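(* Let $\mathcal H$ be a separable Hilbert space, let $\mathfrak i$ be a stable Calkin space and let $\mathrm s$ be an $s$-function. Let $\Phi$ be an elementary operator on $\mathbf B(\mathcal H)$ (respectively, on $\mathbf K(\mathcal H)$). Then $\mathrm s(\Phi)\in\mathfrak i$ if and only if there exist $m\in\mathbb N$ and $A_i,B_i\in\mathbf B(\mathcal H)$, $i=1,\dots,m$, such that $\Phi=\sum_{i=1}^m M_{A_i,B_i}$ and $s(A_i),s(B_i)\in\mathfrak i$ for $i=1,\dots,m$.
   Context: $M_{A,B}$ denotes the operator $X\mapsto AXB$ (on $\mathbf B(\mathcal H)$, resp. on $\mathbf K(\mathcal H)$); an elementary operator is a finite sum $\sum_i M_{A_i,B_i}$. For a compact operator $T$, $s(T)$ is its non-increasing sequence of singular numbers; the condition $s(T)\in\mathfrak i$ is understood for compact $T$ (equivalently, $s(T)$ denotes the sequence of approximation numbers $\inf\{\|T-F\|:\mathrm{rank}F<n\}$, which coincides with the singular numbers for compact $T$ and lies in $c_0$ only if $T$ is compact). $c_0$: complex null sequences; for $\alpha\in c_0$, $\alpha^\star$ is the non-increasing rearrangement of $(|\alpha_n|)$. A Calkin space is a linear subspace $\mathfrak i\subseteq c_0$ with: $\alpha\in\mathfrak i$, $\beta\in c_0$, $\beta^\star\le\alpha^\star$ termwise $\Rightarrow\beta\in\mathfrak i$. For $\alpha,\beta\in c_0$, $\alpha\otimes\beta$ is the non-increasing rearrangement (with multiplicities) of $(|\alpha_i\beta_j|)_{i,j}$. $\mathfrak i\otimes\mathfrak i$ is the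 smallest Calkin space containing all $\alpha\otimes\beta$, $\alpha,\beta\in\mathfrak i$; $\mathfrak i$ is stable if $\mathfrak i\otimes\mathfrak i=\mathfrak i$. An $s$-function assigns to every bounded operator $T$ between Banach spaces a sequence $\mathrm s(T)$ of non-negative reals with: $\|T\|=\mathrm s_1(T)\ge\mathrm s_2(T)\ge\cdots$; $\mathrm s_n(S+T)\le\mathrm s_n(S)+\|T\|$; $\mathrm s_n(RST)\le\|R\|\|T\|\mathrm s_n(S)$; $\mathrm s_n(T)=0$ if $\mathrm{rank}T<n$; $\mathrm s_n(I_n)=1$ for the identity of $\ell_2^n$. *)

theory Defs
  imports "HOL-Analysis.Analysis"
begin

definition c0 :: "(nat \<Rightarrow> complex) set" where
  "c0 = {\<alpha>. \<alpha> \<longlonglongrightarrow> 0}"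

text \<open>Non-increasing rearrangement (with multiplicities) of the moduli of a null family
  indexed by an arbitrary (countable) index set, written out as
  dstar f n = inf over sets F of at most n indices of sup of the remaining moduli.
  Sequences are indexed from 0, so dstar f 0 is the largest modulus.\<close>
definition dstar :: "('i \<Rightarrow> 'a::real_normed_vector) \<Rightarrow> nat \<Rightarrow> real" where
  "dstar f n = Inf {Sup ((\<lambda>k. norm (f k)) ` (- F) \<union> {0}) | F. finite F \<and> card F \<le> n}"

definition calkin_space :: "(nat \<Rightarrow> complex) set \<Rightarrow> bool" where
  "calkin_space I \<longleftrightarrow> I \<subseteq> c0 \<and> (\<lambda>n. 0) \<in> I
     \<and> (\<forall>\<alpha>\<in>I. \<forall>\<beta>\<in>I. (\<lambda>n. \<alpha> n + \<beta> n) \<in> I)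
     \<and> (\<forall>c. \<forall>\<alpha>\<in>I. (\<lambda>n. c * \<alpha> n) \<in> I)
     \<and> (\<forall>\<alpha>\<in>I. \<forall>\<beta>\<in>c0. (\<forall>n. dstar \<beta> n \<le> dstar \<alpha> n) \<longrightarrow> \<beta> \<in> I)"

definition seq_tensor :: "(nat \<Rightarrow> complex) \<Rightarrow> (nat \<Rightarrow> complex) \<Rightarrow> nat \<Rightarrow> complex" where
  "seq_tensor \<alpha> \<beta> = (\<lambda>n. complex_of_real (dstar (\<lambda>(i::nat, j::nat). \<alpha> i * \<beta> j) n))"

definition calkin_tensor :: "(nat \<Rightarrow> complex) set \<Rightarrow> (nat \<Rightarrow> complex) set" where
  "calkin_tensor I = \<Inter> {J. calkin_space J \<and> (\<forall>\<alpha>\<in>I. \<forall>\<beta>\<in>I. seq_tensor \<alpha> \<beta> \<in> J)}"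

definition stable_calkin :: "(nat \<Rightarrow> complex) set \<Rightarrow> bool" where
  "stable_calkin I \<longleftrightarrow> calkin_space I \<and> calkin_tensor I = I"

text \<open>A complex Hilbert space is a real Hilbert space 'h together with an orthogonal
  complex structure J (multiplication by i).\<close>
definition cplx_structure :: "('h::real_inner \<Rightarrow> 'h) \<Rightarrow> bool" where
  "cplx_structure J \<longleftrightarrow> linear J \<and> (\<forall>x. J (J x) = - x) \<and> (\<forall>x y. inner (J x) (J y) = inner x y)"

definition hscale :: "('h::real_vector \<Rightarrow> 'h) \<Rightarrow> complex \<Rightarrow> 'h \<Rightarrow> 'h" where
  "hscale J c x = Re c *\<^sub>R x + Im c *\<^sub>R J x"

definition Bop :: "('h::real_inner \<Rightarrow> 'h) \<Rightarrow> ('h \<Rightarrow> 'h) set" where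
  "Bop J = {T. bounded_linear T \<and> (\<forall>x. T (J x) = J (T x))}"

definition compact_operator :: "('h::real_normed_vector \<Rightarrow> 'h) \<Rightarrow> bool" where
  "compact_operator T \<longleftrightarrow> compact (closure (T ` cball 0 1))"

definition Kop :: "('h::real_inner \<Rightarrow> 'h) \<Rightarrow> ('h \<Rightarrow> 'h) set" where
  "Kop J = {T \<in> Bop J. compact_operator T}"

definition hspan :: "('h::real_vector \<Rightarrow> 'h) \<Rightarrow> 'h set \<Rightarrow> 'h set" where
  "hspan J B = {(\<Sum>b\<in>B. hscale J (c b) b) | c. True}"

definition rank_le :: "('h::real_vector \<Rightarrow> 'h) \<Rightarrow> ('h \<Rightarrow> 'h) \<Rightarrow> nat \<Rightarrow> bool" where
  "rank_le J F n \<longleftrightarrow> (\<exists>B. finite B \<and> card B \<le> n \<and> range F \<subseteq> hspan J B)"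

text \<open>Approximation numbers of an operator on H, indexed from 0:
  approx_num J T n = inf { norm (T - F) : F in B(H), rank F < n+1 }.
  For compact T these are the singular numbers s(T).\<close>
definition approx_num :: "('h::real_inner \<Rightarrow> 'h) \<Rightarrow> ('h \<Rightarrow> 'h) \<Rightarrow> nat \<Rightarrow> real" where
  "approx_num J T n = Inf {onorm (\<lambda>x. T x - F x) | F. F \<in> Bop J \<and> rank_le J F n}"

definition sing_seq :: "('h::real_inner \<Rightarrow> 'h) \<Rightarrow> ('h \<Rightarrow> 'h) \<Rightarrow> nat \<Rightarrow> complex" where
  "sing_seq J T = (\<lambda>n. complex_of_real (approx_num J T n))"

definition uadd :: "('h \<Rightarrow> 'h::real_vector) \<Rightarrow> ('h \<Rightarrow> 'h) \<Rightarrow> 'h \<Rightarrow> 'h" where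
  "uadd f g = (\<lambda>x. f x + g x)"
definition usub :: "('h \<Rightarrow> 'h::real_vector) \<Rightarrow> ('h \<Rightarrow> 'h) \<Rightarrow> 'h \<Rightarrow> 'h" where
  "usub f g = (\<lambda>x. f x - g x)"
definition uzero :: "'h \<Rightarrow> 'h::real_vector" where
  "uzero = (\<lambda>x. 0)"
definition uscale :: "('h::real_vector \<Rightarrow> 'h) \<Rightarrow> complex \<Rightarrow> ('h \<Rightarrow> 'h) \<Rightarrow> 'h \<Rightarrow> 'h" where
  "uscale J c f = (\<lambda>x. hscale J c (f x))"

type_synonym 'h bspace = "('h \<Rightarrow> 'h) set \<times> (('h \<Rightarrow> 'h) \<Rightarrow> real)"

definition is_bspace :: "('h::real_vector \<Rightarrow> 'h) \<Rightarrow> 'h bspace \<Rightarrow> bool" where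
  "is_bspace J E \<longleftrightarrow> (case E of (V, N) \<Rightarrow>
     uzero \<in> V \<and> (\<forall>f\<in>V. \<forall>g\<in>V. uadd f g \<in> V) \<and> (\<forall>c. \<forall>f\<in>V. uscale J c f \<in> V)
     \<and> (\<forall>f\<in>V. 0 \<le> N f \<and> (N f = 0 \<longleftrightarrow> f = uzero))
     \<and> (\<forall>f\<in>V. \<forall>g\<in>V. N (uadd f g) \<le> N f + N g)
     \<and> (\<forall>c. \<forall>f\<in>V. N (uscale J c f) = cmod c * N f)
     \<and> (\<forall>X. (\<forall>n. X n \<in> V) \<and> (\<forall>e>0. \<exists>M. \<forall>m\<ge>M. \<forall>n\<ge>M. N (usub (X m) (X n)) < e)
            \<longrightarrow> (\<exists>l\<in>V. (\<lambda>n. N (usub (X n) l)) \<longlonglongrightarrow> 0)))"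

definition is_bop :: "('h::real_vector \<Rightarrow> 'h) \<Rightarrow> 'h bspace \<Rightarrow> 'h bspace \<Rightarrow> (('h \<Rightarrow> 'h) \<Rightarrow> ('h \<Rightarrow> 'h)) \<Rightarrow> bool" where
  "is_bop J E F T \<longleftrightarrow> (case E of (V, N) \<Rightarrow> case F of (W, M) \<Rightarrow>
     (\<forall>f\<in>V. T f \<in> W) \<and> (\<forall>f. f \<notin> V \<longrightarrow> T f = uzero)
     \<and> (\<forall>f\<in>V. \<forall>g\<in>V. T (uadd f g) = uadd (T f) (T g))
     \<and> (\<forall>c. \<forall>f\<in>V. T (uscale J c f) = uscale J c (T f))
     \<and> (\<exists>K. \<forall>f\<in>V. M (T f) \<le> K * N f))"

definition op_norm :: "'h bspace \<Rightarrow> 'h bspace \<Rightarrow> (('h \<Rightarrow> 'h) \<Rightarrow> ('h \<Rightarrow> 'h)) \<Rightarrow> real" where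
  "op_norm E F T = (case E of (V, N) \<Rightarrow> case F of (W, M) \<Rightarrow>
     Sup ({M (T f) | f. f \<in> V \<and> N f \<le> 1} \<union> {0}))"

definition uspan :: "('h::real_vector \<Rightarrow> 'h) \<Rightarrow> ('h \<Rightarrow> 'h) set \<Rightarrow> ('h \<Rightarrow> 'h) set" where
  "uspan J B = {(\<lambda>x. \<Sum>b\<in>B. hscale J (c b) (b x)) | c. True}"

definition op_rank_le :: "('h::real_vector \<Rightarrow> 'h) \<Rightarrow> 'h bspace \<Rightarrow> (('h \<Rightarrow> 'h) \<Rightarrow> ('h \<Rightarrow> 'h)) \<Rightarrow> nat \<Rightarrow> bool" where
  "op_rank_le J E T n \<longleftrightarrow> (\<exists>B. finite B \<and> card B \<le> n \<and> T ` fst E \<subseteq> uspan J B)"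

definition is_l2n :: "('h::real_vector \<Rightarrow> 'h) \<Rightarrow> 'h bspace \<Rightarrow> nat \<Rightarrow> bool" where
  "is_l2n J E n \<longleftrightarrow> (\<exists>e :: nat \<Rightarrow> ('h \<Rightarrow> 'h).
     fst E = {(\<lambda>x. \<Sum>i<n. hscale J (c i) (e i x)) | c. True}
     \<and> (\<forall>c. snd E (\<lambda>x. \<Sum>i<n. hscale J (c i) (e i x)) = sqrt (\<Sum>i<n. (cmod (c i))\<^sup>2)))"

definition id_on :: "'h bspace \<Rightarrow> ('h \<Rightarrow> 'h) \<Rightarrow> ('h \<Rightarrow> 'h::real_vector)" where
  "id_on E = (\<lambda>f. if f \<in> fst E then f else uzero)"

text \<open>s-functions (sequences indexed from 0, so s E F T n is s_{n+1}(T)).\<close>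
definition s_function ::
  "('h::real_vector \<Rightarrow> 'h) \<Rightarrow> ('h bspace \<Rightarrow> 'h bspace \<Rightarrow> (('h \<Rightarrow> 'h) \<Rightarrow> ('h \<Rightarrow> 'h)) \<Rightarrow> nat \<Rightarrow> real) \<Rightarrow> bool" where
  "s_function J s \<longleftrightarrow>
     (\<forall>E F T. is_bspace J E \<and> is_bspace J F \<and> is_bop J E F T \<longrightarrow>
        s E F T 0 = op_norm E F T \<and> (\<forall>n. 0 \<le> s E F T n \<and> s E F T (Suc n) \<le> s E F T n))
   \<and> (\<forall>E F S T n. is_bspace J E \<and> is_bspace J F \<and> is_bop J E F S \<and> is_bop J E F T \<longrightarrow>
        s E F (\<lambda>f. uadd (S f) (T f)) n \<le> s E F S n + op_norm E F T)
   \<and> (\<forall>E0 E F F0 R S T n. is_bspace J E0 \<and> is_bspace J E \<and> is_bspace J F \<and> is_bspace J F0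
        \<and> is_bop J E0 E T \<and> is_bop J E F S \<and> is_bop J F F0 R \<longrightarrow>
        s E0 F0 (R \<circ> S \<circ> T) n \<le> op_norm F F0 R * op_norm E0 E T * s E F S n)
   \<and> (\<forall>E F T n. is_bspace J E \<and> is_bspace J F \<and> is_bop J E F T \<and> op_rank_le J E T n \<longrightarrow>
        s E F T n = 0)
   \<and> (\<forall>E n. is_bspace J E \<and> is_l2n J E (Suc n) \<longrightarrow> s E E (id_on E) n = 1)"

definition BH :: "('h::real_inner \<Rightarrow> 'h) \<Rightarrow> 'h bspace" where
  "BH J = (Bop J, onorm)"

definition KH :: "('h::real_inner \<Rightarrow> 'h) \<Rightarrow> 'h bspace" where
  "KH J = (Kop J, onorm)"

definition elem_op :: "'h bspace \<Rightarrow> nat \<Rightarrow> (nat \<Rightarrow> 'h \<Rightarrow> 'h) \<Rightarrow> (nat \<Rightarrow> 'h \<Rightarrow> 'h)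
    \<Rightarrow> ('h \<Rightarrow> 'h) \<Rightarrow> ('h \<Rightarrow> 'h::real_vector)" where
  "elem_op E m A B = (\<lambda>X. if X \<in> fst E then (\<lambda>x. \<Sum>i<m. A i (X (B i x))) else uzero)"

definition elementary_op :: "('h::real_inner \<Rightarrow> 'h) \<Rightarrow> 'h bspace \<Rightarrow> (('h \<Rightarrow> 'h) \<Rightarrow> ('h \<Rightarrow> 'h)) \<Rightarrow> bool" where
  "elementary_op J E \<Phi> \<longleftrightarrow> (\<exists>m A B. (\<forall>i<m. A i \<in> Bop J \<and> B i \<in> Bop J) \<and> \<Phi> = elem_op E m A B)"

end

theory Submission
  imports Defs
begin

text \<open>
  Suppose first that the coefficients have singular numbers in \<open>I\<close>. Group the singular
  vectors of \<open>A\<close> and \<open>B\<close> by the dyadic level of their singular numbers. The blocks of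
  \<open>X \<mapsto> A X B\<close> whose two levels add up to \<open>M\<close> have mutually orthogonal ranges and mutually orthogonal
  supports, so their sum has norm of order \<open>2\<^sup>-\<^sup>M\<close> only. Keeping the levels with sum below \<open>N\<close>
  therefore shows that the approximation numbers of \<open>X \<mapsto> A X B\<close>, which dominate every
  \<open>s\<close>-function, are bounded by a multiple of \<open>s(A) \<otimes> s(B)\<close>; stability of \<open>I\<close> does the rest.

  Conversely, in a representation of minimal length the \<open>A\<^sub>i\<close> are linearly independent and so are
  the \<open>B\<^sub>i\<close>. Hence \<open>A\<^sub>j\<close> is a linear combination of operators \<open>S \<xi> = \<Phi> (\<xi> \<otimes> y) x\<close>. If
  \<open>S\<close> has large approximation number \<open>2 n\<close>, then there are \<open>n + 1\<close> orthonormal vectors with large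
  orthogonal images under \<open>S\<close>, through which the identity of \<open>\<ell>\<^sub>2\<^sup>n\<^sup>+\<^sup>1\<close> factors via \<open>\<Phi>\<close>. This
  bounds the approximation numbers of \<open>S\<close> by those \<open>s\<close>-numbers of \<open>\<Phi>\<close> with half the index. The
  argument for \<open>B\<^sub>j\<close> is dual.
\<close>

section \<open>Calkin spaces\<close>

text \<open>The axioms of an s-function are weak: none of them bounds the value of a sum at index
  \<open>m + n\<close> by the values of the summands at \<open>m\<close> and \<open>n\<close>. Sums
  of elementary operators are therefore never handled on the level of \<open>s\<close>; finite-rank
  approximants are added, and \<open>s\<close> enters only through the approximation error. In the
  converse direction nothing is known beforehand about compactness of the coefficients, so no
  singular value decomposition of \<open>S\<close> can be used. Vectors are chosen greedily instead:
  each new one must be orthogonal to the earlier ones and its image orthogonal to the earlier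
  images. This costs two linear conditions per earlier vector and is the origin of the index
  \<open>2 * n\<close>. The loss is harmless, since Calkin spaces absorb the passage from
  \<open>g n\<close> to \<open>g (n div 2)\<close>; the same passage pays for adding ranks.\<close>

lemma dstar_bdd_below:
  fixes f :: "'i \<Rightarrow> 'a::real_normed_vector"
  assumes "\<And>k. norm (f k) \<le> M"
  shows "bdd_above ((\<lambda>k. norm (f k)) ` (- F))"
    and "bdd_below {Sup ((\<lambda>k. norm (f k)) ` (- F) \<union> {0}) | F. finite F \<and> card F \<le> n}"
proof -
  show bdd: "bdd_above ((\<lambda>k. norm (f k)) ` (- F))" for F
    using assms by (intro bdd_aboveI[of _ M]) auto
  show "bdd_below {Sup ((\<lambda>k. norm (f k)) ` (- F) \<union> {0}) | F. finite F \<and> card F \<le> n}"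
    using bdd by (intro bdd_belowI[of _ 0]) (force intro: cSup_upper)
qed

lemma dstar_le:
  fixes f :: "'i \<Rightarrow> 'a::real_normed_vector"
  assumes "\<And>k. norm (f k) \<le> M" "finite F" "card F \<le> n" "\<And>k. k \<notin> F \<Longrightarrow> norm (f k) \<le> t" "0 \<le> t"
  shows "dstar f n \<le> t"
proof -
  have "dstar f n \<le> Sup ((\<lambda>k. norm (f k)) ` (- F) \<union> {0})"
    unfolding dstar_def using assms by (intro cInf_lower dstar_bdd_below(2)) auto
  also have "\<dots> \<le> t" using assms by (intro cSup_least) auto
  finally show ?thesis .
qed

lemma dstar_nonneg:
  fixes f :: "'i \<Rightarrow> 'a::real_normed_vector"
  assumes "\<And>k. norm (f k) \<le> M"
  shows "0 \<le> dstar f n"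
  unfolding dstar_def
proof (rule cInf_greatest)
  show "{Sup ((\<lambda>k. norm (f k)) ` (- F) \<union> {0}) | F. finite F \<and> card F \<le> n} \<noteq> {}"
    by (auto intro!: exI[of _ "{}"])
  fix x assume "x \<in> {Sup ((\<lambda>k. norm (f k)) ` (- F) \<union> {0}) | F. finite F \<and> card F \<le> n}"
  then obtain F where x: "x = Sup ((\<lambda>k. norm (f k)) ` (- F) \<union> {0})" by auto
  show "0 \<le> x" unfolding x
    by (rule cSup_upper) (use dstar_bdd_below(1)[of f M F, OF assms] in auto)
qed

lemma dstar_antimono:
  fixes f :: "'i \<Rightarrow> 'a::real_normed_vector"
  assumes "\<And>k. norm (f k) \<le> M" "m \<le> n"
  shows "dstar f n \<le> dstar f m"
  unfolding dstar_def
proof (rule cInf_superset_mono)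
  show "{Sup ((\<lambda>k. norm (f k)) ` (- F) \<union> {0}) | F. finite F \<and> card F \<le> m} \<noteq> {}"
    by (auto intro!: exI[of _ "{}"])
  show "bdd_below {Sup ((\<lambda>k. norm (f k)) ` (- F) \<union> {0}) | F. finite F \<and> card F \<le> n}"
    by (rule dstar_bdd_below(2)[OF assms(1)])
qed (use assms(2) in auto)

text \<open>The infimum in \<open>dstar\<close> is approached but not claimed to be attained, so an
  exceptional set is extracted from a strict bound only. This is the counting form in which
  rearrangements are used later.\<close>

lemma dstar_lessD:
  fixes f :: "'i \<Rightarrow> 'a::real_normed_vector"
  assumes "\<And>k. norm (f k) \<le> M" "dstar f n < t"
  obtains F where "finite F" "card F \<le> n" "\<And>k. k \<notin> F \<Longrightarrow> norm (f k) < t"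
proof -
  have "{Sup ((\<lambda>k. norm (f k)) ` (- F) \<union> {0}) | F. finite F \<and> card F \<le> n} \<noteq> {}"
    by (auto intro!: exI[of _ "{}"])
  from cInf_lessD[OF this assms(2)[unfolded dstar_def]]
  obtain F where F: "finite F" "card F \<le> n" "Sup ((\<lambda>k. norm (f k)) ` (- F) \<union> {0}) < t" by auto
  have "norm (f k) < t" if "k \<notin> F" for k
  proof -
    have "norm (f k) \<le> Sup ((\<lambda>k. norm (f k)) ` (- F) \<union> {0})"
      by (rule cSup_upper) (use that dstar_bdd_below(1)[of f M F, OF assms(1)] in auto)
    thus ?thesis using F by simp
  qed
  thus ?thesis using F that by blast
qed

text \<open>Pigeonhole: at most \<open>n\<close> removed indices cannot cover \<open>{..n}\<close>,
  and a surviving index \<open>k \<le> n\<close> has \<open>g k \<ge> g n\<close>.\<close>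

lemma dstar_decseq_ge:
  fixes g :: "nat \<Rightarrow> real"
  assumes "decseq g" "\<And>n. 0 \<le> g n"
  shows "g n \<le> dstar (\<lambda>k. complex_of_real (g k)) n"
  unfolding dstar_def
proof (rule cInf_greatest)
  show "{Sup ((\<lambda>k. cmod (complex_of_real (g k))) ` (- F) \<union> {0}) | F. finite F \<and> card F \<le> n} \<noteq> {}"
    by (auto intro!: exI[of _ "{}"])
next
  fix x assume "x \<in> {Sup ((\<lambda>k. cmod (complex_of_real (g k))) ` (- F) \<union> {0}) | F. finite F \<and> card F \<le> n}"
  then obtain F where F: "finite F" "card F \<le> n" and x: "x = Sup ((\<lambda>k. cmod (complex_of_real (g k))) ` (- F) \<union> {0})"
    by auto
  have "\<not> {..n} \<subseteq> F" using card_mono[OF F(1), of "{..n}"] F(2) by auto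
  then obtain k where k: "k \<le> n" "k \<notin> F" by auto
  have "g n \<le> g k" using assms(1) k by (simp add: decseq_def)
  also have "g k \<le> x" unfolding x
  proof (rule cSup_upper)
    show "g k \<in> (\<lambda>k. cmod (complex_of_real (g k))) ` (- F) \<union> {0}"
      using k assms(2)[of k] by (auto intro!: image_eqI[of _ _ k])
    have "bdd_above ((\<lambda>k. cmod (complex_of_real (g k))) ` (- F))"
      by (rule dstar_bdd_below(1)[of _ "g 0"]) (use assms in \<open>auto simp: decseq_def\<close>)
    thus "bdd_above ((\<lambda>k. cmod (complex_of_real (g k))) ` (- F) \<union> {0})" by simp
  qed
  finally show "g n \<le> x" .
qed

lemma c0_bounded:
  assumes "\<alpha> \<in> c0"
  obtains M where "0 \<le> M" "\<And>n. cmod (\<alpha> n) \<le> M"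
proof -
  have "Bseq \<alpha>" using assms unfolding c0_def by (auto intro: convergent_imp_Bseq convergentI)
  then obtain M where "0 < M" "\<And>n. cmod (\<alpha> n) \<le> M" by (auto simp: Bseq_def)
  thus ?thesis using that[of M] by simp
qed

text \<open>The defining axiom compares rearrangements. A set that is exceptional for
  \<open>\<alpha>\<close> is also exceptional for anything termwise dominated by
  \<open>\<alpha>\<close>, which turns termwise domination into that comparison.\<close>

lemma calkin_mono:
  assumes "calkin_space I" "\<alpha> \<in> I" "\<And>n. cmod (\<beta> n) \<le> cmod (\<alpha> n)"
  shows "\<beta> \<in> I"
proof -
  have \<alpha>: "\<alpha> \<in> c0" using assms unfolding calkin_space_def by auto
  have "\<beta> \<longlonglongrightarrow> 0"
    by (rule Lim_null_comparison[of _ "\<lambda>n. cmod (\<alpha> n)"])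
       (use assms \<alpha> in \<open>auto simp: c0_def tendsto_norm_zero_iff\<close>)
  hence \<beta>: "\<beta> \<in> c0" by (simp add: c0_def)
  obtain M where M: "0 \<le> M" "\<And>n. cmod (\<alpha> n) \<le> M" using c0_bounded[OF \<alpha>] by blast
  have "dstar \<beta> n \<le> dstar \<alpha> n" for n
  proof (rule field_le_epsilon)
    fix e :: real assume e: "0 < e"
    have "dstar \<alpha> n < dstar \<alpha> n + e" using e by simp
    from dstar_lessD[OF M(2) this] obtain F where F: "finite F" "card F \<le> n"
      "\<And>k. k \<notin> F \<Longrightarrow> cmod (\<alpha> k) < dstar \<alpha> n + e" by blast
    show "dstar \<beta> n \<le> dstar \<alpha> n + e"
    proof (rule dstar_le[OF _ F(1,2)])
      show "cmod (\<beta> k) \<le> M" for k using M assms(3) order_trans by blast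
      show "cmod (\<beta> k) \<le> dstar \<alpha> n + e" if "k \<notin> F" for k
        using F(3)[OF that] assms(3)[of k] by simp
      show "0 \<le> dstar \<alpha> n + e" using dstar_nonneg[of \<alpha>, OF M(2)] e by simp
    qed
  qed
  thus ?thesis using assms \<beta> unfolding calkin_space_def by blast
qed

lemma calkin_add:
  assumes "calkin_space I" "\<alpha> \<in> I" "\<beta> \<in> I"
  shows "(\<lambda>n. \<alpha> n + \<beta> n) \<in> I"
  using assms unfolding calkin_space_def by blast

lemma calkin_scale:
  assumes "calkin_space I" "\<alpha> \<in> I"
  shows "(\<lambda>n. c * \<alpha> n) \<in> I"
  using assms unfolding calkin_space_def by blast

text \<open>The doubled sequence is the sum of two sequences, each obtained from the original one by
  inserting zeros, which does not change the rearrangement.\<close>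
lemma calkin_double:
  fixes g :: "nat \<Rightarrow> real"
  assumes I: "calkin_space I" and g: "decseq g" "\<And>n. 0 \<le> g n" "(\<lambda>n. complex_of_real (g n)) \<in> I"
  shows "(\<lambda>n. complex_of_real (g (n div 2))) \<in> I"
proof -
  have g0: "(\<lambda>n. complex_of_real (g n)) \<in> c0" using assms unfolding calkin_space_def by auto
  hence "(\<lambda>n. complex_of_real (g n)) \<longlonglongrightarrow> 0" by (simp add: c0_def)
  hence lim: "g \<longlonglongrightarrow> 0" using tendsto_of_real_iff[of g 0, where 'a=complex] by simp
  have "filterlim (\<lambda>n::nat. n div 2) at_top at_top"
    unfolding filterlim_at_top
  proof
    fix Z :: nat
    show "eventually (\<lambda>n. Z \<le> n div 2) at_top"
      using eventually_ge_at_top[of "2 * Z"] by eventually_elim simp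
  qed
  from filterlim_compose[OF lim this] have lim2: "(\<lambda>n. g (n div 2)) \<longlonglongrightarrow> 0" .
  have *: "(\<lambda>n. if n mod 2 = r then complex_of_real (g (n div 2)) else 0) \<in> I" (is "?h \<in> I")
    if r: "r < 2" for r
  proof -
    have b: "cmod (?h n) \<le> g (n div 2)" for n using g(2) by auto
    have "?h \<longlonglongrightarrow> 0"
      by (rule Lim_null_comparison[OF _ lim2]) (use b in auto)
    hence h: "?h \<in> c0" by (simp add: c0_def)
    have "dstar ?h n \<le> dstar (\<lambda>n. complex_of_real (g n)) n" for n
    proof -
      \<comment> \<open>The removed set consists of the first \<open>n\<close> positions of residue
        class \<open>r\<close>; they carry the values \<open>g 0, ..., g (n - 1)\<close>, and
        everything else is zero or at most \<open>g n\<close>.\<close>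
      have "dstar ?h n \<le> g n"
      proof (rule dstar_le[where M = "g 0" and F = "(\<lambda>k. 2 * k + r) ` {..<n}"])
        show "cmod (?h k) \<le> g 0" for k
          by (rule order_trans[OF b]) (use g(1) in \<open>simp add: decseq_def\<close>)
        show "card ((\<lambda>k. 2 * k + r) ` {..<n}) \<le> n" using card_image_le[of "{..<n}"] by simp
        show "cmod (?h k) \<le> g n" if "k \<notin> (\<lambda>k. 2 * k + r) ` {..<n}" for k
        proof (cases "k mod 2 = r")
          case True
          hence "k = 2 * (k div 2) + r" by auto
          hence "\<not> k div 2 < n" using that by blast
          hence "n \<le> k div 2" by simp
          hence "g (k div 2) \<le> g n" using g(1) by (simp add: decseq_def)
          thus ?thesis using b[of k] by linarith
        qed (use g in auto)
      qed (use g in auto)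
      also have "\<dots> \<le> dstar (\<lambda>n. complex_of_real (g n)) n" by (rule dstar_decseq_ge[OF g(1,2)])
      finally show ?thesis .
    qed
    thus ?thesis using I g(3) h unfolding calkin_space_def by blast
  qed
  have "(\<lambda>n. (if n mod 2 = 0 then complex_of_real (g (n div 2)) else 0) +
             (if n mod 2 = 1 then complex_of_real (g (n div 2)) else 0)) \<in> I"
    by (rule calkin_add[OF I *[of 0] *[of 1]]) auto
  moreover have "(\<lambda>n. (if n mod 2 = 0 then complex_of_real (g (n div 2)) else 0) +
             (if n mod 2 = 1 then complex_of_real (g (n div 2)) else 0)) =
     (\<lambda>n. complex_of_real (g (n div 2)))"
    by (auto simp: fun_eq_iff)
  ultimately show ?thesis by simp
qed

lemma seq_tensor_mem:
  assumes "stable_calkin I" "\<alpha> \<in> I" "\<beta> \<in> I"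
  shows "seq_tensor \<alpha> \<beta> \<in> I"
proof -
  have "seq_tensor \<alpha> \<beta> \<in> calkin_tensor I" using assms by (auto simp: calkin_tensor_def)
  thus ?thesis using assms by (simp add: stable_calkin_def)
qed

section \<open>Complex Hilbert spaces\<close>

locale hilbert =
  fixes J :: "'h::{real_inner, complete_space} \<Rightarrow> 'h"
  assumes cplx: "cplx_structure J"
begin

abbreviation hs :: "complex \<Rightarrow> 'h \<Rightarrow> 'h" where "hs \<equiv> hscale J"

lemma linear_J: "linear J" and J_J [simp]: "J (J x) = - x" and inner_J_J [simp]: "inner (J x) (J y) = inner x y"
  using cplx by (auto simp: cplx_structure_def)

lemma J_add: "J (x + y) = J x + J y" and J_scaleR: "J (r *\<^sub>R x) = r *\<^sub>R J x"
  and J_diff: "J (x - y) = J x - J y" and J_zero [simp]: "J 0 = 0" and J_minus: "J (- x) = - J x"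
  using linear_J by (simp_all add: linear_add linear_scale linear_diff linear_0 linear_neg)

lemma inner_J_left: "inner (J x) y = - inner x (J y)"
  using inner_J_J[of x "J y"] by simp

lemma inner_J_self [simp]: "inner x (J x) = 0" "inner (J x) x = 0"
  using inner_J_left[of x x] by (simp_all add: inner_commute)

sublocale cv: vector_space "hscale J"
  by unfold_locales (simp_all add: hscale_def algebra_simps J_add J_scaleR)

lemma hs_of_real: "hs (complex_of_real r) x = r *\<^sub>R x"
  by (simp add: hscale_def)

lemma hs_ii: "hs \<i> x = J x"
  by (simp add: hscale_def)

text \<open>The complex inner product recovered from the real one. As \<open>J\<close> is skew, this
  choice of imaginary part makes it linear in the first and conjugate-linear in the second
  argument.\<close>

definition cip :: "'h \<Rightarrow> 'h \<Rightarrow> complex" where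
  "cip x y = Complex (inner x y) (inner x (J y))"

lemma cip_add_left: "cip (x + y) z = cip x z + cip y z"
  and cip_diff_left: "cip (x - y) z = cip x z - cip y z"
  and cip_zero_left [simp]: "cip 0 z = 0"
  and cip_hs_left: "cip (hs c x) z = c * cip x z"
  by (simp_all add: cip_def hscale_def complex_eq_iff inner_add_left inner_diff_left inner_J_left algebra_simps)

lemma cip_commute: "cip y x = cnj (cip x y)"
  using inner_J_left[of x y] by (simp add: cip_def complex_eq_iff inner_commute)

lemma cip_add_right: "cip z (x + y) = cip z x + cip z y"
  and cip_zero_right [simp]: "cip z 0 = 0"
  and cip_hs_right: "cip z (hs c x) = cnj c * cip z x"
  using cip_commute[of z] by (simp_all add: cip_add_left cip_hs_left)

lemma cip_sum_left: "cip (sum f S) z = (\<Sum>i\<in>S. cip (f i) z)"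
  by (induction S rule: infinite_finite_induct) (simp_all add: cip_add_left)

lemma cip_sum_right: "cip z (sum f S) = (\<Sum>i\<in>S. cip z (f i))"
  by (induction S rule: infinite_finite_induct) (simp_all add: cip_add_right)

lemma Re_cip: "Re (cip x y) = inner x y"
  by (simp add: cip_def)

lemma cip_self: "cip x x = complex_of_real ((norm x)\<^sup>2)"
  by (simp add: cip_def complex_eq_iff power2_norm_eq_inner)

lemma cip_eq_0I: "inner x y = 0 \<Longrightarrow> inner x (J y) = 0 \<Longrightarrow> cip x y = 0"
  by (simp add: cip_def complex_eq_iff)

lemma cip_eq_0D: "cip x y = 0 \<Longrightarrow> inner x y = 0" "cip x y = 0 \<Longrightarrow> inner x (J y) = 0"
  by (simp_all add: cip_def complex_eq_iff)

lemma cip_eq_0_commute: "cip x y = 0 \<longleftrightarrow> cip y x = 0"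
  by (metis cip_commute complex_cnj_zero_iff)

lemma cip_ext:
  assumes "\<And>y. cip x y = cip z y" shows "x = z"
proof -
  have "cip (x - z) (x - z) = 0" using assms by (simp add: cip_diff_left)
  thus ?thesis by (simp add: cip_self)
qed

lemma norm_hs [simp]: "norm (hs c x) = cmod c * norm x"
proof -
  have "cip (hs c x) (hs c x) = (c * cnj c) * cip x x"
    by (simp add: cip_hs_left cip_hs_right)
  also have "c * cnj c = complex_of_real ((cmod c)\<^sup>2)"
    by (simp add: complex_norm_square del: of_real_power)
  finally have "(norm (hs c x))\<^sup>2 = (cmod c * norm x)\<^sup>2"
    unfolding cip_self power_mult_distrib by (metis of_real_eq_iff of_real_mult)
  thus ?thesis by (simp add: power2_eq_iff_nonneg)
qed

lemma cmod_cip_le: "cmod (cip x y) \<le> norm x * norm y"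
proof (cases "cip x y = 0")
  case False
  \<comment> \<open>A phase rotating \<open>cip x y\<close> onto the positive real axis, so that the
    real Cauchy-Schwarz inequality applies.\<close>
  define c where "c = cnj (sgn (cip x y))"
  have c: "cmod c = 1" using False by (simp add: c_def norm_sgn)
  have "c * cip x y = cmod (cip x y)"
    using complex_norm_square[of "cip x y"] False
    by (simp add: c_def sgn_eq power2_eq_square field_simps)
  hence "cip (hs c x) y = cmod (cip x y)" by (simp add: cip_hs_left)
  hence "cmod (cip x y) = inner (hs c x) y" using Re_cip[of "hs c x" y] by simp
  also have "\<dots> \<le> norm (hs c x) * norm y" by (rule norm_cauchy_schwarz)
  finally show ?thesis using c by simp
qed simp

lemma bounded_linear_hs: "bounded_linear (hs c)"
proof (rule bounded_linear_intro)
  show "hs c (x + y) = hs c x + hs c y" for x y by (rule cv.scale_right_distrib)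
  show "hs c (r *\<^sub>R x) = r *\<^sub>R hs c x" for r x
    by (metis cv.scale_scale hs_of_real mult.commute)
  show "norm (hs c x) \<le> norm x * cmod c" for x by simp
qed

lemma bounded_linear_hs_left: "bounded_linear (\<lambda>c. hs c x)"
proof (rule bounded_linear_intro)
  show "hs (r *\<^sub>R c) x = r *\<^sub>R hs c x" for r c
    by (simp add: hscale_def algebra_simps)
  show "norm (hs c x) \<le> norm c * norm x" for c by simp
qed (rule cv.scale_left_distrib)

lemma J_hs: "J (hs c x) = hs c (J x)"
  by (simp add: hscale_def J_add J_scaleR J_minus)

lemma J_sum: "J (sum f S) = (\<Sum>i\<in>S. J (f i))"
  by (simp add: linear_J linear_sum)

lemma BopD: "T \<in> Bop J \<Longrightarrow> bounded_linear T" "T \<in> Bop J \<Longrightarrow> T (J x) = J (T x)"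
  by (auto simp: Bop_def)

lemma Bop_hs: "T \<in> Bop J \<Longrightarrow> T (hs c x) = hs c (T x)"
  using BopD(1)[of T] BopD(2)[of T x]
  by (simp add: hscale_def linear_add linear_scale bounded_linear.linear)

lemma Bop_add: "T \<in> Bop J \<Longrightarrow> T (x + y) = T x + T y"
  and Bop_diff: "T \<in> Bop J \<Longrightarrow> T (x - y) = T x - T y"
  and Bop_0: "T \<in> Bop J \<Longrightarrow> T 0 = 0"
  and Bop_sum: "T \<in> Bop J \<Longrightarrow> T (sum f S) = (\<Sum>i\<in>S. T (f i))"
  using BopD(1)[THEN bounded_linear.linear]
  by (auto simp: linear_add linear_diff linear_0 linear_sum)

lemma Bop_norm_le: "T \<in> Bop J \<Longrightarrow> norm (T x) \<le> onorm T * norm x"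
  by (simp add: BopD(1) onorm)

lemma Bop_onorm_nonneg: "T \<in> Bop J \<Longrightarrow> 0 \<le> onorm T"
  by (simp add: BopD(1) onorm_pos_le)

lemma Bop_plus: "S \<in> Bop J \<Longrightarrow> T \<in> Bop J \<Longrightarrow> (\<lambda>x. S x + T x) \<in> Bop J"
  and Bop_minus: "S \<in> Bop J \<Longrightarrow> T \<in> Bop J \<Longrightarrow> (\<lambda>x. S x - T x) \<in> Bop J"
  by (auto simp: Bop_def bounded_linear_add bounded_linear_sub J_add J_diff)

lemma Bop_scale: "T \<in> Bop J \<Longrightarrow> (\<lambda>x. hs c (T x)) \<in> Bop J"
  by (auto simp: Bop_def J_hs intro: bounded_linear_compose[OF bounded_linear_hs])

lemma Bop_zero: "(\<lambda>x. 0) \<in> Bop J"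
  by (auto simp: Bop_def)

lemma Bop_ident: "(\<lambda>x. x) \<in> Bop J"
  by (auto simp: Bop_def bounded_linear_ident)

lemma Bop_finite_sum: "(\<And>i. i \<in> S \<Longrightarrow> T i \<in> Bop J) \<Longrightarrow> (\<lambda>x. \<Sum>i\<in>S. T i x) \<in> Bop J"
  by (auto simp: Bop_def J_sum intro!: bounded_linear_sum)

lemma Bop_compose: "S \<in> Bop J \<Longrightarrow> T \<in> Bop J \<Longrightarrow> (\<lambda>x. S (T x)) \<in> Bop J"
  by (auto simp: Bop_def intro: bounded_linear_compose)

lemma BopI:
  assumes "\<And>x y. T (x + y) = T x + T y" "\<And>c x. T (hs c x) = hs c (T x)"
    and "\<And>x. norm (T x) \<le> K * norm x"
  shows "T \<in> Bop J"
proof -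
  have "bounded_linear T"
    by (rule bounded_linear_intro[where K = K])
      (use assms(1,3) assms(2)[of "complex_of_real _"] in \<open>auto simp: hs_of_real mult.commute\<close>)
  thus ?thesis using assms(2)[of \<i>] by (simp add: Bop_def hs_ii)
qed

text \<open>The tensor of \<open>u\<close> and \<open>v\<close> from the overview. It is
  conjugate-linear in \<open>v\<close>, which accounts for the conjugates in later test
  maps.\<close>

definition rank1 :: "'h \<Rightarrow> 'h \<Rightarrow> 'h \<Rightarrow> 'h" where
  "rank1 u v = (\<lambda>x. hs (cip x v) u)"

lemma norm_rank1_le: "norm (rank1 u v x) \<le> (norm u * norm v) * norm x"
  using mult_right_mono[OF cmod_cip_le[of x v], of "norm u"] by (simp add: rank1_def mult_ac)

lemma rank1_Bop: "rank1 u v \<in> Bop J"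
  by (rule BopI[OF _ _ norm_rank1_le])
     (simp_all add: rank1_def cip_add_left cip_hs_left cv.scale_left_distrib)

lemma onorm_rank1_le: "onorm (rank1 u v) \<le> norm u * norm v"
  by (rule onorm_bound) (simp_all add: norm_rank1_le)

section \<open>Orthogonal systems\<close>

text \<open>Zero vectors are allowed, so that the Gram--Schmidt process and the singular value
  decomposition never have to stop.\<close>
definition orthsys :: "('i \<Rightarrow> 'h) \<Rightarrow> 'i set \<Rightarrow> bool" where
  "orthsys v S \<longleftrightarrow> (\<forall>i\<in>S. \<forall>j\<in>S. i \<noteq> j \<longrightarrow> cip (v i) (v j) = 0) \<and> (\<forall>i\<in>S. v i = 0 \<or> norm (v i) = 1)"

text \<open>For an \<open>orthsys\<close> this is the orthogonal projection onto the span; zero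
  vectors of the system contribute nothing. As a finite sum of \<open>rank1\<close> operators it is
  bounded for any \<open>v\<close>.\<close>

definition proj :: "('i \<Rightarrow> 'h) \<Rightarrow> 'i set \<Rightarrow> 'h \<Rightarrow> 'h" where
  "proj v S x = (\<Sum>i\<in>S. hs (cip x (v i)) (v i))"

text \<open>The vectors are not normalised: besides orthonormal systems the lemma is applied to
  families of images \<open>A (v i)\<close>.\<close>

lemma norm_sum_orth:
  assumes "finite S" "\<And>i j. i \<in> S \<Longrightarrow> j \<in> S \<Longrightarrow> i \<noteq> j \<Longrightarrow> cip (u i) (u j) = 0"
  shows "(norm (\<Sum>i\<in>S. hs (c i) (u i)))\<^sup>2 = (\<Sum>i\<in>S. (cmod (c i))\<^sup>2 * (norm (u i))\<^sup>2)"
proof -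
  have "pairwise (\<lambda>i j. orthogonal (hs (c i) (u i)) (hs (c j) (u j))) S"
    using assms(2) by (auto simp: pairwise_def orthogonal_def cip_hs_left cip_hs_right simp flip: Re_cip)
  from norm_sum_Pythagorean[OF assms(1) this] show ?thesis by (simp add: power_mult_distrib)
qed

lemma orthsys_subset: "orthsys v S \<Longrightarrow> T \<subseteq> S \<Longrightarrow> orthsys v T"
  by (auto simp: orthsys_def)

lemma orthsys_cip_sum:
  assumes "finite S" "orthsys v S" "j \<in> S"
  shows "cip (\<Sum>i\<in>S. hs (c i) (v i)) (v j) = (if v j = 0 then 0 else c j)"
proof -
  have "cip (\<Sum>i\<in>S. hs (c i) (v i)) (v j) = (\<Sum>i\<in>S. if i = j then c j * cip (v j) (v j) else 0)"
    unfolding cip_sum_left using assms by (intro sum.cong) (auto simp: orthsys_def cip_hs_left)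
  thus ?thesis using assms by (auto simp: orthsys_def cip_self)
qed

lemma cip_proj:
  assumes "finite S" "orthsys v S" "j \<in> S"
  shows "cip (proj v S x) (v j) = cip x (v j)"
  unfolding proj_def using orthsys_cip_sum[OF assms] by simp

lemma norm_proj_sq:
  assumes "finite S" "orthsys v S"
  shows "(norm (proj v S x))\<^sup>2 = (\<Sum>i\<in>S. (cmod (cip x (v i)))\<^sup>2)"
  unfolding proj_def using assms
  by (subst norm_sum_orth) (auto simp: orthsys_def intro!: sum.cong)

lemma cip_proj_compl:
  assumes "finite S" "orthsys v S"
  shows "cip (x - proj v S x) (proj v S y) = 0"
  using assms by (auto simp: proj_def[of v S y] cip_sum_right cip_hs_right cip_diff_left cip_proj intro!: sum.neutral)

lemma norm_proj_Pythagoras: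
  assumes "finite S" "orthsys v S"
  shows "(norm x)\<^sup>2 = (norm (proj v S x))\<^sup>2 + (norm (x - proj v S x))\<^sup>2"
proof -
  have "inner (x - proj v S x) (proj v S x) = 0"
    using cip_proj_compl[OF assms, of x x] cip_eq_0D by blast
  hence "orthogonal (proj v S x) (x - proj v S x)" by (simp add: orthogonal_def inner_commute)
  from norm_add_Pythagorean[OF this] show ?thesis by simp
qed

lemma norm_proj_le:
  assumes "finite S" "orthsys v S"
  shows "norm (proj v S x) \<le> norm x" "norm (x - proj v S x) \<le> norm x"
  using norm_proj_Pythagoras[OF assms, of x]
  by (auto intro: power2_le_imp_le[OF _ norm_ge_zero])

lemma bessel:
  assumes "finite S" "orthsys v S"
  shows "(\<Sum>i\<in>S. (cmod (cip x (v i)))\<^sup>2) \<le> (norm x)\<^sup>2"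
  using norm_proj_sq[OF assms, of x] norm_proj_le(1)[OF assms, of x] by (metis norm_ge_zero power_mono)

lemma proj_Bop: "proj v S \<in> Bop J"
proof -
  have "proj v S = (\<lambda>x. \<Sum>i\<in>S. rank1 (v i) (v i) x)" by (simp add: fun_eq_iff proj_def rank1_def)
  thus ?thesis using Bop_finite_sum[of S "\<lambda>i. rank1 (v i) (v i)"] rank1_Bop by simp
qed

lemma proj_compl_Bop: "(\<lambda>x. x - proj v S x) \<in> Bop J"
  by (rule Bop_minus[OF Bop_ident proj_Bop])

lemma proj_eq_0: "(\<And>i. i \<in> S \<Longrightarrow> cip x (v i) = 0) \<Longrightarrow> proj v S x = 0"
  by (simp add: proj_def)

lemma proj_of_sum:
  assumes "finite S" "orthsys v S"
  shows "proj v S (\<Sum>i\<in>S. hs (c i) (v i)) = (\<Sum>i\<in>S. hs (c i) (v i))"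
  unfolding proj_def using assms by (intro sum.cong) (auto simp: orthsys_cip_sum)

lemma proj_fixed:
  assumes "finite S" "orthsys v S" "i \<in> S"
  shows "proj v S (v i) = v i"
proof -
  have "(\<Sum>k\<in>S. hs (if k = i then 1 else 0) (v k)) = (\<Sum>k\<in>S. if k = i then v i else 0)"
    by (intro sum.cong) auto
  also have "\<dots> = v i" using assms by simp
  finally show ?thesis using proj_of_sum[OF assms(1,2), of "\<lambda>k. if k = i then 1 else 0"] by simp
qed

text \<open>Because \<open>inverse 0 = 0\<close>, the zero vector is sent to zero, exactly the
  degenerate entry that \<open>orthsys\<close> tolerates.\<close>

definition unitize :: "'h \<Rightarrow> 'h" where "unitize x = hs (complex_of_real (inverse (norm x))) x"

lemma unitize: "unitize x = 0 \<or> norm (unitize x) = 1" "hs (complex_of_real (norm x)) (unitize x) = x"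
  by (cases "x = 0"; simp add: unitize_def norm_inverse)+

lemma gram_schmidt:
  fixes b :: "nat \<Rightarrow> 'h"
  shows "\<exists>e :: nat \<Rightarrow> 'h. orthsys e {..<n} \<and> (\<forall>i<n. proj e {..<n} (b i) = b i)"
proof (induction n)
  case 0
  show ?case by (simp add: orthsys_def)
next
  case (Suc n)
  then obtain e where e: "orthsys e {..<n}" "\<And>i. i < n \<Longrightarrow> proj e {..<n} (b i) = b i" by blast
  \<comment> \<open>If \<open>b n\<close> already lies in the span of the earlier vectors, the
    remainder and hence \<open>u\<close> vanish, and the system is extended by a zero
    vector.\<close>
  define u where "u = unitize (b n - proj e {..<n} (b n))"
  define e' where "e' = e(n := u)"
  have ue: "cip u (e i) = 0" if "i < n" for i
    using that cip_proj[OF _ e(1), of i "b n"]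
    by (simp add: u_def unitize_def cip_hs_left cip_diff_left)
  have eu: "cip (e i) u = 0" if "i < n" for i using ue[OF that] cip_eq_0_commute by blast
  have o: "orthsys e' {..<Suc n}"
    using e(1) ue eu unitize(1) by (auto simp: orthsys_def e'_def u_def less_Suc_eq)
  have pe: "proj e' {..<Suc n} x = proj e {..<n} x + hs (cip x u) u" for x
    by (simp add: proj_def e'_def lessThan_Suc)
  have fix_u: "proj e' {..<Suc n} u = u" using proj_fixed[OF _ o, of n] by (simp add: e'_def)
  have fix_e: "proj e' {..<Suc n} (proj e {..<n} x) = proj e {..<n} x" for x
  proof -
    have "cip (proj e {..<n} x) u = 0"
      by (simp add: proj_def cip_sum_left cip_hs_left eu)
    thus ?thesis unfolding pe using proj_of_sum[OF _ e(1)] by (simp add: proj_def)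
  qed
  have "b n = proj e {..<n} (b n) + hs (norm (b n - proj e {..<n} (b n))) u"
    unfolding u_def unitize(2) by simp
  hence bn: "proj e' {..<Suc n} (b n) = b n"
    by (metis Bop_add Bop_hs proj_Bop fix_u fix_e)
  have "proj e' {..<Suc n} (b i) = b i" if "i < Suc n" for i
    using that bn fix_e[of "b i"] e(2)[of i] by (cases "i = n") auto
  thus ?case using o by blast
qed

text \<open>Dependent elements of \<open>B\<close> produce zero entries, so the index set can always
  be \<open>{..<card B}\<close>, without computing a dimension.\<close>

lemma gram_schmidt_set:
  assumes "finite B"
  obtains e :: "nat \<Rightarrow> 'h" where "orthsys e {..<card B}" "\<And>x. x \<in> cv.span B \<Longrightarrow> proj e {..<card B} x = x"
proof -
  obtain b where b: "bij_betw b {..<card B} B" using ex_bij_betw_nat_finite[OF assms] by (auto simp: atLeast0LessThan)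
  obtain e :: "nat \<Rightarrow> 'h" where e: "orthsys e {..<card B}" "\<And>i. i < card B \<Longrightarrow> proj e {..<card B} (b i) = b i"
    using gram_schmidt by blast
  have "proj e {..<card B} x = x" if "x \<in> cv.span B" for x
    using that
  proof (induction rule: cv.span_induct_alt)
    case base
    show ?case using Bop_0[OF proj_Bop] by blast
  next
    case (step c x y)
    from step(1) obtain i where "i < card B" "x = b i" using b by (auto simp: bij_betw_def)
    with step e(2)[of i] show ?case by (simp add: Bop_add[OF proj_Bop] Bop_hs[OF proj_Bop])
  qed
  thus ?thesis using e that by blast
qed

lemma hspan_eq_span: "finite B \<Longrightarrow> hspan J B = cv.span B"
  by (auto simp: hspan_def cv.span_finite)

section \<open>Approximation numbers\<close>

lemma rank_le_proj:
  fixes v :: "'i \<Rightarrow> 'h"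
  assumes "finite S" "card S \<le> n"
  shows "rank_le J (\<lambda>x. \<Sum>i\<in>S. hs (c i x) (v i)) n"
  unfolding rank_le_def
proof (intro exI conjI)
  show "card (v ` S) \<le> n" using assms card_image_le order_trans by blast
  show "range (\<lambda>x. \<Sum>i\<in>S. hs (c i x) (v i)) \<subseteq> hspan J (v ` S)"
    using assms by (auto simp: hspan_eq_span intro!: cv.span_sum cv.span_scale intro: cv.span_base)
qed (use assms in simp)

lemma approx_num_bdd: "T \<in> Bop J \<Longrightarrow> bdd_below {onorm (\<lambda>x. T x - F x) | F. F \<in> Bop J \<and> rank_le J F n}"
  by (rule bdd_belowI[of _ 0]) (auto intro!: Bop_onorm_nonneg Bop_minus)

lemma rank_le_zero: "rank_le J (\<lambda>x. 0) n"
  using rank_le_proj[of "{} :: nat set" n] by simp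

lemma approx_num_le:
  assumes "T \<in> Bop J" "F \<in> Bop J" "rank_le J F n"
  shows "approx_num J T n \<le> onorm (\<lambda>x. T x - F x)"
  unfolding approx_num_def using assms by (intro cInf_lower approx_num_bdd) auto

lemma approx_num_ge:
  assumes "\<And>F. F \<in> Bop J \<Longrightarrow> rank_le J F n \<Longrightarrow> c \<le> onorm (\<lambda>x. T x - F x)"
  shows "c \<le> approx_num J T n"
  unfolding approx_num_def using assms Bop_zero rank_le_zero by (intro cInf_greatest) auto

lemma approx_num_lessD:
  assumes "approx_num J T n < c"
  obtains F where "F \<in> Bop J" "rank_le J F n" "onorm (\<lambda>x. T x - F x) < c"
proof -
  have "{onorm (\<lambda>x. T x - F x) | F. F \<in> Bop J \<and> rank_le J F n} \<noteq> {}"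
    using Bop_zero rank_le_zero by auto
  from cInf_lessD[OF this assms[unfolded approx_num_def]] show ?thesis using that by blast
qed

lemma approx_num_nonneg: "T \<in> Bop J \<Longrightarrow> 0 \<le> approx_num J T n"
  by (auto intro!: approx_num_ge Bop_onorm_nonneg Bop_minus)

lemma rank_le_mono: "rank_le J F m \<Longrightarrow> m \<le> n \<Longrightarrow> rank_le J F n"
  unfolding rank_le_def using order_trans by blast

lemma approx_num_decseq: "T \<in> Bop J \<Longrightarrow> decseq (approx_num J T)"
  by (rule antimonoI, rule approx_num_ge) (auto intro!: approx_num_le intro: rank_le_mono)

lemma rank_le_add:
  assumes "rank_le J F m" "rank_le J G n"
  shows "rank_le J (\<lambda>x. F x + G x) (m + n)"
proof -
  obtain B C where B: "finite B" "card B \<le> m" "range F \<subseteq> cv.span B"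
    and C: "finite C" "card C \<le> n" "range G \<subseteq> cv.span C"
    using assms by (auto simp: rank_le_def hspan_eq_span)
  have "F x + G x \<in> cv.span (B \<union> C)" for x
    using B(3) C(3) cv.span_mono[of B "B \<union> C"] cv.span_mono[of C "B \<union> C"]
    by (intro cv.span_add) auto
  moreover have "card (B \<union> C) \<le> m + n" using card_Un_le[of B C] B C by linarith
  ultimately show ?thesis unfolding rank_le_def using B C
    by (intro exI[of _ "B \<union> C"]) (auto simp: hspan_eq_span)
qed

lemma rank_le_scale: "rank_le J F m \<Longrightarrow> rank_le J (\<lambda>x. hs c (F x)) m"
proof -
  assume "rank_le J F m"
  then obtain B where "finite B" "card B \<le> m" "range F \<subseteq> cv.span B"
    by (auto simp: rank_le_def hspan_eq_span)
  thus ?thesis unfolding rank_le_def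
    by (intro exI[of _ B]) (auto simp: hspan_eq_span intro!: cv.span_scale)
qed

lemma approx_num_add:
  assumes "S \<in> Bop J" "T \<in> Bop J"
  shows "approx_num J (\<lambda>x. S x + T x) (m + n) \<le> approx_num J S m + approx_num J T n"
proof (rule field_le_epsilon)
  fix e :: real assume "0 < e"
  hence "approx_num J S m < approx_num J S m + e / 2" "approx_num J T n < approx_num J T n + e / 2" by auto
  note e = this
  obtain F where F: "F \<in> Bop J" "rank_le J F m" "onorm (\<lambda>x. S x - F x) < approx_num J S m + e / 2"
    using approx_num_lessD[OF e(1)] by blast
  obtain G where G: "G \<in> Bop J" "rank_le J G n" "onorm (\<lambda>x. T x - G x) < approx_num J T n + e / 2"
    using approx_num_lessD[OF e(2)] by blast
  have "approx_num J (\<lambda>x. S x + T x) (m + n) \<le> onorm (\<lambda>x. (S x + T x) - (F x + G x))"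
    by (intro approx_num_le Bop_plus assms F G rank_le_add)
  also have "\<dots> = onorm (\<lambda>x. (S x - F x) + (T x - G x))" by (simp add: algebra_simps)
  also have "\<dots> \<le> onorm (\<lambda>x. S x - F x) + onorm (\<lambda>x. T x - G x)"
    by (intro onorm_triangle BopD(1) Bop_minus assms F G)
  finally show "approx_num J (\<lambda>x. S x + T x) (m + n) \<le> approx_num J S m + approx_num J T n + e"
    using F G by linarith
qed

lemma approx_num_scale:
  assumes "T \<in> Bop J"
  shows "approx_num J (\<lambda>x. hs c (T x)) n \<le> cmod c * approx_num J T n"
proof (rule field_le_epsilon)
  fix e :: real assume e: "0 < e"
  \<comment> \<open>The \<open>+ 1\<close> covers \<open>c = 0\<close>.\<close>
  define d where "d = e / (cmod c + 1)"
  have d: "0 < d" "cmod c * d \<le> e"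
    using e by (auto simp: d_def divide_simps add_nonneg_pos)
  hence "approx_num J T n < approx_num J T n + d" by simp
  from approx_num_lessD[OF this] obtain F where F: "F \<in> Bop J" "rank_le J F n"
    "onorm (\<lambda>x. T x - F x) < approx_num J T n + d" by blast
  have "approx_num J (\<lambda>x. hs c (T x)) n \<le> onorm (\<lambda>x. hs c (T x) - hs c (F x))"
    by (intro approx_num_le Bop_scale assms F rank_le_scale)
  also have "\<dots> \<le> cmod c * onorm (\<lambda>x. T x - F x)"
  proof (rule onorm_bound)
    fix x
    have "norm (hs c (T x) - hs c (F x)) = cmod c * norm (T x - F x)"
      by (metis cv.scale_right_diff_distrib norm_hs)
    also have "\<dots> \<le> cmod c * (onorm (\<lambda>x. T x - F x) * norm x)"
      by (intro mult_left_mono Bop_norm_le[OF Bop_minus] assms F) auto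
    finally show "norm (hs c (T x) - hs c (F x)) \<le> cmod c * onorm (\<lambda>x. T x - F x) * norm x"
      by (simp add: mult_ac)
  qed (use assms F in \<open>auto intro!: mult_nonneg_nonneg Bop_onorm_nonneg Bop_minus\<close>)
  also have "\<dots> \<le> cmod c * (approx_num J T n + d)" using F by (intro mult_left_mono) auto
  finally show "approx_num J (\<lambda>x. hs c (T x)) n \<le> cmod c * approx_num J T n + e"
    using d by (simp add: algebra_simps)
qed

lemma sing_seq_zero: "calkin_space I \<Longrightarrow> sing_seq J (\<lambda>x. 0) \<in> I"
proof -
  assume I: "calkin_space I"
  have "approx_num J (\<lambda>x. 0) n = 0" for n
    using approx_num_le[OF Bop_zero Bop_zero rank_le_zero, of n] approx_num_nonneg[OF Bop_zero, of n]
    by (simp add: onorm_zero)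
  thus ?thesis using I by (simp add: sing_seq_def calkin_space_def)
qed

lemma sing_seq_scale:
  assumes "calkin_space I" "T \<in> Bop J" "sing_seq J T \<in> I"
  shows "sing_seq J (\<lambda>x. hs c (T x)) \<in> I"
proof (rule calkin_mono[OF assms(1) calkin_scale[OF assms(1,3), of "complex_of_real (cmod c)"]])
  show "cmod (sing_seq J (\<lambda>x. hs c (T x)) n) \<le> cmod (complex_of_real (cmod c) * sing_seq J T n)" for n
    using approx_num_scale[OF assms(2)] approx_num_nonneg[OF assms(2)] approx_num_nonneg[OF Bop_scale[OF assms(2)]]
    by (simp add: sing_seq_def norm_mult)
qed

text \<open>Estimates at even indices suffice: monotonicity gives the majorant
  \<open>g (n div 2)\<close>, which stays in \<open>I\<close> by \<open>calkin_double\<close>. It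
  absorbs the factor 2 both from adding ranks and from the greedy choice in
  \<open>orthonormal_images\<close>.\<close>

lemma approx_num_mem_of_double:
  assumes I: "calkin_space I" and T: "T \<in> Bop J"
    and g: "decseq g" "\<And>n. 0 \<le> g n" "(\<lambda>n. complex_of_real (g n)) \<in> I"
    and le: "\<And>n. approx_num J T (2 * n) \<le> g n"
  shows "sing_seq J T \<in> I"
proof (rule calkin_mono[OF I calkin_double[OF I g]])
  fix n
  have "approx_num J T n \<le> approx_num J T (2 * (n div 2))"
    using approx_num_decseq[OF T] by (simp add: decseq_def)
  also have "\<dots> \<le> g (n div 2)" by (rule le)
  finally show "cmod (sing_seq J T n) \<le> cmod (complex_of_real (g (n div 2)))"
    using approx_num_nonneg[OF T] g(2) by (simp add: sing_seq_def)
qed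

lemma sing_seq_add:
  assumes I: "calkin_space I" and "S \<in> Bop J" "T \<in> Bop J" "sing_seq J S \<in> I" "sing_seq J T \<in> I"
  shows "sing_seq J (\<lambda>x. S x + T x) \<in> I"
proof (rule approx_num_mem_of_double[OF I Bop_plus[OF assms(2,3)]])
  show "approx_num J (\<lambda>x. S x + T x) (2 * n) \<le> approx_num J S n + approx_num J T n" for n
    using approx_num_add[OF assms(2,3), of n n] by (simp add: mult_2)
  show "decseq (\<lambda>n. approx_num J S n + approx_num J T n)"
    using approx_num_decseq[OF assms(2)] approx_num_decseq[OF assms(3)]
    by (auto simp: decseq_def intro!: add_mono)
  show "0 \<le> approx_num J S n + approx_num J T n" for n
    using assms by (simp add: approx_num_nonneg)
  show "(\<lambda>n. complex_of_real (approx_num J S n + approx_num J T n)) \<in> I"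
    using calkin_add[OF I assms(4,5)] by (simp add: sing_seq_def)
qed

end

section \<open>Norm attainment and adjoints\<close>

text \<open>Closed balls of half the radius form a closed cover, which therefore also covers the
  closure. Compactness of operators can thus be checked on the image of the ball itself.\<close>

lemma compact_closure_iff_totally_bounded:
  fixes S :: "'a::complete_space set"
  shows "compact (closure S) \<longleftrightarrow> (\<forall>e>0. \<exists>k. finite k \<and> S \<subseteq> (\<Union>x\<in>k. ball x e))"
proof
  assume "compact (closure S)"
  hence *: "\<forall>e>0. \<exists>k. finite k \<and> closure S \<subseteq> (\<Union>x\<in>k. ball x e)"
    by (simp add: compact_eq_totally_bounded)
  show "\<forall>e>0. \<exists>k. finite k \<and> S \<subseteq> (\<Union>x\<in>k. ball x e)"
    using * closure_subset[of S] by (meson order_trans)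
next
  assume tb: "\<forall>e>0. \<exists>k. finite k \<and> S \<subseteq> (\<Union>x\<in>k. ball x e)"
  have "\<exists>k. finite k \<and> closure S \<subseteq> (\<Union>x\<in>k. ball x e)" if e: "e > 0" for e
  proof -
    obtain k where k: "finite k" "S \<subseteq> (\<Union>x\<in>k. ball x (e/2))" using tb e half_gt_zero by blast
    have "closed (\<Union>x\<in>k. cball x (e/2))" using k by (intro closed_UN) auto
    moreover have "S \<subseteq> (\<Union>x\<in>k. cball x (e/2))" using k(2) by force
    ultimately have "closure S \<subseteq> (\<Union>x\<in>k. cball x (e/2))" by (rule closure_minimal[rotated])
    also have "\<dots> \<subseteq> (\<Union>x\<in>k. ball x e)" using e by (intro UN_mono) auto
    finally show ?thesis using k(1) by blast
  qed
  thus "compact (closure S)" by (simp add: compact_eq_totally_bounded complete_eq_closed)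
qed

text \<open>By the parallelogram identity a norm-maximizing sequence is Cauchy, so no weak compactness
  is needed.\<close>
lemma compact_attains_onorm:
  fixes A :: "'a::{real_inner, complete_space} \<Rightarrow> 'b::real_normed_vector"
  assumes A: "bounded_linear A" and cpt: "compact (closure (A ` cball 0 1))"
  obtains v where "norm v \<le> 1" "norm (A v) = onorm A"
proof (cases "onorm A = 0")
  case True
  thus ?thesis using that[of 0] A by (simp add: linear_0 bounded_linear.linear)
next
  case False
  define K where "K = onorm A"
  have K: "0 < K" using False onorm_pos_le[OF A] by (simp add: K_def)
  have leK: "norm (A x) \<le> K * norm x" for x unfolding K_def by (rule onorm[OF A])
  \<comment> \<open>A nonnegative sequence strictly below \<open>K\<close> and tending to
    \<open>K\<close>; strictness yields unit vectors whose images have norm above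
    \<open>c n\<close>.\<close>
  define c where "c n = K * (1 - 1 / (real n + 2))" for n
  have "\<exists>x. norm x = 1 \<and> c n < norm (A x)" for n
  proof -
    have c: "0 \<le> c n" "c n < K" using K by (auto simp: c_def field_simps)
    have "\<exists>x. c n * norm x < norm (A x)"
    proof (rule ccontr)
      assume "\<not> ?thesis"
      hence "norm (A x) \<le> c n * norm x" for x by (meson not_less)
      from onorm_bound[OF c(1) this] show False using c by (simp add: K_def)
    qed
    then obtain x where x: "c n * norm x < norm (A x)" by blast
    hence x0: "x \<noteq> 0" using A by (auto simp: linear_0 bounded_linear.linear)
    have "c n < norm (A (inverse (norm x) *\<^sub>R x))"
      using x x0 by (simp add: linear_scale[OF bounded_linear.linear[OF A]] field_simps)
    thus ?thesis using x0 by (intro exI[of _ "inverse (norm x) *\<^sub>R x"]) simp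
  qed
  then obtain x where x: "\<And>n. norm (x n) = 1" "\<And>n. c n < norm (A (x n))" by metis
  have "A (x n) \<in> closure (A ` cball 0 1)" for n
    using closure_subset[of "A ` cball 0 1"] x(1)[of n] by (auto simp: subset_eq)
  then obtain l r where r: "strict_mono (r :: nat \<Rightarrow> nat)" and l: "(\<lambda>n. A (x (r n))) \<longlonglongrightarrow> l"
    using cpt[unfolded compact_def, rule_format, of "\<lambda>n. A (x n)"] by (auto simp: o_def)
  have "c \<longlonglongrightarrow> K"
  proof -
    have "(\<lambda>n. 1 / (real (n + 2))) \<longlonglongrightarrow> 0" by (rule LIMSEQ_ignore_initial_segment[OF lim_1_over_n])
    hence "(\<lambda>n. K * (1 - 1 / (real n + 2))) \<longlonglongrightarrow> K * (1 - 0)"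
      by (intro tendsto_intros) (simp add: add.commute)
    thus ?thesis by (simp add: c_def[abs_def])
  qed
  hence c_r: "(\<lambda>n. c (r n)) \<longlonglongrightarrow> K" using LIMSEQ_subseq_LIMSEQ[OF _ r] by (auto simp: o_def)
  have nl: "norm l = K"
  proof (rule antisym)
    show "norm l \<le> K" by (rule LIMSEQ_le_const2[OF tendsto_norm[OF l]]) (use leK x in \<open>metis mult.right_neutral\<close>)
    show "K \<le> norm l" by (rule LIMSEQ_le[OF c_r tendsto_norm[OF l]]) (use x in \<open>auto intro: less_imp_le\<close>)
  qed
  have "Cauchy (\<lambda>n. x (r n))"
  proof (rule metric_CauchyI)
    fix e :: real assume e: "0 < e"
    \<comment> \<open>The bound \<open>d \<le> K\<close> keeps \<open>1 - d / K\<close> nonnegative,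
      so that it may be squared. The parallelogram identity then bounds the squared distance by
      \<open>8 * (d / K)\<close>, which the other bound makes at most half of the square of
      \<open>e\<close>.\<close>
    define d where "d = min K (K * e\<^sup>2 / 16)"
    have d: "0 < d" "d \<le> K" "d \<le> K * e\<^sup>2 / 16" using K e by (auto simp: d_def)
    obtain M where M: "\<And>n. n \<ge> M \<Longrightarrow> norm (A (x (r n)) - l) < d" using LIMSEQ_D[OF l d(1)] by blast
    have "dist (x (r m)) (x (r n)) < e" if mn: "m \<ge> M" "n \<ge> M" for m n
    proof -
      let ?y = "x (r m)" and ?z = "x (r n)"
      have "A (?y + ?z) = A ?y + A ?z" using A by (simp add: linear_add bounded_linear.linear)
      hence eq: "2 *\<^sub>R l = A (?y + ?z) - (A ?y - l) - (A ?z - l)" by (simp add: scaleR_2)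
      have "2 * K \<le> norm (A (?y + ?z)) + norm (A ?y - l) + norm (A ?z - l)"
        using arg_cong[OF eq, of norm] norm_triangle_ineq4[of "A (?y + ?z) - (A ?y - l)" "A ?z - l"]
          norm_triangle_ineq4[of "A (?y + ?z)" "A ?y - l"] nl by simp
      hence "2 * K - 2 * d \<le> norm (A (?y + ?z))" using M[OF mn(1)] M[OF mn(2)] by simp
      also have "\<dots> \<le> K * norm (?y + ?z)" by (rule leK)
      finally have le: "2 * (1 - d / K) \<le> norm (?y + ?z)" using K by (simp add: field_simps)
      have "0 \<le> 1 - d / K" using d K by simp
      hence "(2 * (1 - d / K))\<^sup>2 \<le> (norm (?y + ?z))\<^sup>2" using le by (intro power_mono) auto
      moreover have "(norm (?y - ?z))\<^sup>2 = 4 - (norm (?y + ?z))\<^sup>2"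
      proof -
        have "inner ?y ?y = 1" "inner ?z ?z = 1" using x(1) by (simp_all flip: power2_norm_eq_inner)
        thus ?thesis by (simp add: power2_norm_eq_inner algebra_simps inner_commute)
      qed
      moreover have "(2 * (1 - d / K))\<^sup>2 = 4 - 8 * (d / K) + 4 * (d / K)\<^sup>2" by algebra
      ultimately have "(norm (?y - ?z))\<^sup>2 \<le> 8 * (d / K)" by (smt (verit) zero_le_power2)
      also have "8 * (d / K) \<le> e\<^sup>2 / 2" using d K by (simp add: field_simps)
      also have "\<dots> < e\<^sup>2" using e by simp
      finally show ?thesis using e by (simp add: dist_norm power_less_imp_less_base)
    qed
    thus "\<exists>M. \<forall>m\<ge>M. \<forall>n\<ge>M. dist (x (r m)) (x (r n)) < e" by blast
  qed
  then obtain v where v: "(\<lambda>n. x (r n)) \<longlonglongrightarrow> v" using Cauchy_convergent convergent_def by blast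
  have "norm v = 1" using tendsto_norm[OF v] x(1) by (simp add: LIMSEQ_const_iff)
  moreover have "A v = l" using LIMSEQ_unique[OF bounded_linear.tendsto[OF A v] l] .
  ultimately show ?thesis using that[of v] nl by (simp add: K_def)
qed

text \<open>First variation: moving from \<open>v\<close> by \<open>t *\<^sub>R w\<close> changes
  the squared norm of the image to first order by \<open>2 * t * inner (A v) (A w)\<close>, while
  the squared norm of the argument changes only to second order. A nonzero inner product would
  contradict maximality for a small \<open>t\<close> of the right sign.\<close>

lemma maximizer_orthogonal:
  fixes A :: "'a::real_inner \<Rightarrow> 'b::real_inner"
  assumes A: "linear A" and le: "\<And>x. norm (A x) \<le> K * norm x"
    and v: "norm v = 1" "norm (A v) = K" and w: "inner v w = 0"
  shows "inner (A v) (A w) = 0"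
proof (rule ccontr)
  define a where "a = inner (A v) (A w)"
  \<comment> \<open>\<open>C\<close> dominates the second-order growth allowed by the norm bound and
    is positive even for \<open>w = 0\<close>; with \<open>t = a / C\<close> the second-order term
    is at most \<open>t * a\<close>, half of the first-order term.\<close>
  define C where "C = K\<^sup>2 * (norm w)\<^sup>2 + 1"
  assume "inner (A v) (A w) \<noteq> 0"
  hence a: "a \<noteq> 0" by (simp add: a_def)
  have C: "C > 0" unfolding C_def by (intro add_nonneg_pos) auto
  define t where "t = a / C"
  have Avw: "A (v + t *\<^sub>R w) = A v + t *\<^sub>R A w" using A by (simp add: linear_add linear_scale)
  have "(norm (A (v + t *\<^sub>R w)))\<^sup>2 \<le> (K * norm (v + t *\<^sub>R w))\<^sup>2" using le by (intro power_mono) auto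
  moreover have "(norm (v + t *\<^sub>R w))\<^sup>2 = 1 + t\<^sup>2 * (norm w)\<^sup>2"
    using w norm_add_Pythagorean[of v "t *\<^sub>R w"] v(1) by (simp add: orthogonal_def power_mult_distrib)
  moreover have "(norm (A (v + t *\<^sub>R w)))\<^sup>2 = K\<^sup>2 + 2 * t * a + t\<^sup>2 * (norm (A w))\<^sup>2"
    unfolding Avw power2_norm_eq_inner v(2)[symmetric]
    by (simp add: a_def inner_add_left inner_add_right inner_commute power2_eq_square)
  ultimately have "2 * t * a + t\<^sup>2 * (norm (A w))\<^sup>2 \<le> t\<^sup>2 * (K\<^sup>2 * (norm w)\<^sup>2)"
    by (simp add: power_mult_distrib algebra_simps)
  also have "\<dots> \<le> t\<^sup>2 * C" by (intro mult_left_mono) (auto simp: C_def)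
  also have "t\<^sup>2 * C = t * a" using C by (simp add: t_def power2_eq_square)
  finally have "2 * (t * a) + t\<^sup>2 * (norm (A w))\<^sup>2 \<le> t * a" by simp
  moreover have "0 \<le> t\<^sup>2 * (norm (A w))\<^sup>2" by simp
  ultimately have "t * a \<le> 0" by linarith
  moreover have "t * a > 0" using a C by (simp add: t_def flip: power2_eq_square)
  ultimately show False by simp
qed

text \<open>A functional attains its norm because bounded sets of reals have compact closure. By
  \<open>maximizer_orthogonal\<close> it vanishes on the orthogonal complement of the maximizer,
  which is therefore, up to scaling, the representing vector.\<close>

lemma riesz:
  fixes f :: "'a::{real_inner, complete_space} \<Rightarrow> real"
  assumes f: "bounded_linear f"
  obtains z where "\<And>x. f x = inner x z"
proof (cases "onorm f = 0")
  case True
  hence "f x = 0" for x using onorm[OF f, of x] by simp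
  thus ?thesis using that[of 0] by simp
next
  case False
  have "bounded (f ` cball 0 1)" by (rule bounded_linear_image[OF bounded_cball f])
  hence "compact (closure (f ` cball 0 1))" by (simp add: compact_closure)
  from compact_attains_onorm[OF f this] obtain v where v: "norm v \<le> 1" "norm (f v) = onorm f" by blast
  have pos: "onorm f > 0" using False onorm_pos_le[OF f] by simp
  have v1: "norm v = 1"
  proof (rule antisym)
    have "onorm f \<le> onorm f * norm v" using onorm[OF f, of v] v(2) by simp
    thus "1 \<le> norm v" using pos by simp
  qed (rule v)
  have lin: "linear f" using f by (rule bounded_linear.linear)
  have "f x = inner x (f v *\<^sub>R v)" for x
  proof -
    have "inner v (x - inner x v *\<^sub>R v) = 0"
      using v1 norm_eq_1[of v] by (simp add: inner_diff_right inner_commute)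
    from maximizer_orthogonal[OF lin onorm[OF f] v1 v(2) this] have "f (x - inner x v *\<^sub>R v) = 0"
      using v(2) pos by auto
    thus ?thesis by (simp add: linear_diff[OF lin] linear_scale[OF lin])
  qed
  thus ?thesis using that by blast
qed

context hilbert
begin

text \<open>Riesz for the real part gives the vector; evaluating the real identity at
  \<open>J x\<close> supplies the imaginary part.\<close>

lemma adjoint_exists:
  assumes T: "T \<in> Bop J"
  obtains z where "\<And>x. cip (T x) y = cip x z"
proof -
  have "bounded_linear (\<lambda>x. inner (T x) y)"
    by (rule bounded_linear_compose[OF bounded_linear_inner_left BopD(1)[OF T]])
  from riesz[OF this] obtain z where z: "\<And>x. inner (T x) y = inner x z" by blast
  have "inner (T x) (J y) = inner x (J z)" for x
    using z[of "J x"] by (simp add: BopD(2)[OF T] inner_J_left)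
  thus ?thesis using that[of z] z by (simp add: cip_def)
qed

section \<open>Compact operators\<close>

lemma compact_operatorI:
  assumes "compact K" "T ` cball 0 1 \<subseteq> K"
  shows "compact_operator T"
proof -
  have "closure (T ` cball 0 1) \<subseteq> K" using assms by (intro closure_minimal compact_imp_closed)
  thus ?thesis unfolding compact_operator_def using assms(1)
    by (metis closed_closure compact_Int_closed inf.absorb_iff2)
qed

lemma compact_operator_limit:
  fixes T :: "'h \<Rightarrow> 'h"
  assumes "\<And>e. 0 < e \<Longrightarrow> \<exists>F. compact_operator F \<and> (\<forall>x\<in>cball 0 1. norm (T x - F x) < e)"
  shows "compact_operator T"
  unfolding compact_operator_def compact_closure_iff_totally_bounded
proof (intro allI impI)
  fix e :: real assume e: "0 < e"
  then obtain F where F: "compact_operator F" "\<And>x. x \<in> cball 0 1 \<Longrightarrow> norm (T x - F x) < e / 2"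
    using assms[of "e/2"] by auto
  obtain k where k: "finite k" "F ` cball 0 1 \<subseteq> (\<Union>x\<in>k. ball x (e/2))"
    using F(1) e half_gt_zero unfolding compact_operator_def compact_closure_iff_totally_bounded by blast
  have "T ` cball 0 1 \<subseteq> (\<Union>x\<in>k. ball x e)"
  proof
    fix y assume "y \<in> T ` cball 0 1"
    then obtain x where x: "x \<in> cball 0 1" "y = T x" by blast
    then obtain z where z: "z \<in> k" "dist z (F x) < e / 2" using k(2) by force
    have "dist z (T x) \<le> dist z (F x) + dist (F x) (T x)" by (rule dist_triangle)
    also have "\<dots> < e" using z F(2)[OF x(1)] by (simp add: dist_norm norm_minus_commute)
    finally show "y \<in> (\<Union>x\<in>k. ball x e)" using z x by auto
  qed
  thus "\<exists>k. finite k \<and> T ` cball 0 1 \<subseteq> (\<Union>x\<in>k. ball x e)" using k by blast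
qed

lemma compact_operator_add:
  assumes "compact_operator (S :: 'h \<Rightarrow> 'h)" "compact_operator T"
  shows "compact_operator (\<lambda>x. S x + T x)"
proof (rule compact_operatorI)
  show "compact {x + y |x y. x \<in> closure (S ` cball 0 1) \<and> y \<in> closure (T ` cball 0 1)}"
    using assms by (intro compact_sums) (auto simp: compact_operator_def)
  show "(\<lambda>x. S x + T x) ` cball 0 1 \<subseteq> {x + y |x y. x \<in> closure (S ` cball 0 1) \<and> y \<in> closure (T ` cball 0 1)}"
    using closure_subset[of "S ` cball 0 1"] closure_subset[of "T ` cball 0 1"] by (auto simp: subset_eq)
qed

lemma compact_operator_zero: "compact_operator (\<lambda>x. 0 :: 'h)"
  by (rule compact_operatorI[of "{0}"]) auto

lemma compact_operator_sum:
  assumes "\<And>i. i \<in> S \<Longrightarrow> compact_operator (T i :: 'h \<Rightarrow> 'h)"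
  shows "compact_operator (\<lambda>x. \<Sum>i\<in>S. T i x)"
  using assms by (induction S rule: infinite_finite_induct) (auto simp: compact_operator_zero compact_operator_add)

lemma compact_operator_compose_left:
  assumes "A \<in> Bop J" "compact_operator T"
  shows "compact_operator (\<lambda>x. A (T x))"
proof (rule compact_operatorI)
  show "compact (A ` closure (T ` cball 0 1))"
    using assms BopD(1) by (intro compact_continuous_image) 
      (auto simp: compact_operator_def intro: linear_continuous_on)
  show "(\<lambda>x. A (T x)) ` cball 0 1 \<subseteq> A ` closure (T ` cball 0 1)"
    using closure_subset[of "T ` cball 0 1"] by auto
qed

lemma compact_operator_compose_right:
  assumes A: "A \<in> Bop J" and B: "B \<in> Bop J" and cpt: "compact_operator A"
  shows "compact_operator (\<lambda>x. A (B x))"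
proof (rule compact_operatorI)
  define K where "K = onorm B + 1"
  have K: "K > 0" using Bop_onorm_nonneg[OF B] by (simp add: K_def)
  show "compact ((\<lambda>x. K *\<^sub>R x) ` closure (A ` cball 0 1))"
    using cpt by (intro compact_scaling) (auto simp: compact_operator_def)
  show "(\<lambda>x. A (B x)) ` cball 0 1 \<subseteq> (\<lambda>x. K *\<^sub>R x) ` closure (A ` cball 0 1)"
  proof (rule image_subsetI)
    fix x :: 'h assume x: "x \<in> cball 0 1"
    have "norm (B x) \<le> onorm B * norm x" by (rule Bop_norm_le[OF B])
    also have "\<dots> \<le> onorm B * 1" using x by (intro mult_left_mono Bop_onorm_nonneg[OF B]) auto
    finally have "norm (B x) \<le> K" by (simp add: K_def)
    hence "inverse K *\<^sub>R B x \<in> cball 0 1" using K by (simp add: field_simps)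
    hence "A (inverse K *\<^sub>R B x) \<in> closure (A ` cball 0 1)"
      using closure_subset[of "A ` cball 0 1"] by blast
    moreover have "A (B x) = K *\<^sub>R A (inverse K *\<^sub>R B x)"
      using K by (simp add: linear_scale[OF bounded_linear.linear[OF BopD(1)[OF A]]])
    ultimately show "A (B x) \<in> (\<lambda>x. K *\<^sub>R x) ` closure (A ` cball 0 1)" by blast
  qed
qed

lemma compact_operator_rank1: "compact_operator (rank1 u v)"
proof (rule compact_operatorI)
  show "compact ((\<lambda>c. hs c u) ` cball 0 (norm v))"
    by (intro compact_continuous_image linear_continuous_on bounded_linear_hs_left) simp
  show "rank1 u v ` cball 0 1 \<subseteq> (\<lambda>c. hs c u) ` cball 0 (norm v)"
  proof (rule image_subsetI)
    fix x :: 'h assume "x \<in> cball 0 1"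
    hence "norm x * norm v \<le> 1 * norm v" by (intro mult_right_mono) auto
    hence "cip x v \<in> cball 0 (norm v)" using cmod_cip_le[of x v] by simp
    thus "rank1 u v x \<in> (\<lambda>c. hs c u) ` cball 0 (norm v)" unfolding rank1_def by (rule imageI)
  qed
qed

text \<open>Projecting onto the span of the range does not change \<open>F\<close> and writes it as
  a finite sum of rank-one operators composed with \<open>F\<close>.\<close>

lemma finite_rank_compact:
  assumes "F \<in> Bop J" "rank_le J F n"
  shows "compact_operator F"
proof -
  obtain B where B: "finite B" "range F \<subseteq> cv.span B"
    using assms(2) by (auto simp: rank_le_def hspan_eq_span)
  obtain e :: "nat \<Rightarrow> 'h" where e: "\<And>x. x \<in> cv.span B \<Longrightarrow> proj e {..<card B} x = x"
    using gram_schmidt_set[OF B(1)] by blast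
  have "F = (\<lambda>x. proj e {..<card B} (F x))" using e[OF subsetD[OF B(2)]] by simp
  also have "\<dots> = (\<lambda>x. \<Sum>i<card B. rank1 (e i) (e i) (F x))" by (simp add: proj_def rank1_def)
  finally have F: "F = (\<lambda>x. \<Sum>i<card B. rank1 (e i) (e i) (F x))" .
  show ?thesis
    by (subst F) (intro compact_operator_sum compact_operator_compose_right[OF rank1_Bop assms(1) compact_operator_rank1])
qed

text \<open>Such an operator is a norm limit of finite-rank operators. This supplies the compactness
  behind the singular value decomposition when only membership of the singular numbers in a Calkin
  space is assumed.\<close>

lemma null_approx_num_compact:
  assumes T: "T \<in> Bop J" and "approx_num J T \<longlonglongrightarrow> 0"
  shows "compact_operator T"
proof (rule compact_operator_limit)
  fix e :: real assume e: "0 < e"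
  have "\<forall>\<^sub>F n in sequentially. approx_num J T n < e" using assms(2) e by (rule order_tendstoD)
  then obtain n where "approx_num J T n < e" by (meson eventually_sequentially order_refl)
  from approx_num_lessD[OF this] obtain F where F: "F \<in> Bop J" "rank_le J F n" "onorm (\<lambda>x. T x - F x) < e" by blast
  have "norm (T x - F x) < e" if "x \<in> cball 0 1" for x
  proof -
    have "norm (T x - F x) \<le> onorm (\<lambda>x. T x - F x) * norm x" by (rule Bop_norm_le[OF Bop_minus[OF T F(1)]])
    also have "\<dots> \<le> onorm (\<lambda>x. T x - F x) * 1"
      using that by (intro mult_left_mono Bop_onorm_nonneg Bop_minus T F) auto
    finally show ?thesis using F by simp
  qed
  thus "\<exists>F. compact_operator F \<and> (\<forall>x\<in>cball 0 1. norm (T x - F x) < e)"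
    using finite_rank_compact[OF F(1,2)] by blast
qed

section \<open>Singular value decomposition\<close>

text \<open>The next singular vector maximizes the norm of \<open>A\<close> on the orthogonal
  complement of the previous ones. The last clause, on all admissible \<open>w\<close> at once, is
  the first variation at this maximizer; it secures orthogonality to images of vectors not yet
  chosen.\<close>

lemma svd_step:
  assumes A: "A \<in> Bop J" "compact_operator A" and v: "orthsys v {..<n::nat}"
  shows "\<exists>u. (u = 0 \<or> norm u = 1) \<and> (\<forall>i<n. cip u (v i) = 0) \<and>
    (\<forall>x. norm (A (x - proj v {..<n} x)) \<le> norm (A u) * norm x) \<and>
    (\<forall>w. (\<forall>i<n. cip w (v i) = 0) \<longrightarrow> cip u w = 0 \<longrightarrow> cip (A u) (A w) = 0)"
proof -
  define P where "P = proj v {..<n}"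
  define G where "G = (\<lambda>x. A (x - P x))"
  have G: "G \<in> Bop J" unfolding G_def P_def by (rule Bop_compose[OF A(1) proj_compl_Bop])
  have "compact_operator G" unfolding G_def P_def by (rule compact_operator_compose_right[OF A(1) proj_compl_Bop A(2)])
  hence "compact (closure (G ` cball 0 1))" by (simp add: compact_operator_def)
  from compact_attains_onorm[OF BopD(1)[OF G] this] obtain y where y: "norm y \<le> 1" "norm (G y) = onorm G" by blast
  show ?thesis
  proof (cases "onorm G = 0")
    case True
    hence "norm (A (x - P x)) \<le> 0" for x using Bop_norm_le[OF G, of x] by (simp add: G_def)
    thus ?thesis using Bop_0[OF A(1)] by (intro exI[of _ 0]) (auto simp: P_def)
  next
    case False
    hence pos: "onorm G > 0" using Bop_onorm_nonneg[OF G] by simp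
    \<comment> \<open>A maximizer \<open>y\<close> of \<open>G\<close> may have a component in the
      old span. Removing it leaves \<open>G y\<close> unchanged and places the vector in the
      complement; maximality then forces its norm to be exactly 1.\<close>
    define u where "u = y - P y"
    have uv: "cip u (v i) = 0" if "i < n" for i
      using cip_proj[OF _ v, of i y] that by (simp add: u_def P_def cip_diff_left)
    have Pw: "G w = A w" if "\<forall>i<n. cip w (v i) = 0" for w
      using that proj_eq_0[of "{..<n}" w v] by (simp add: G_def P_def)
    have Gu: "G u = A u" by (rule Pw) (use uv in auto)
    have Au: "norm (A u) = onorm G" using y(2) by (simp add: u_def G_def)
    have u1: "norm u = 1"
    proof (rule antisym)
      show "norm u \<le> 1" using norm_proj_le(2)[OF _ v, of y] y(1) by (simp add: u_def P_def)
      have "onorm G \<le> onorm G * norm u" using Bop_norm_le[OF G, of u] Au Gu by simp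
      thus "1 \<le> norm u" using pos by simp
    qed
    have orth: "cip (A u) (A w) = 0" if w: "\<forall>i<n. cip w (v i) = 0" "cip u w = 0" for w
    proof -
      \<comment> \<open>The variational argument is real. Applied to both \<open>w\<close> and
        \<open>J w\<close> it gives complex orthogonality.\<close>
      have "G (J w) = J (A w)" using BopD(2)[OF G] Pw[OF w(1)] by simp
      moreover have "inner (G u) (G w) = 0" "inner (G u) (G (J w)) = 0"
        by (rule maximizer_orthogonal[OF bounded_linear.linear[OF BopD(1)[OF G]] Bop_norm_le[OF G] u1];
            use w(2) cip_eq_0D Au Gu in auto)+
      ultimately show ?thesis using Pw[OF w(1)] Gu by (intro cip_eq_0I) auto
    qed
    have "norm (A (x - P x)) \<le> norm (A u) * norm x" for x
      using Bop_norm_le[OF G, of x] by (simp add: Au G_def)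
    thus ?thesis using u1 uv orth by (intro exI[of _ u]) (auto simp: P_def)
  qed
qed

lemma svd_exists:
  assumes A: "A \<in> Bop J" "compact_operator A"
  obtains v :: "nat \<Rightarrow> 'h" where "orthsys v UNIV" "\<And>i j. i \<noteq> j \<Longrightarrow> cip (A (v i)) (A (v j)) = 0"
    "\<And>n x. norm (A (x - proj v {..<n} x)) \<le> norm (A (v n)) * norm x"
proof -
  define P where "P v n u \<longleftrightarrow> (u = 0 \<or> norm u = 1) \<and> (\<forall>i<n. cip u (v i) = 0) \<and>
    (\<forall>x. norm (A (x - proj v {..<n} x)) \<le> norm (A u) * norm x) \<and>
    (\<forall>w. (\<forall>i<n. cip w (v i) = 0) \<longrightarrow> cip u w = 0 \<longrightarrow> cip (A u) (A w) = 0)"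
    for v :: "nat \<Rightarrow> 'h" and n u
  have orth: "orthsys v {..<n}" if "\<And>i. i < n \<Longrightarrow> P v i (v i)" for v n
  proof -
    have *: "cip (v i) (v j) = 0" if "j < i" "i < n" for i j
      using that \<open>\<And>i. i < n \<Longrightarrow> P v i (v i)\<close>[of i] by (simp add: P_def)
    hence "cip (v i) (v j) = 0" if "i \<noteq> j" "i < n" "j < n" for i j
      using that cip_eq_0_commute[of "v i" "v j"] by (cases "j < i") auto
    thus ?thesis using that by (auto simp: orthsys_def P_def)
  qed
  \<comment> \<open>\<open>P v n\<close> only inspects the entries of \<open>v\<close> before
    \<open>n\<close>, so one step at a time can be assembled into a full sequence by
    recursion.\<close>
  have "\<exists>v. \<forall>n. P v n (v n)"
  proof (rule dependent_wellorder_choice)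
    fix r n and f g :: "nat \<Rightarrow> 'h"
    assume fg: "\<And>y. y < n \<Longrightarrow> f y = g y"
    have "proj f {..<n} = proj g {..<n}" unfolding proj_def by (intro ext sum.cong) (auto simp: fg)
    thus "P f n r = P g n r" unfolding P_def using fg by simp
  next
    fix n and f :: "nat \<Rightarrow> 'h"
    assume "\<And>y. y < n \<Longrightarrow> P f y (f y)"
    from svd_step[OF A orth[OF this]] show "\<exists>r. P f n r" unfolding P_def by blast
  qed
  then obtain v where v: "\<And>n. P v n (v n)" by blast
  have o: "orthsys v UNIV"
    using orth[OF v] by (auto simp: orthsys_def) (metis lessThan_iff less_Suc_eq_le max.cobounded1 max.cobounded2)+
  \<comment> \<open>The maximality at the smaller index is used: \<open>v j\<close> is one of the
    admissible directions \<open>w\<close> of step \<open>i\<close>.\<close>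
  have AA: "cip (A (v i)) (A (v j)) = 0" if "i < j" for i j
  proof -
    have "\<forall>k<i. cip (v j) (v k) = 0" "cip (v i) (v j) = 0" using o that by (auto simp: orthsys_def)
    thus ?thesis using v[of i] unfolding P_def by blast
  qed
  have "cip (A (v i)) (A (v j)) = 0" if "i \<noteq> j" for i j
    using AA[of i j] AA[of j i] that cip_eq_0_commute by (meson linorder_neqE_nat)
  thus ?thesis using that[OF o] v unfolding P_def by blast
qed

text \<open>The range has dimension at most \<open>n\<close>, but there are \<open>n + 1\<close>
  vectors. Since \<open>cv.dependent\<close> concerns sets, coinciding images are treated apart,
  with coefficients 1 and -1.\<close>

lemma dependent_of_rank_le:
  fixes v :: "nat \<Rightarrow> 'h"
  assumes "rank_le J F n"
  obtains c where "\<exists>i\<le>n. c i \<noteq> 0" "(\<Sum>i\<le>n. hs (c i) (F (v i))) = 0"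
proof (cases "inj_on (\<lambda>i. F (v i)) {..n}")
  case True
  obtain B where B: "finite B" "card B \<le> n" "range F \<subseteq> cv.span B"
    using assms by (auto simp: rank_le_def hspan_eq_span)
  have "card ((\<lambda>i. F (v i)) ` {..n}) = Suc n" using True by (simp add: card_image)
  hence "cv.dependent ((\<lambda>i. F (v i)) ` {..n})"
    using cv.independent_span_bound[OF B(1), of "(\<lambda>i. F (v i)) ` {..n}"] B by auto
  then obtain u where u: "\<exists>x\<in>(\<lambda>i. F (v i)) ` {..n}. u x \<noteq> 0" "(\<Sum>x\<in>(\<lambda>i. F (v i)) ` {..n}. hs (u x) x) = 0"
    by (auto simp: cv.dependent_finite)
  show ?thesis
    by (rule that[of "\<lambda>i. u (F (v i))"]) (use u True in \<open>auto simp: sum.reindex\<close>)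
next
  case False
  then obtain i j where ij: "i \<le> n" "j \<le> n" "i \<noteq> j" "F (v i) = F (v j)" by (auto simp: inj_on_def)
  define c :: "nat \<Rightarrow> complex" where "c k = (if k = i then 1 else if k = j then - 1 else 0)" for k
  have "(\<Sum>k\<le>n. hs (c k) (F (v k))) = (\<Sum>k\<in>{i, j}. hs (c k) (F (v k)))"
    by (rule sum.mono_neutral_right) (use ij in \<open>auto simp: c_def\<close>)
  also have "\<dots> = 0" using ij by (simp add: c_def)
  finally have "(\<Sum>k\<le>n. hs (c k) (F (v k))) = 0" .
  moreover have "c i \<noteq> 0" by (simp add: c_def)
  ultimately show ?thesis using that[of c] ij(1) by blast
qed

text \<open>For \<open>m < n\<close> the vector \<open>v n\<close> is untouched by removing the
  projection on the first \<open>m\<close> vectors, so the extremal bound at step \<open>m\<close>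
  applies to it.\<close>

lemma svd_decreasing:
  fixes v :: "nat \<Rightarrow> 'h"
  assumes o: "orthsys v UNIV"
    and le: "\<And>n x. norm (A (x - proj v {..<n} x)) \<le> norm (A (v n)) * norm x"
    and "m \<le> n"
  shows "norm (A (v n)) \<le> norm (A (v m))"
proof (cases "m = n")
  case False
  hence "proj v {..<m} (v n) = 0" using o assms(3) by (intro proj_eq_0) (auto simp: orthsys_def)
  hence "norm (A (v n)) \<le> norm (A (v m)) * norm (v n)" using le[of "v n" m] by simp
  also have "\<dots> \<le> norm (A (v m)) * 1"
    using o by (cases "v n = 0") (auto simp: orthsys_def)
  finally show ?thesis by simp
qed simp

text \<open>On the span of \<open>v 0, ..., v n\<close> the operator expands by at least
  \<open>norm (A (v n))\<close>, since the images are orthogonal and the norms decrease. Any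
  \<open>F\<close> of rank at most \<open>n\<close> kills a nonzero vector there.\<close>

lemma svd_le_approx_num:
  fixes v :: "nat \<Rightarrow> 'h"
  assumes A: "A \<in> Bop J" and o: "orthsys v UNIV" and AA: "\<And>i j. i \<noteq> j \<Longrightarrow> cip (A (v i)) (A (v j)) = 0"
    and le: "\<And>n x. norm (A (x - proj v {..<n} x)) \<le> norm (A (v n)) * norm x"
  shows "norm (A (v n)) \<le> approx_num J A n"
proof (cases "A (v n) = 0")
  case True
  thus ?thesis using approx_num_nonneg[OF A] by simp
next
  case False
  \<comment> \<open>A nonzero \<open>A (v n)\<close> excludes zero placeholders among the earlier
    vectors.\<close>
  have v1: "norm (v i) = 1" if "i \<le> n" for i
  proof -
    have "norm (A (v i)) > 0" using svd_decreasing[where A=A, OF o le that] False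
      by (metis norm_le_zero_iff not_less order_trans)
    hence "v i \<noteq> 0" using Bop_0[OF A] by auto
    thus ?thesis using o by (auto simp: orthsys_def)
  qed
  show ?thesis
  proof (rule approx_num_ge)
    fix F assume F: "F \<in> Bop J" "rank_le J F n"
    obtain c where c: "\<exists>i\<le>n. c i \<noteq> 0" "(\<Sum>i\<le>n. hs (c i) (F (v i))) = 0" using dependent_of_rank_le[OF F(2)] by blast
    define x where "x = (\<Sum>i\<le>n. hs (c i) (v i))"
    have Fx: "F x = 0" using c(2) by (simp add: x_def Bop_sum[OF F(1)] Bop_hs[OF F(1)])
    have Ax: "A x = (\<Sum>i\<le>n. hs (c i) (A (v i)))" by (simp add: x_def Bop_sum[OF A] Bop_hs[OF A])
    have nx: "(norm x)\<^sup>2 = (\<Sum>i\<le>n. (cmod (c i))\<^sup>2)" unfolding x_def using o v1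
      by (subst norm_sum_orth) (auto simp: orthsys_def)
    obtain i0 where "i0 \<le> n" "c i0 \<noteq> 0" using c(1) by blast
    hence "(\<Sum>i\<le>n. (cmod (c i))\<^sup>2) > 0" by (intro sum_pos2[of _ i0]) auto
    hence x0: "norm x > 0" using nx by (metis zero_less_norm_iff norm_zero zero_power2 less_irrefl)
    have "(norm (A (v n)) * norm x)\<^sup>2 = (\<Sum>i\<le>n. (cmod (c i))\<^sup>2 * (norm (A (v n)))\<^sup>2)"
      by (simp add: power_mult_distrib nx sum_distrib_left mult.commute)
    also have "\<dots> \<le> (\<Sum>i\<le>n. (cmod (c i))\<^sup>2 * (norm (A (v i)))\<^sup>2)"
      by (intro sum_mono mult_left_mono power_mono svd_decreasing[OF o le]) auto
    also have "\<dots> = (norm (A x))\<^sup>2" unfolding Ax using AA by (subst norm_sum_orth) auto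
    finally have "norm (A (v n)) * norm x \<le> norm (A x)" by (rule power2_le_imp_le) simp
    also have "\<dots> = norm (A x - F x)" using Fx by simp
    also have "\<dots> \<le> onorm (\<lambda>x. A x - F x) * norm x" by (rule Bop_norm_le[OF Bop_minus[OF A F(1)]])
    finally show "norm (A (v n)) \<le> onorm (\<lambda>x. A x - F x)" using x0 by simp
  qed
qed

text \<open>Greedy substitute for a singular value decomposition of an operator not known to be
  compact. After \<open>k\<close> choices there are \<open>2 * k\<close> linear conditions on the
  next vector; composing \<open>S\<close> with the projection on them has rank at most
  \<open>2 * k\<close>, so what remains of \<open>S\<close> still has norm above \<open>c\<close> as
  long as \<open>k \<le> n\<close>.\<close>

lemma orthonormal_images:
  assumes S: "S \<in> Bop J" and c: "c < approx_num J S (2 * n)" "0 \<le> c"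
  obtains v :: "nat \<Rightarrow> 'h" where "\<And>i. i \<le> n \<Longrightarrow> norm (v i) = 1"
    "\<And>i j. i \<le> n \<Longrightarrow> j \<le> n \<Longrightarrow> i \<noteq> j \<Longrightarrow> cip (v i) (v j) = 0 \<and> cip (S (v i)) (S (v j)) = 0"
    "\<And>i. i \<le> n \<Longrightarrow> c < norm (S (v i))"
proof -
  \<comment> \<open>The predicate is void beyond \<open>n\<close>, so the recursion may run over all
    natural numbers.\<close>
  define P where "P v k u \<longleftrightarrow> (k \<le> n \<longrightarrow> norm u = 1 \<and> c < norm (S u) \<and>
      (\<forall>i<k. cip u (v i) = 0 \<and> cip (S u) (S (v i)) = 0))" for v :: "nat \<Rightarrow> 'h" and k u
  have "\<exists>v. \<forall>k. P v k (v k)"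
  proof (rule dependent_wellorder_choice)
    show "P f k r = P g k r" if "\<And>y. y < k \<Longrightarrow> f y = g y" for r k and f g :: "nat \<Rightarrow> 'h"
      using that by (simp add: P_def)
  next
    fix k and f :: "nat \<Rightarrow> 'h"
    show "\<exists>u. P f k u"
    proof (cases "k \<le> n")
      case True
      have "\<exists>z. \<forall>x. cip (S x) (S (f i)) = cip x z" for i using adjoint_exists[OF S] by metis
      then obtain z where z: "\<And>i x. cip (S x) (S (f i)) = cip x (z i)" by metis
      \<comment> \<open>The first \<open>k\<close> entries are the old vectors, the next
        \<open>k\<close> represent the functionals pairing \<open>S x\<close> with
        \<open>S (f i)\<close>. Orthogonality to all of them is both required orthogonalities at
        once.\<close>
      define b where "b j = (if j < k then f j else z (j - k))" for j
      obtain e :: "nat \<Rightarrow> 'h" where e: "orthsys e {..<2*k}" "\<And>i. i < 2 * k \<Longrightarrow> proj e {..<2*k} (b i) = b i"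
        using gram_schmidt by blast
      let ?P = "proj e {..<2*k}"
      have "(\<lambda>x. S (?P x)) = (\<lambda>x. \<Sum>i<2*k. hs (cip x (e i)) (S (e i)))"
        by (simp add: proj_def Bop_sum[OF S] Bop_hs[OF S])
      hence "rank_le J (\<lambda>x. S (?P x)) (2 * k)" using rank_le_proj[of "{..<2*k}" "2 * k"] by simp
      hence "approx_num J S (2 * k) \<le> onorm (\<lambda>x. S x - S (?P x))"
        by (intro approx_num_le S Bop_compose[OF S proj_Bop])
      moreover have "approx_num J S (2 * n) \<le> approx_num J S (2 * k)"
        using approx_num_decseq[OF S] True by (simp add: decseq_def)
      ultimately have big: "c < onorm (\<lambda>x. S x - S (?P x))" using c by simp
      have "\<exists>x. c * norm x < norm (S x - S (?P x))"
      proof (rule ccontr)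
        assume "\<not> ?thesis"
        hence "norm (S x - S (?P x)) \<le> c * norm x" for x by (meson not_less)
        from onorm_bound[OF c(2) this] show False using big by simp
      qed
      then obtain x where x: "c * norm x < norm (S x - S (?P x))" by blast
      define w where "w = x - ?P x"
      have "norm w \<le> norm x" unfolding w_def by (rule norm_proj_le[OF _ e(1)]) simp
      hence "c * norm w \<le> c * norm x" using c by (intro mult_left_mono)
      hence w: "c * norm w < norm (S w)" using x by (simp add: w_def Bop_diff[OF S])
      hence w0: "w \<noteq> 0" using Bop_0[OF S] by auto
      have wb: "cip w (b j) = 0" if "j < 2 * k" for j
        using cip_proj_compl[OF _ e(1), of x "b j"] e(2)[OF that] by (simp add: w_def)
      define u where "u = unitize w"
      have "norm u = 1" using w0 by (simp add: u_def unitize_def norm_inverse)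
      moreover have "c < norm (S u)" using w w0
        by (simp add: u_def unitize_def Bop_hs[OF S] norm_inverse pos_less_divide_eq[symmetric] divide_inverse)
           (simp add: field_simps)
      moreover have "cip u (f i) = 0 \<and> cip (S u) (S (f i)) = 0" if "i < k" for i
        using wb[of i] wb[of "i + k"] that
        by (simp add: z u_def unitize_def cip_hs_left b_def)
      ultimately show ?thesis by (auto simp: P_def)
    qed (simp add: P_def)
  qed
  then obtain v where v: "\<And>k. P v k (v k)" by blast
  have *: "cip (v i) (v j) = 0 \<and> cip (S (v i)) (S (v j)) = 0" if "j < i" "i \<le> n" for i j
    using v[of i] that by (simp add: P_def)
  have "cip (v i) (v j) = 0 \<and> cip (S (v i)) (S (v j)) = 0" if "i \<le> n" "j \<le> n" "i \<noteq> j" for i j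
    using *[of i j] *[of j i] that cip_eq_0_commute by (meson linorder_neqE_nat)
  thus ?thesis using that[of v] v by (simp add: P_def)
qed

end

context hilbert
begin

section \<open>Spaces of operators and s-functions\<close>

text \<open>The easy inequality for \<open>c\<close> and the same inequality for
  \<open>inverse c\<close> together give equality.\<close>

lemma onorm_hs:
  assumes T: "T \<in> Bop J"
  shows "onorm (\<lambda>x. hs c (T x)) = cmod c * onorm T"
proof (cases "c = 0")
  case True
  thus ?thesis by (simp add: onorm_zero)
next
  case False
  have le: "onorm (\<lambda>x. hs c (T x)) \<le> cmod c * onorm T" if T: "T \<in> Bop J" for c T
  proof (rule onorm_bound)
    show "norm (hs c (T x)) \<le> cmod c * onorm T * norm x" for x
      using mult_left_mono[OF Bop_norm_le[OF T, of x], of "cmod c"] by (simp add: mult_ac)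
  qed (simp add: Bop_onorm_nonneg[OF T])
  have "onorm (\<lambda>x. hs (inverse c) (hs c (T x))) \<le> cmod (inverse c) * onorm (\<lambda>x. hs c (T x))"
    by (rule le[OF Bop_scale[OF T]])
  hence "onorm T \<le> inverse (cmod c) * onorm (\<lambda>x. hs c (T x))"
    using False by (simp add: norm_inverse)
  hence "cmod c * onorm T \<le> cmod c * (inverse (cmod c) * onorm (\<lambda>x. hs c (T x)))"
    by (rule mult_left_mono) simp
  also have "\<dots> = onorm (\<lambda>x. hs c (T x))" using False by (simp flip: mult.assoc)
  finally show ?thesis using le[OF T, of c] by simp
qed

lemma Bop_complete:
  assumes X: "\<And>n. X n \<in> Bop J"
    and C: "\<And>e. 0 < e \<Longrightarrow> \<exists>M. \<forall>m\<ge>M. \<forall>n\<ge>M. onorm (\<lambda>x. X m x - X n x) < e"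
  obtains L where "L \<in> Bop J" "(\<lambda>n. onorm (\<lambda>x. X n x - L x)) \<longlonglongrightarrow> 0"
proof -
  have "convergent (\<lambda>n. X n x)" for x
  proof (rule Cauchy_convergent, rule metric_CauchyI)
    fix e :: real assume e: "0 < e"
    define d where "d = e / (norm x + 1)"
    have d: "0 < d" using e by (simp add: d_def add_nonneg_pos)
    obtain M where M: "\<And>m n. m \<ge> M \<Longrightarrow> n \<ge> M \<Longrightarrow> onorm (\<lambda>x. X m x - X n x) < d" using C[OF d] by blast
    have "dist (X m x) (X n x) < e" if "m \<ge> M" "n \<ge> M" for m n
    proof -
      have "norm (X m x - X n x) \<le> onorm (\<lambda>x. X m x - X n x) * norm x"
        by (rule Bop_norm_le[OF Bop_minus[OF X X]])
      also have "\<dots> \<le> d * norm x" using M[OF that] by (intro mult_right_mono) auto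
      also have "\<dots> < d * (norm x + 1)" using d by (intro mult_strict_left_mono) auto
      also have "\<dots> = e" by (simp add: d_def add_nonneg_eq_0_iff)
      finally show ?thesis by (simp add: dist_norm)
    qed
    thus "\<exists>M. \<forall>m\<ge>M. \<forall>n\<ge>M. dist (X m x) (X n x) < e" by blast
  qed
  then obtain L where L: "\<And>x. (\<lambda>n. X n x) \<longlonglongrightarrow> L x" unfolding convergent_def by metis
  have near: "\<exists>M. \<forall>n\<ge>M. \<forall>x. norm (X n x - L x) \<le> e * norm x" if e: "0 < e" for e
  proof -
    obtain M where M: "\<And>m n. m \<ge> M \<Longrightarrow> n \<ge> M \<Longrightarrow> onorm (\<lambda>x. X m x - X n x) < e" using C[OF e] by blast
    have "norm (X n x - L x) \<le> e * norm x" if n: "n \<ge> M" for n x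
    proof (rule LIMSEQ_le_const2)
      show "(\<lambda>m. norm (X n x - X m x)) \<longlonglongrightarrow> norm (X n x - L x)" by (intro tendsto_intros L)
      have "norm (X n x - X m x) \<le> e * norm x" if m: "m \<ge> M" for m
      proof -
        have "norm (X n x - X m x) \<le> onorm (\<lambda>x. X n x - X m x) * norm x"
          by (rule Bop_norm_le[OF Bop_minus[OF X X]])
        also have "\<dots> \<le> e * norm x" using M[OF n m] by (intro mult_right_mono) auto
        finally show ?thesis .
      qed
      thus "\<exists>N. \<forall>m\<ge>N. norm (X n x - X m x) \<le> e * norm x" by blast
    qed
    thus ?thesis by blast
  qed
  obtain M where M: "\<And>x. norm (X M x - L x) \<le> 1 * norm x" using near[of 1] by auto
  have LB: "L \<in> Bop J"
  proof (rule BopI)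
    show "L (x + y) = L x + L y" for x y
      using tendsto_add[OF L[of x] L[of y]] by (intro LIMSEQ_unique[OF L]) (simp add: Bop_add[OF X])
    show "L (hs c x) = hs c (L x)" for c x
      using bounded_linear.tendsto[OF bounded_linear_hs L[of x], of c]
      by (intro LIMSEQ_unique[OF L]) (simp add: Bop_hs[OF X])
    show "norm (L x) \<le> (onorm (X M) + 1) * norm x" for x
      using M[of x] norm_triangle_sub[of "L x" "X M x"] Bop_norm_le[OF X[of M], of x]
      by (simp add: algebra_simps norm_minus_commute)
  qed
  have "(\<lambda>n. onorm (\<lambda>x. X n x - L x)) \<longlonglongrightarrow> 0"
  proof (rule LIMSEQ_I)
    fix e :: real assume e: "0 < e"
    obtain M where M: "\<And>n x. n \<ge> M \<Longrightarrow> norm (X n x - L x) \<le> (e/2) * norm x"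
      using near[OF half_gt_zero[OF e]] by blast
    have "onorm (\<lambda>x. X n x - L x) \<le> e / 2" if "n \<ge> M" for n
      using e M[OF that] by (intro onorm_bound) auto
    hence "norm (onorm (\<lambda>x. X n x - L x) - 0) < e" if "n \<ge> M" for n
      using that e Bop_onorm_nonneg[OF Bop_minus[OF X LB], of n] by fastforce
    thus "\<exists>N. \<forall>n\<ge>N. norm (onorm (\<lambda>x. X n x - L x) - 0) < e" by blast
  qed
  thus ?thesis using that LB by blast
qed

lemma Kop_limit:
  assumes X: "\<And>n. X n \<in> Kop J" and L: "L \<in> Bop J" "(\<lambda>n. onorm (\<lambda>x. X n x - L x)) \<longlonglongrightarrow> 0"
  shows "L \<in> Kop J"
proof -
  have XB: "X n \<in> Bop J" for n using X[of n] by (simp add: Kop_def)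
  have "compact_operator L"
  proof (rule compact_operator_limit)
    fix e :: real assume "0 < e"
    then obtain n where n: "onorm (\<lambda>x. X n x - L x) < e"
      using order_tendstoD(2)[OF L(2)] by (meson eventually_sequentially order_refl)
    have "norm (L x - X n x) < e" if "x \<in> cball 0 1" for x
    proof -
      have "norm (X n x - L x) \<le> onorm (\<lambda>x. X n x - L x) * norm x" by (rule Bop_norm_le[OF Bop_minus[OF XB L(1)]])
      also have "\<dots> \<le> onorm (\<lambda>x. X n x - L x) * 1"
        using that by (intro mult_left_mono Bop_onorm_nonneg[OF Bop_minus[OF XB L(1)]]) auto
      finally show ?thesis using n by (simp add: norm_minus_commute)
    qed
    thus "\<exists>F. compact_operator F \<and> (\<forall>x\<in>cball 0 1. norm (L x - F x) < e)"
      using X[of n] by (auto simp: Kop_def)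
  qed
  thus ?thesis using L by (simp add: Kop_def)
qed

lemma Kop_plus: "S \<in> Kop J \<Longrightarrow> T \<in> Kop J \<Longrightarrow> (\<lambda>x. S x + T x) \<in> Kop J"
  by (simp add: Kop_def Bop_plus compact_operator_add)

lemma Kop_scale: "T \<in> Kop J \<Longrightarrow> (\<lambda>x. hs c (T x)) \<in> Kop J"
  using compact_operator_compose_left[OF Bop_scale[OF Bop_ident], of T c] by (simp add: Kop_def Bop_scale)

text \<open>Completeness comes from that of all bounded operators, so norm-closedness of
  \<open>V\<close> is what has to be supplied; this treats \<open>BH\<close> and \<open>KH\<close>
  together.\<close>

lemma is_bspace_subspace:
  assumes V: "V \<subseteq> Bop J" "(\<lambda>x. 0) \<in> V" "\<And>S T. S \<in> V \<Longrightarrow> T \<in> V \<Longrightarrow> (\<lambda>x. S x + T x) \<in> V"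
    "\<And>c T. T \<in> V \<Longrightarrow> (\<lambda>x. hs c (T x)) \<in> V"
    and closed: "\<And>X L. (\<And>n. X n \<in> V) \<Longrightarrow> L \<in> Bop J \<Longrightarrow> (\<lambda>n. onorm (\<lambda>x. X n x - L x)) \<longlonglongrightarrow> 0 \<Longrightarrow> L \<in> V"
  shows "is_bspace J (V, onorm)"
  unfolding is_bspace_def prod.case uadd_def uzero_def uscale_def usub_def
proof (intro conjI ballI allI impI)
  fix f g assume f: "f \<in> V" and g: "g \<in> V"
  show "onorm (\<lambda>x. f x + g x) \<le> onorm f + onorm g"
    using f g V(1) by (intro onorm_triangle BopD(1)) auto
next
  fix f assume f: "f \<in> V"
  show "0 \<le> onorm f" using f V(1) Bop_onorm_nonneg by auto
  show "(onorm f = 0) = (f = (\<lambda>x. 0))"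
    using f V(1) BopD(1) onorm_eq_0[of f] by (auto simp: fun_eq_iff)
next
  fix c f assume f: "f \<in> V"
  show "onorm (\<lambda>x. hs c (f x)) = cmod c * onorm f" using f V(1) by (intro onorm_hs) auto
next
  fix X :: "nat \<Rightarrow> 'h \<Rightarrow> 'h"
  assume X: "(\<forall>n. X n \<in> V) \<and> (\<forall>e>0. \<exists>M. \<forall>m\<ge>M. \<forall>n\<ge>M. onorm (\<lambda>x. X m x - X n x) < e)"
  obtain L where L: "L \<in> Bop J" "(\<lambda>n. onorm (\<lambda>x. X n x - L x)) \<longlonglongrightarrow> 0"
    using Bop_complete[of X] X V(1) by blast
  show "\<exists>l\<in>V. (\<lambda>n. onorm (\<lambda>x. X n x - l x)) \<longlonglongrightarrow> 0" using closed[OF _ L] X L(2) by blast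
qed (use V in auto)

lemma is_bspace_BH: "is_bspace J (BH J)"
  unfolding BH_def by (rule is_bspace_subspace) (auto simp: Bop_zero Bop_plus Bop_scale)

lemma is_bspace_KH: "is_bspace J (KH J)"
  unfolding KH_def
proof (rule is_bspace_subspace)
  show "(\<lambda>x. 0) \<in> Kop J" by (simp add: Kop_def Bop_zero compact_operator_zero)
  show "Kop J \<subseteq> Bop J" by (auto simp: Kop_def)
qed (auto intro: Kop_plus Kop_scale Kop_limit)

text \<open>Both cases of the theorem run through one argument. It uses that \<open>E\<close>
  contains the rank-one operators, carries the operator norm, and is closed under linear
  combinations and two-sided multiplication.\<close>

definition opspace :: "'h bspace \<Rightarrow> bool" where
  "opspace E \<longleftrightarrow> E = BH J \<or> E = KH J"

lemma opspace_is_bspace: "opspace E \<Longrightarrow> is_bspace J E"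
  by (auto simp: opspace_def is_bspace_BH is_bspace_KH)

lemma opspace_norm: "opspace E \<Longrightarrow> snd E = onorm"
  by (auto simp: opspace_def BH_def KH_def)

lemma opspace_Bop: "opspace E \<Longrightarrow> X \<in> fst E \<Longrightarrow> X \<in> Bop J"
  by (auto simp: opspace_def BH_def KH_def Kop_def)

lemma opspace_rank1: "opspace E \<Longrightarrow> rank1 u v \<in> fst E"
  by (auto simp: opspace_def BH_def KH_def Kop_def rank1_Bop compact_operator_rank1)

lemma opspace_compose:
  assumes "opspace E" "A \<in> Bop J" "B \<in> Bop J" "X \<in> fst E"
  shows "(\<lambda>x. A (X (B x))) \<in> fst E"
proof -
  have XB: "(\<lambda>x. X (B x)) \<in> Bop J" by (rule Bop_compose[OF opspace_Bop[OF assms(1,4)] assms(3)])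
  have "compact_operator X \<Longrightarrow> compact_operator (\<lambda>x. A (X (B x)))"
    using compact_operator_compose_left[OF assms(2) compact_operator_compose_right[OF opspace_Bop[OF assms(1,4)] assms(3)]] .
  thus ?thesis using assms Bop_compose[OF assms(2) XB] by (auto simp: opspace_def BH_def KH_def Kop_def)
qed

lemma opspace_sum:
  assumes "opspace E" "\<And>i. i \<in> S \<Longrightarrow> X i \<in> fst E"
  shows "(\<lambda>x. \<Sum>i\<in>S. X i x) \<in> fst E"
  using assms Bop_finite_sum[of S X] compact_operator_sum[of S X]
  by (auto simp: opspace_def BH_def KH_def Kop_def)

lemma opspace_scale: "opspace E \<Longrightarrow> X \<in> fst E \<Longrightarrow> (\<lambda>x. hs c (X x)) \<in> fst E"
  by (auto simp: opspace_def BH_def KH_def Kop_scale Bop_scale)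

section \<open>Upper and lower bounds for arbitrary s-functions\<close>

lemma op_norm_le:
  assumes "0 \<le> K" "\<And>f. f \<in> fst E \<Longrightarrow> snd F (T f) \<le> K * snd E f"
  shows "op_norm E F T \<le> K"
proof -
  obtain V N W M where E: "E = (V, N)" and F: "F = (W, M)" by (metis surj_pair)
  have "M (T f) \<le> K" if "f \<in> V" "N f \<le> 1" for f
    using assms(2)[of f] mult_left_mono[OF that(2) assms(1)] that(1) by (simp add: E F)
  thus ?thesis unfolding op_norm_def E F prod.case using assms(1) by (intro cSup_least) auto
qed

lemma is_bopI:
  assumes "\<And>f. f \<in> fst E \<Longrightarrow> T f \<in> fst F" "\<And>f. f \<notin> fst E \<Longrightarrow> T f = uzero"
    "\<And>f g. f \<in> fst E \<Longrightarrow> g \<in> fst E \<Longrightarrow> T (uadd f g) = uadd (T f) (T g)"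
    "\<And>c f. f \<in> fst E \<Longrightarrow> T (uscale J c f) = uscale J c (T f)"
    "\<And>f. f \<in> fst E \<Longrightarrow> snd F (T f) \<le> K * snd E f"
  shows "is_bop J E F T"
proof -
  have "\<exists>K. \<forall>f\<in>fst E. snd F (T f) \<le> K * snd E f" using assms(5) by blast
  thus ?thesis using assms(1-4) unfolding is_bop_def by (cases E; cases F) simp
qed

lemma elem_op_is_bop:
  assumes E: "opspace E" and AB: "\<And>i. i < m \<Longrightarrow> A i \<in> Bop J \<and> B i \<in> Bop J"
  shows "is_bop J E E (elem_op E m A B)"
proof (rule is_bopI)
  have add: "uadd f g \<in> fst E" and scale: "uscale J c f \<in> fst E" if "f \<in> fst E" "g \<in> fst E" for c f g
    using opspace_is_bspace[OF E] that by (auto simp: is_bspace_def split: prod.splits)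
  fix f assume f: "f \<in> fst E"
  show "elem_op E m A B f \<in> fst E"
    using opspace_sum[OF E, of "{..<m}" "\<lambda>i x. A i (f (B i x))"] opspace_compose[OF E _ _ f] f AB
    by (simp add: elem_op_def)
  show "elem_op E m A B (uscale J c f) = uscale J c (elem_op E m A B f)" for c
  proof -
    have "(\<Sum>i<m. A i (hs c (f (B i x)))) = (\<Sum>i<m. hs c (A i (f (B i x))))" for x
      using AB by (intro sum.cong) (auto simp: Bop_hs)
    thus ?thesis using f scale[OF f f, of c] by (simp add: elem_op_def uscale_def cv.scale_sum_right)
  qed
  show "elem_op E m A B (uadd f g) = uadd (elem_op E m A B f) (elem_op E m A B g)" if g: "g \<in> fst E" for g
  proof -
    have "(\<Sum>i<m. A i (f (B i x) + g (B i x))) = (\<Sum>i<m. A i (f (B i x)) + A i (g (B i x)))" for x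
      using AB by (intro sum.cong) (auto simp: Bop_add)
    thus ?thesis using f g add[OF f g] by (simp add: elem_op_def uadd_def sum.distrib)
  qed
  show "snd E (elem_op E m A B f) \<le> (\<Sum>i<m. onorm (A i) * onorm (B i)) * snd E f"
  proof -
    have fB: "f \<in> Bop J" by (rule opspace_Bop[OF E f])
    have "onorm (\<lambda>x. \<Sum>i<m. A i (f (B i x))) \<le> (\<Sum>i<m. onorm (A i) * onorm (B i)) * onorm f"
    proof (rule onorm_bound)
      show "0 \<le> (\<Sum>i<m. onorm (A i) * onorm (B i)) * onorm f"
        using AB fB by (intro mult_nonneg_nonneg sum_nonneg) (auto intro: Bop_onorm_nonneg)
      fix x
      have "norm (\<Sum>i<m. A i (f (B i x))) \<le> (\<Sum>i<m. onorm (A i) * (onorm f * (onorm (B i) * norm x)))"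
      proof (rule sum_norm_le)
        fix i assume "i \<in> {..<m}"
        hence i: "A i \<in> Bop J" "B i \<in> Bop J" using AB by auto
        have "norm (A i (f (B i x))) \<le> onorm (A i) * norm (f (B i x))" by (rule Bop_norm_le[OF i(1)])
        also have "\<dots> \<le> onorm (A i) * (onorm f * norm (B i x))"
          by (intro mult_left_mono Bop_norm_le fB Bop_onorm_nonneg i)
        also have "\<dots> \<le> onorm (A i) * (onorm f * (onorm (B i) * norm x))"
          by (intro mult_left_mono Bop_norm_le fB Bop_onorm_nonneg i)
        finally show "norm (A i (f (B i x))) \<le> onorm (A i) * (onorm f * (onorm (B i) * norm x))" .
      qed
      thus "norm (\<Sum>i<m. A i (f (B i x))) \<le> (\<Sum>i<m. onorm (A i) * onorm (B i)) * onorm f * norm x"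
        by (simp add: sum_distrib_left sum_distrib_right mult_ac)
    qed
    thus ?thesis using f by (simp add: elem_op_def opspace_norm[OF E])
  qed
qed (simp add: elem_op_def)

lemma s_function_basic:
  assumes s: "s_function J s" and "is_bspace J E" "is_bspace J F" "is_bop J E F T"
  shows "s E F T 0 = op_norm E F T" "0 \<le> s E F T n" "decseq (s E F T)"
  using s[unfolded s_function_def, THEN conjunct1, rule_format, of E F T] assms(2-)
  by (auto intro: decseq_SucI)

text \<open>Every s-function is dominated by approximation numbers: write \<open>\<Phi>\<close> as
  \<open>G\<close> plus an error, use that \<open>s\<close> vanishes at \<open>n\<close> on
  \<open>G\<close>, and estimate the error by its norm.\<close>

lemma s_function_le:
  assumes s: "s_function J s" and E: "is_bspace J E" and \<Phi>: "is_bop J E E \<Phi>" and G: "is_bop J E E G"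
    and rank: "op_rank_le J E G n" and K: "0 \<le> K"
    and le: "\<And>f. f \<in> fst E \<Longrightarrow> snd E (usub (\<Phi> f) (G f)) \<le> K * snd E f"
  shows "s E E \<Phi> n \<le> K"
proof -
  define D where "D f = usub (\<Phi> f) (G f)" for f
  \<comment> \<open>The closure properties in \<open>is_bspace\<close> are stated for
    \<open>uadd\<close> and \<open>uscale\<close>, so differences are reduced to these.\<close>
  have neg: "usub f g = uadd f (uscale J (-1) g)" for f g :: "'h \<Rightarrow> 'h"
    by (simp add: usub_def uadd_def uscale_def fun_eq_iff)
  have D: "is_bop J E E D"
  proof (rule is_bopI[where K = K])
    show "D f \<in> fst E" if "f \<in> fst E" for f
      using \<Phi> G E that unfolding D_def neg is_bop_def is_bspace_def by (auto split: prod.splits)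
    show "D f = uzero" if "f \<notin> fst E" for f
      using \<Phi> G that unfolding D_def usub_def uzero_def is_bop_def by (auto split: prod.splits)
    show "D (uadd f g) = uadd (D f) (D g)" if "f \<in> fst E" "g \<in> fst E" for f g
      using \<Phi> G that unfolding D_def usub_def is_bop_def by (auto split: prod.splits simp: uadd_def fun_eq_iff)
    show "D (uscale J c f) = uscale J c (D f)" if "f \<in> fst E" for c f
      using \<Phi> G that unfolding D_def usub_def is_bop_def
      by (auto split: prod.splits simp: uscale_def fun_eq_iff cv.scale_right_diff_distrib)
    show "snd E (D f) \<le> K * snd E f" if "f \<in> fst E" for f using le[OF that] by (simp add: D_def)
  qed
  have "s E E (\<lambda>f. uadd (G f) (D f)) n \<le> s E E G n + op_norm E E D"
    using s E G D unfolding s_function_def by blast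
  moreover have "(\<lambda>f. uadd (G f) (D f)) = \<Phi>" by (simp add: D_def uadd_def usub_def fun_eq_iff)
  moreover have "s E E G n = 0" using s E G rank unfolding s_function_def by blast
  moreover have "op_norm E E D \<le> K" by (rule op_norm_le[OF K]) (use le in \<open>simp add: D_def\<close>)
  ultimately show ?thesis by simp
qed

text \<open>The space \<open>\<ell>\<^sub>2\<^sup>n\<close> is modelled by constant functions with values in the span of an
  orthonormal system.\<close>
lemma s_function_ge:
  fixes v :: "nat \<Rightarrow> 'h"
  assumes s: "s_function J s" and E: "is_bspace J E" and \<Phi>: "is_bop J E E \<Phi>"
    and v: "\<And>i. i \<le> n \<Longrightarrow> norm (v i) = 1" "\<And>i j. i \<le> n \<Longrightarrow> j \<le> n \<Longrightarrow> i \<noteq> j \<Longrightarrow> cip (v i) (v j) = 0"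
    and t: "\<And>c. t c \<in> fst E" "\<And>c d. t (\<lambda>i. c i + d i) = uadd (t c) (t d)"
      "\<And>a c. t (\<lambda>i. a * c i) = uscale J a (t c)"
      "\<And>c. snd E (t c) \<le> K * sqrt (\<Sum>i\<le>n. (cmod (c i))\<^sup>2)"
    and r: "\<And>Y Z i. Y \<in> fst E \<Longrightarrow> Z \<in> fst E \<Longrightarrow> r (uadd Y Z) i = r Y i + r Z i"
      "\<And>a Y i. Y \<in> fst E \<Longrightarrow> r (uscale J a Y) i = a * r Y i"
      "\<And>Y. Y \<in> fst E \<Longrightarrow> sqrt (\<Sum>i\<le>n. (cmod (r Y i))\<^sup>2) \<le> L * snd E Y"
    and rt: "\<And>c i. i \<le> n \<Longrightarrow> r (\<Phi> (t c)) i = c i"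
    and KL: "0 \<le> K" "0 \<le> L"
  shows "1 \<le> L * K * s E E \<Phi> n"
proof -
  have o: "orthsys v {..n}" using v by (auto simp: orthsys_def)
  define e where "e c = (\<lambda>_::'h. \<Sum>i\<le>n. hs (c i) (v i))" for c
  define G where "G = (range e, \<lambda>f :: 'h \<Rightarrow> 'h. norm (f 0))"
  have ne: "norm (\<Sum>i\<le>n. hs (c i) (v i)) = sqrt (\<Sum>i\<le>n. (cmod (c i))\<^sup>2)" for c
    using norm_sum_orth[of "{..n}" v c] v by (intro real_sqrt_unique[symmetric]) auto
  have e_add: "uadd (e c) (e d) = e (\<lambda>i. c i + d i)" for c d
    by (simp add: e_def uadd_def cv.scale_left_distrib sum.distrib)
  have e_scale: "uscale J a (e c) = e (\<lambda>i. a * c i)" for a c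
    by (simp add: e_def uscale_def cv.scale_sum_right)
  have e0: "(uzero :: 'h \<Rightarrow> 'h) = e (\<lambda>i. 0)" by (simp add: e_def uzero_def)
  have e_coord: "e (\<lambda>i. cip (e c 0) (v i)) = e c" for c
    using proj_of_sum[OF _ o] by (simp add: e_def proj_def)
  have Gb: "is_bspace J G"
    unfolding is_bspace_def G_def prod.case
  proof (intro conjI ballI allI impI)
    fix f g assume f: "f \<in> range e" and g: "g \<in> range e"
    show "uadd f g \<in> range e" using f g e_add by auto
    show "norm (uadd f g 0) \<le> norm (f 0) + norm (g 0)" by (simp add: uadd_def norm_triangle_ineq)
  next
    fix X :: "nat \<Rightarrow> 'h \<Rightarrow> 'h"
    assume X: "(\<forall>n. X n \<in> range e) \<and> (\<forall>d>0. \<exists>M. \<forall>m\<ge>M. \<forall>n\<ge>M. norm (usub (X m) (X n) 0) < d)"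
    hence "Cauchy (\<lambda>k. X k 0)" by (auto simp: Cauchy_def usub_def dist_norm)
    then obtain l where l: "(\<lambda>k. X k 0) \<longlonglongrightarrow> l" using Cauchy_convergent convergent_def by blast
    have Xk: "X k 0 = proj v {..n} (X k 0)" for k
    proof -
      obtain c where c: "X k = e c" using X by blast
      show ?thesis unfolding c using proj_of_sum[OF _ o, of c] by (simp add: e_def)
    qed
    have "(\<lambda>k. proj v {..n} (X k 0)) \<longlonglongrightarrow> proj v {..n} l"
      by (rule bounded_linear.tendsto[OF BopD(1)[OF proj_Bop] l])
    hence "(\<lambda>k. X k 0) \<longlonglongrightarrow> proj v {..n} l" by (simp flip: Xk)
    hence pl: "l = proj v {..n} l" using LIMSEQ_unique[OF l] by blast
    have el: "e (\<lambda>i. cip l (v i)) 0 = l" using pl by (simp add: e_def proj_def)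
    have "(\<lambda>k. norm (X k 0 - l)) \<longlonglongrightarrow> norm (l - l)" by (intro tendsto_intros l)
    thus "\<exists>l\<in>range e. (\<lambda>n. norm (usub (X n) l 0)) \<longlonglongrightarrow> 0"
      using el by (intro bexI[of _ "e (\<lambda>i. cip l (v i))"]) (auto simp: usub_def)
  next
    fix f assume f: "f \<in> range e"
    show "uscale J c f \<in> range e" for c using f e_scale by auto
    show "(norm (f 0) = 0) = (f = uzero)" using f by (auto simp: uzero_def e_def fun_eq_iff)
    show "norm (uscale J c f 0) = cmod c * norm (f 0)" for c by (simp add: uscale_def)
  qed (auto simp: e0)
  have "is_l2n J G (Suc n)"
    unfolding is_l2n_def
    by (rule exI[of _ "\<lambda>i _. v i"]) (auto simp: G_def e_def lessThan_Suc_atMost ne)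
  hence id1: "s G G (id_on G) n = 1" using s Gb unfolding s_function_def by blast
  \<comment> \<open>\<open>T\<close> embeds the model of the Euclidean space into \<open>E\<close>,
    reading the coordinates of a constant function off its value at 0; \<open>R\<close> returns from
    \<open>E\<close> to the model. Both take the default value \<open>uzero\<close> off their
    domain, as \<open>is_bop\<close> demands.\<close>
  define T where "T f = (if f \<in> range e then t (\<lambda>i. cip (f 0) (v i)) else uzero)" for f :: "'h \<Rightarrow> 'h"
  define R where "R Y = (if Y \<in> fst E then e (r Y) else uzero)" for Y
  have coord: "(\<Sum>i\<le>n. (cmod (cip (e c 0) (v i)))\<^sup>2) = (norm (e c 0))\<^sup>2" for c
    using norm_proj_sq[OF _ o, of "e c 0"] proj_of_sum[OF _ o, of c] by (simp add: e_def)
  have Tle: "snd E (T f) \<le> K * snd G f" if f: "f \<in> fst G" for f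
  proof -
    obtain c where c: "f = e c" using f by (auto simp: G_def)
    show ?thesis using t(4)[of "\<lambda>i. cip (e c 0) (v i)"] unfolding coord by (simp add: T_def c G_def)
  qed
  have T: "is_bop J G E T"
  proof (rule is_bopI[OF _ _ _ _ Tle])
    show "T f \<in> fst E" if "f \<in> fst G" for f using that t(1) by (simp add: T_def G_def)
    show "T f = uzero" if "f \<notin> fst G" for f using that by (simp add: T_def G_def)
    show "T (uadd f g) = uadd (T f) (T g)" if "f \<in> fst G" "g \<in> fst G" for f g
    proof -
      have "uadd f g \<in> range e" using that e_add by (auto simp: G_def)
      thus ?thesis using that by (simp add: T_def G_def flip: t(2)) (simp add: uadd_def cip_add_left)
    qed
    show "T (uscale J c f) = uscale J c (T f)" if "f \<in> fst G" for c f
    proof -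
      have "uscale J c f \<in> range e" using that e_scale by (auto simp: G_def)
      thus ?thesis using that by (simp add: T_def G_def flip: t(3)) (simp add: uscale_def cip_hs_left)
    qed
  qed
  have Rle: "snd G (R Y) \<le> L * snd E Y" if "Y \<in> fst E" for Y
    using that r(3)[of Y] by (simp add: R_def G_def e_def ne)
  have E_add: "uadd f g \<in> fst E" and E_scale: "uscale J c f \<in> fst E" if "f \<in> fst E" "g \<in> fst E" for c f g
    using E that by (auto simp: is_bspace_def split: prod.splits)
  have R: "is_bop J E G R"
  proof (rule is_bopI[OF _ _ _ _ Rle])
    show "R f \<in> fst G" if "f \<in> fst E" for f using that by (simp add: R_def G_def)
    show "R f = uzero" if "f \<notin> fst E" for f using that by (simp add: R_def)
    show "R (uadd f g) = uadd (R f) (R g)" if "f \<in> fst E" "g \<in> fst E" for f g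
      using that E_add r(1) by (simp add: R_def e_add fun_eq_iff[of "r _"]) (simp add: e_def r(1) that)
    show "R (uscale J c f) = uscale J c (R f)" if "f \<in> fst E" for c f
      using that E_scale[OF that that] by (simp add: R_def e_scale) (simp add: e_def r(2) that)
  qed
  have \<Phi>V: "\<Phi> f \<in> fst E" if "f \<in> fst E" for f using \<Phi> that by (auto simp: is_bop_def split: prod.splits)
  have u0: "uzero \<in> fst E" using E by (auto simp: is_bspace_def split: prod.splits)
  have \<Phi>0: "\<Phi> uzero = uzero"
  proof -
    have "\<Phi> (uscale J 0 uzero) = uscale J 0 (\<Phi> uzero)" using \<Phi> u0 by (auto simp: is_bop_def split: prod.splits)
    thus ?thesis by (simp add: uscale_def uzero_def)
  qed
  have R0: "R uzero = uzero"
    using r(2)[OF u0, of 0] u0 by (simp add: R_def e_def uscale_def uzero_def)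
  \<comment> \<open>The axioms concern total functions, so equality is also required outside
    \<open>fst G\<close>; there both sides are \<open>uzero\<close>, by \<open>\<Phi>0\<close> and
    \<open>R0\<close>.\<close>
  have "R \<circ> \<Phi> \<circ> T = id_on G"
  proof
    fix f
    show "(R \<circ> \<Phi> \<circ> T) f = id_on G f"
    proof (cases "f \<in> fst G")
      case True
      then obtain c where c: "f = e c" by (auto simp: G_def)
      have "R (\<Phi> (T f)) = e (r (\<Phi> (T f)))" using True t(1) \<Phi>V by (simp add: R_def T_def G_def)
      also have "\<dots> = e (\<lambda>i. cip (e c 0) (v i))" using rt
        by (simp add: T_def c) (simp add: e_def)
      also have "\<dots> = f" by (simp add: e_coord c)
      finally show ?thesis using True by (simp add: id_on_def)
    next
      case False
      thus ?thesis by (simp add: id_on_def T_def G_def \<Phi>0 R0)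
    qed
  qed
  moreover have "s G G (R \<circ> \<Phi> \<circ> T) n \<le> op_norm E G R * op_norm G E T * s E E \<Phi> n"
    using s Gb E T \<Phi> R unfolding s_function_def by blast
  moreover have "op_norm E G R * op_norm G E T * s E E \<Phi> n \<le> L * K * s E E \<Phi> n"
  proof -
    have sn: "0 \<le> s E E \<Phi> n" by (rule s_function_basic(2)[OF s E E \<Phi>])
    have TK: "op_norm G E T \<le> K" by (rule op_norm_le[OF KL(1) Tle])
    have RL: "op_norm E G R \<le> L" by (rule op_norm_le[OF KL(2) Rle])
    \<comment> \<open>An operator norm equals the zeroth s-number, and s-numbers are nonnegative;
      \<open>mult_mono\<close> needs this sign.\<close>
    have s0: "\<And>A B S. is_bspace J A \<Longrightarrow> is_bspace J B \<Longrightarrow> is_bop J A B S \<Longrightarrow> 0 \<le> op_norm A B S"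
      using s_function_basic(1,2)[OF s] by metis
    show ?thesis by (intro mult_right_mono mult_mono TK RL sn s0[OF Gb E T] KL)
  qed
  ultimately show ?thesis using id1 by simp
qed

end

section \<open>Coefficients of an elementary operator\<close>

text \<open>If the functions \<open>f i\<close> are linearly independent, their value vectors span the whole
  coordinate space.\<close>
lemma dual_vectors:
  fixes f :: "nat \<Rightarrow> 'p \<Rightarrow> complex" and W :: "(nat \<Rightarrow> complex) set"
  assumes add: "\<And>d e. d \<in> W \<Longrightarrow> e \<in> W \<Longrightarrow> (\<lambda>i. d i + e i) \<in> W"
    and scale: "\<And>a d. d \<in> W \<Longrightarrow> (\<lambda>i. a * d i) \<in> W"
    and ev: "\<And>p. (\<lambda>i. f i p) \<in> W" and zero: "(\<lambda>i. 0) \<in> W"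
    and indep: "\<And>c. (\<And>p. (\<Sum>i<m. c i * f i p) = 0) \<Longrightarrow> \<forall>i<m. c i = 0"
  shows "\<forall>j<m. \<exists>d\<in>W. \<forall>i<m. d i = (if i = j then 1 else 0)"
  using indep
proof (induction m)
  case (Suc m)
  have "\<forall>i<m. c i = 0" if "\<And>p. (\<Sum>i<m. c i * f i p) = 0" for c
  proof -
    have "(\<Sum>i<Suc m. (if i < m then c i else 0) * f i p) = 0" for p
      using that[of p] by simp
    from Suc.prems[OF this] show ?thesis by (metis less_SucI)
  qed
  from Suc.IH[OF this] obtain D where D: "\<And>j. j < m \<Longrightarrow> D j \<in> W"
    "\<And>i j. i < m \<Longrightarrow> j < m \<Longrightarrow> D j i = (if i = j then 1 else 0)" by metis
  \<comment> \<open>Otherwise \<open>f m\<close> would be the combination of the earlier functions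
    with coefficients \<open>D j m\<close>, contrary to independence.\<close>
  have "\<exists>p. f m p - (\<Sum>j<m. D j m * f j p) \<noteq> 0"
  proof (rule ccontr)
    assume "\<nexists>p. f m p - (\<Sum>j<m. D j m * f j p) \<noteq> 0"
    hence "(\<Sum>i<Suc m. (if i < m then - D i m else 1) * f i p) = 0" for p
      by (simp add: sum_negf)
    from Suc.prems[OF this] show False by (metis lessI less_irrefl one_neq_zero)
  qed
  then obtain p where p: "f m p - (\<Sum>j<m. D j m * f j p) \<noteq> 0" by blast
  define g where "g = f m p - (\<Sum>j<m. D j m * f j p)"
  have sumW: "(\<lambda>i. \<Sum>j<n. a j * D j i) \<in> W" if "n \<le> m" for a n
    using that
  proof (induction n)
    case (Suc n)
    thus ?case using add[OF _ scale[OF D(1)[of n], of "a n"]] by simp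
  qed (simp add: zero)
  \<comment> \<open>The value vector at \<open>p\<close>, with its components along the earlier dual
    vectors removed: it vanishes at all \<open>i < m\<close>, and division by \<open>g\<close> makes
    its entry at \<open>m\<close> equal to 1.\<close>
  define e where "e i = (1 / g) * (f i p + (-1) * (\<Sum>j<m. f j p * D j i))" for i
  have eW: "e \<in> W" unfolding e_def by (intro scale add ev sumW) simp
  have em: "e m = 1" using p by (simp add: e_def g_def mult.commute)
  have ei: "e i = 0" if "i < m" for i
  proof -
    have "(\<Sum>j<m. f j p * D j i) = (\<Sum>j<m. if j = i then f i p else 0)"
      using D(2)[OF that] by (intro sum.cong) auto
    thus ?thesis using that by (simp add: e_def)
  qed
  show ?case
  proof (intro allI impI)
    fix j assume j: "j < Suc m"
    show "\<exists>d\<in>W. \<forall>i<Suc m. d i = (if i = j then 1 else 0)"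
    proof (cases "j = m")
      case True
      thus ?thesis using eW em ei by (intro bexI[of _ e]) (auto simp: less_Suc_eq)
    next
      case False
      hence j: "j < m" using j by simp
      \<comment> \<open>The old dual vectors are only controlled below \<open>m\<close>; subtracting
        a multiple of \<open>e\<close> corrects the entry at \<open>m\<close> without touching the
        others.\<close>
      have "(\<lambda>i. D j i + (- D j m) * e i) \<in> W" by (intro add scale D j eW)
      thus ?thesis using em ei D(2)[OF _ j] False
        by (intro bexI[of _ "\<lambda>i. D j i + (- D j m) * e i"]) (auto simp: less_Suc_eq)
    qed
  qed
qed simp

context hilbert
begin

text \<open>Test operators have the fixed right factor \<open>y\<close> and a left factor in the
  span of the \<open>v i\<close>, so \<open>t\<close> has norm at most \<open>norm y\<close>. The
  return map pairs \<open>Y x\<close> with the normalised images and divides by their norms, which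
  exceed \<open>c\<close>; Bessel bounds it by \<open>norm x / c\<close>.\<close>

lemma approx_num_left_coefficient:
  assumes s: "s_function J s" and E: "opspace E" and \<Phi>: "is_bop J E E \<Phi>" and S: "S \<in> Bop J"
    and S_eq: "\<And>\<xi>. \<Phi> (rank1 \<xi> y) x = S \<xi>"
  shows "approx_num J S (2 * n) \<le> norm x * norm y * s E E \<Phi> n"
proof (rule ccontr)
  have Eb: "is_bspace J E" by (rule opspace_is_bspace[OF E])
  have s0: "0 \<le> norm x * norm y * s E E \<Phi> n" using s_function_basic(2)[OF s Eb Eb \<Phi>] by simp
  \<comment> \<open>A number strictly between the two sides leaves room for the strict lower bound
    on the images, and the factorization then forces \<open>c\<close> below the left one.\<close>
  assume "\<not> ?thesis"
  then obtain c where c: "norm x * norm y * s E E \<Phi> n < c" "c < approx_num J S (2 * n)"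
    using dense not_less by meson
  hence c0: "0 < c" using s0 by simp
  obtain v :: "nat \<Rightarrow> 'h" where v: "\<And>i. i \<le> n \<Longrightarrow> norm (v i) = 1"
    "\<And>i j. i \<le> n \<Longrightarrow> j \<le> n \<Longrightarrow> i \<noteq> j \<Longrightarrow> cip (v i) (v j) = 0 \<and> cip (S (v i)) (S (v j)) = 0"
    "\<And>i. i \<le> n \<Longrightarrow> c < norm (S (v i))"
    using orthonormal_images[OF S c(2)] c0 by (metis less_imp_le)
  define u where "u i = unitize (S (v i))" for i
  have u: "orthsys u {..n}"
    using v(2) unitize(1) by (auto simp: orthsys_def u_def unitize_def cip_hs_left cip_hs_right)
  define r where "r Y i = cip (Y x) (u i) / complex_of_real (norm (S (v i)))" for Y i
  define t where "t a = rank1 (\<Sum>i\<le>n. hs (a i) (v i)) y" for a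
  have "1 \<le> norm x / c * norm y * s E E \<Phi> n"
  proof (rule s_function_ge[OF s Eb \<Phi> v(1), where t = t and r = r])
    show "cip (v i) (v j) = 0" if "i \<le> n" "j \<le> n" "i \<noteq> j" for i j using v(2)[OF that] by simp
    show "t a \<in> fst E" for a unfolding t_def by (rule opspace_rank1[OF E])
    show "t (\<lambda>i. a i + b i) = uadd (t a) (t b)" for a b
      by (simp add: t_def uadd_def rank1_def cv.scale_left_distrib sum.distrib cv.scale_right_distrib)
    show "t (\<lambda>i. k * a i) = uscale J k (t a)" for k a
      by (simp add: t_def uscale_def rank1_def cv.scale_sum_right mult_ac)
    show "snd E (t a) \<le> norm y * sqrt (\<Sum>i\<le>n. (cmod (a i))\<^sup>2)" for a
    proof -
      have "(norm (\<Sum>i\<le>n. hs (a i) (v i)))\<^sup>2 = (\<Sum>i\<le>n. (cmod (a i))\<^sup>2)"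
        using v(1,2) by (subst norm_sum_orth) auto
      hence "norm (\<Sum>i\<le>n. hs (a i) (v i)) = sqrt (\<Sum>i\<le>n. (cmod (a i))\<^sup>2)"
        by (intro real_sqrt_unique[symmetric]) auto
      thus ?thesis using onorm_rank1_le[of "\<Sum>i\<le>n. hs (a i) (v i)" y]
        by (simp add: t_def opspace_norm[OF E] mult.commute)
    qed
    show "r (uadd Y Z) i = r Y i + r Z i" for Y Z i
      by (simp add: r_def uadd_def cip_add_left add_divide_distrib)
    show "r (uscale J k Y) i = k * r Y i" for k Y i by (simp add: r_def uscale_def cip_hs_left)
    show "sqrt (\<Sum>i\<le>n. (cmod (r Y i))\<^sup>2) \<le> norm x / c * snd E Y" if Y: "Y \<in> fst E" for Y
    proof (rule real_le_lsqrt)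
      have YB: "Y \<in> Bop J" by (rule opspace_Bop[OF E Y])
      show "0 \<le> norm x / c * snd E Y" using c0 Bop_onorm_nonneg[OF YB] by (simp add: opspace_norm[OF E])
      have "(\<Sum>i\<le>n. (cmod (r Y i))\<^sup>2) \<le> (\<Sum>i\<le>n. (cmod (cip (Y x) (u i)))\<^sup>2 / c\<^sup>2)"
        using v(3) c0
        by (intro sum_mono) (auto simp: r_def norm_divide power_divide less_imp_le intro!: divide_left_mono power_mono
            mult_pos_pos zero_less_power intro: order.strict_trans)
      also have "\<dots> \<le> (norm (Y x))\<^sup>2 / c\<^sup>2"
        using bessel[OF _ u, of "Y x"] by (simp add: divide_right_mono flip: sum_divide_distrib)
      also have "\<dots> \<le> (onorm Y * norm x)\<^sup>2 / c\<^sup>2"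
        by (intro divide_right_mono power_mono Bop_norm_le[OF YB]) auto
      also have "\<dots> = (norm x / c * snd E Y)\<^sup>2" by (simp add: opspace_norm[OF E] power_mult_distrib power_divide)
      finally show "(\<Sum>i\<le>n. (cmod (r Y i))\<^sup>2) \<le> (norm x / c * snd E Y)\<^sup>2" .
    qed
    show "r (\<Phi> (t a)) i = a i" if i: "i \<le> n" for a i
    proof -
      have Si: "norm (S (v i)) \<noteq> 0" using v(3)[OF i] c0 by linarith
      have "cip (S (v j)) (u i) = (if j = i then complex_of_real (norm (S (v i))) else 0)" if "j \<le> n" for j
        using v(2)[OF that i] Si
        by (auto simp: u_def unitize_def cip_hs_right cip_self power2_eq_square simp flip: of_real_mult of_real_inverse)
      hence "cip (S (\<Sum>j\<le>n. hs (a j) (v j))) (u i) = (\<Sum>j\<le>n. if j = i then a i * complex_of_real (norm (S (v i))) else 0)"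
        unfolding Bop_sum[OF S] cip_sum_left Bop_hs[OF S] cip_hs_left by (intro sum.cong) auto
      thus ?thesis using Si i by (simp add: r_def t_def S_eq)
    qed
  qed (use c0 in auto)
  hence "c \<le> norm x * norm y * s E E \<Phi> n" using c0 by (simp add: field_simps)
  thus False using c by simp
qed

text \<open>Dual construction: the left factor \<open>x\<close> of the test operators is fixed and
  the right factor varies over the span of the normalised images, while the return map evaluates at
  the \<open>v i\<close> and pairs with \<open>y\<close>.\<close>

lemma approx_num_right_coefficient:
  assumes s: "s_function J s" and E: "opspace E" and \<Phi>: "is_bop J E E \<Phi>" and S: "S \<in> Bop J"
    and S_eq: "\<And>\<eta> z. cip (\<Phi> (rank1 x \<eta>) z) y = cip (S z) \<eta>"
  shows "approx_num J S (2 * n) \<le> norm x * norm y * s E E \<Phi> n"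
proof (rule ccontr)
  have Eb: "is_bspace J E" by (rule opspace_is_bspace[OF E])
  have s0: "0 \<le> norm x * norm y * s E E \<Phi> n" using s_function_basic(2)[OF s Eb Eb \<Phi>] by simp
  assume "\<not> ?thesis"
  then obtain c where c: "norm x * norm y * s E E \<Phi> n < c" "c < approx_num J S (2 * n)"
    using dense not_less by meson
  hence c0: "0 < c" using s0 by simp
  obtain v :: "nat \<Rightarrow> 'h" where v: "\<And>i. i \<le> n \<Longrightarrow> norm (v i) = 1"
    "\<And>i j. i \<le> n \<Longrightarrow> j \<le> n \<Longrightarrow> i \<noteq> j \<Longrightarrow> cip (v i) (v j) = 0 \<and> cip (S (v i)) (S (v j)) = 0"
    "\<And>i. i \<le> n \<Longrightarrow> c < norm (S (v i))"
    using orthonormal_images[OF S c(2)] c0 by (metis less_imp_le)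
  define u where "u i = unitize (S (v i))" for i
  have uo: "cip (u i) (u j) = 0" if "i \<le> n" "j \<le> n" "i \<noteq> j" for i j
    using v(2)[OF that] by (simp add: u_def unitize_def cip_hs_left cip_hs_right)
  have u1: "norm (u i) = 1" if "i \<le> n" for i
    using v(3)[OF that] c0 unitize(1)[of "S (v i)"] unitize(2)[of "S (v i)"] by (auto simp: u_def)
  define r where "r Y i = cip (Y (v i)) y / complex_of_real (norm (S (v i)))" for Y i
  \<comment> \<open>The conjugates cancel the conjugate-linearity of \<open>rank1\<close> in its
    second argument, making \<open>t\<close> linear.\<close>
  define t where "t a = rank1 x (\<Sum>i\<le>n. hs (cnj (a i)) (u i))" for a
  have t_eq: "t a z = hs (\<Sum>i\<le>n. a i * cip z (u i)) x" for a z
    by (simp add: t_def rank1_def cip_sum_right cip_hs_right)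
  have "1 \<le> norm y / c * norm x * s E E \<Phi> n"
  proof (rule s_function_ge[OF s Eb \<Phi> v(1), where t = t and r = r])
    show "cip (v i) (v j) = 0" if "i \<le> n" "j \<le> n" "i \<noteq> j" for i j using v(2)[OF that] by simp
    show "t a \<in> fst E" for a unfolding t_def by (rule opspace_rank1[OF E])
    show "t (\<lambda>i. a i + b i) = uadd (t a) (t b)" for a b
      by (simp add: fun_eq_iff t_eq uadd_def distrib_right sum.distrib cv.scale_left_distrib)
    show "t (\<lambda>i. k * a i) = uscale J k (t a)" for k a
      by (simp add: fun_eq_iff t_eq uscale_def sum_distrib_left mult_ac)
    show "snd E (t a) \<le> norm x * sqrt (\<Sum>i\<le>n. (cmod (a i))\<^sup>2)" for a
    proof -
      have "(norm (\<Sum>i\<le>n. hs (cnj (a i)) (u i)))\<^sup>2 = (\<Sum>i\<le>n. (cmod (a i))\<^sup>2)"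
        using uo u1 by (subst norm_sum_orth) auto
      hence "norm (\<Sum>i\<le>n. hs (cnj (a i)) (u i)) = sqrt (\<Sum>i\<le>n. (cmod (a i))\<^sup>2)"
        by (intro real_sqrt_unique[symmetric]) auto
      thus ?thesis using onorm_rank1_le[of x "\<Sum>i\<le>n. hs (cnj (a i)) (u i)"]
        by (simp add: t_def opspace_norm[OF E])
    qed
    show "r (uadd Y Z) i = r Y i + r Z i" for Y Z i
      by (simp add: r_def uadd_def cip_add_left add_divide_distrib)
    show "r (uscale J k Y) i = k * r Y i" for k Y i by (simp add: r_def uscale_def cip_hs_left)
    show "sqrt (\<Sum>i\<le>n. (cmod (r Y i))\<^sup>2) \<le> norm y / c * snd E Y" if Y: "Y \<in> fst E" for Y
    proof (rule real_le_lsqrt)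
      have YB: "Y \<in> Bop J" by (rule opspace_Bop[OF E Y])
      show "0 \<le> norm y / c * snd E Y" using c0 Bop_onorm_nonneg[OF YB] by (simp add: opspace_norm[OF E])
      define a where "a i = cip (Y (v i)) y" for i
      define Q where "Q = (\<Sum>i\<le>n. (cmod (a i))\<^sup>2)"
      \<comment> \<open>Duality in place of an adjoint of \<open>Y\<close>: with these coefficients
        \<open>cip (Y w) y\<close> equals \<open>Q\<close>, while the norm of \<open>w\<close> is
        \<open>sqrt Q\<close>. Cancelling one factor \<open>sqrt Q\<close> bounds the coefficient
        vector.\<close>
      define w where "w = (\<Sum>i\<le>n. hs (cnj (a i)) (v i))"
      have Q0: "0 \<le> Q" by (simp add: Q_def sum_nonneg)
      have "(norm w)\<^sup>2 = Q" unfolding w_def Q_def using v by (subst norm_sum_orth) auto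
      hence nw: "norm w = sqrt Q" by (intro real_sqrt_unique[symmetric]) auto
      have "cip (Y w) y = (\<Sum>i\<le>n. cnj (a i) * a i)"
        by (simp add: w_def Bop_sum[OF YB] Bop_hs[OF YB] cip_sum_left cip_hs_left a_def)
      also have "\<dots> = complex_of_real Q"
        unfolding Q_def of_real_sum by (intro sum.cong refl) (metis complex_norm_square mult.commute)
      finally have "Q \<le> norm (Y w) * norm y" using cmod_cip_le[of "Y w" y] Q0 by simp
      also have "\<dots> \<le> (onorm Y * norm w) * norm y" by (intro mult_right_mono Bop_norm_le[OF YB]) simp
      finally have le: "sqrt Q * sqrt Q \<le> (onorm Y * norm y) * sqrt Q" using Q0 by (simp add: nw mult_ac)
      have "sqrt Q \<le> onorm Y * norm y"
      proof (cases "Q = 0")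
        case False
        thus ?thesis using Q0 mult_right_le_imp_le[OF le] by simp
      qed (simp add: Bop_onorm_nonneg[OF YB])
      hence Q: "Q \<le> (onorm Y * norm y)\<^sup>2" using Q0 by (simp add: sqrt_le_D)
      have "(\<Sum>i\<le>n. (cmod (r Y i))\<^sup>2) \<le> (\<Sum>i\<le>n. (cmod (a i))\<^sup>2 / c\<^sup>2)"
        using v(3) c0
        by (intro sum_mono) (auto simp: r_def a_def norm_divide power_divide less_imp_le intro!: divide_left_mono power_mono
            mult_pos_pos zero_less_power intro: order.strict_trans)
      also have "\<dots> = Q / c\<^sup>2" by (simp add: Q_def flip: sum_divide_distrib)
      also have "\<dots> \<le> (onorm Y * norm y)\<^sup>2 / c\<^sup>2" using Q by (intro divide_right_mono) auto
      also have "\<dots> = (norm y / c * snd E Y)\<^sup>2" by (simp add: opspace_norm[OF E] power_mult_distrib power_divide)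
      finally show "(\<Sum>i\<le>n. (cmod (r Y i))\<^sup>2) \<le> (norm y / c * snd E Y)\<^sup>2" .
    qed
    show "r (\<Phi> (t a)) i = a i" if i: "i \<le> n" for a i
    proof -
      have Si: "norm (S (v i)) \<noteq> 0" using v(3)[OF i] c0 by linarith
      have "cip (S (v i)) (u j) = (if j = i then complex_of_real (norm (S (v i))) else 0)" if "j \<le> n" for j
        using v(2)[OF i that] Si
        by (auto simp: u_def unitize_def cip_hs_right cip_self power2_eq_square simp flip: of_real_mult of_real_inverse)
      hence "cip (S (v i)) (\<Sum>j\<le>n. hs (cnj (a j)) (u j)) = (\<Sum>j\<le>n. if j = i then a i * complex_of_real (norm (S (v i))) else 0)"
        unfolding cip_sum_right cip_hs_right by (intro sum.cong) auto
      thus ?thesis using Si i by (simp add: r_def t_def S_eq)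
    qed
  qed (use c0 in auto)
  hence "c \<le> norm x * norm y * s E E \<Phi> n" using c0 by (simp add: field_simps)
  thus False using c by simp
qed

text \<open>Solving the relation for \<open>A j\<close> and substituting moves its scalars to the
  right factors: each remaining \<open>B i\<close> is replaced by
  \<open>B i - (c i / c j) B j\<close>, and one term disappears.\<close>

lemma elem_op_reduce_left:
  assumes E: "opspace E" and AB: "\<And>i. i < m \<Longrightarrow> A i \<in> Bop J \<and> B i \<in> Bop J"
    and dep: "\<And>x. (\<Sum>i<m. hs (c i) (A i x)) = 0" and j: "j < m" "c j \<noteq> 0"
  shows "\<exists>A' B'. (\<forall>i<m-1. A' i \<in> Bop J \<and> B' i \<in> Bop J) \<and> elem_op E m A B = elem_op E (m-1) A' B'"
proof -
  define N where "N = {..<m} - {j}"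
  have N: "finite N" "card N = m - 1" "{..<m} = insert j N" "j \<notin> N" using j by (auto simp: N_def)
  obtain h where h: "bij_betw h {..<m-1} N" using ex_bij_betw_nat_finite[OF N(1)] N(2) by (auto simp: atLeast0LessThan)
  have hm: "h k < m" if "k < m - 1" for k using h that by (auto simp: bij_betw_def N_def)
  define B0 where "B0 i x = B i x - hs (c i / c j) (B j x)" for i x
  have B0: "B0 i \<in> Bop J" if "i < m" for i
    unfolding B0_def[abs_def] using AB that j by (intro Bop_minus Bop_scale) auto
  have Aj: "A j y = - (\<Sum>i\<in>N. hs (c i / c j) (A i y))" for y
  proof -
    have "hs (c j) (A j y) + (\<Sum>i\<in>N. hs (c i) (A i y)) = 0" using dep[of y] N by simp
    hence "hs (1 / c j) (hs (c j) (A j y)) + hs (1 / c j) (\<Sum>i\<in>N. hs (c i) (A i y)) = 0"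
      by (metis cv.scale_right_distrib cv.scale_zero_right)
    thus ?thesis using j by (simp add: cv.scale_sum_right add_eq_0_iff2)
  qed
  have "(\<Sum>i<m. A i (X (B i x))) = (\<Sum>k<m-1. A (h k) (X (B0 (h k) x)))" if X: "X \<in> Bop J" for X x
  proof -
    have "(\<Sum>i<m. A i (X (B i x))) = A j (X (B j x)) + (\<Sum>i\<in>N. A i (X (B i x)))" using N by simp
    also have "\<dots> = (\<Sum>i\<in>N. A i (X (B i x)) - hs (c i / c j) (A i (X (B j x))))"
      by (simp add: Aj sum_subtractf)
    also have "\<dots> = (\<Sum>i\<in>N. A i (X (B0 i x)))"
      using AB by (intro sum.cong) (auto simp: B0_def N_def Bop_diff Bop_hs X)
    also have "\<dots> = (\<Sum>k<m-1. A (h k) (X (B0 (h k) x)))" by (rule sum.reindex_bij_betw[OF h, symmetric])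
    finally show ?thesis .
  qed
  hence "elem_op E m A B = elem_op E (m-1) (\<lambda>k. A (h k)) (\<lambda>k. B0 (h k))"
    using opspace_Bop[OF E] by (auto simp: elem_op_def fun_eq_iff)
  thus ?thesis using AB B0 hm by (intro exI[of _ "\<lambda>k. A (h k)"] exI[of _ "\<lambda>k. B0 (h k)"]) auto
qed

text \<open>Here \<open>B j\<close> is eliminated instead; complex linearity of \<open>X\<close> and
  of \<open>A j\<close> carries the scalars over to the left factors.\<close>

lemma elem_op_reduce_right:
  assumes E: "opspace E" and AB: "\<And>i. i < m \<Longrightarrow> A i \<in> Bop J \<and> B i \<in> Bop J"
    and dep: "\<And>x. (\<Sum>i<m. hs (c i) (B i x)) = 0" and j: "j < m" "c j \<noteq> 0"
  shows "\<exists>A' B'. (\<forall>i<m-1. A' i \<in> Bop J \<and> B' i \<in> Bop J) \<and> elem_op E m A B = elem_op E (m-1) A' B'"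
proof -
  define N where "N = {..<m} - {j}"
  have N: "finite N" "card N = m - 1" "{..<m} = insert j N" "j \<notin> N" using j by (auto simp: N_def)
  obtain h where h: "bij_betw h {..<m-1} N" using ex_bij_betw_nat_finite[OF N(1)] N(2) by (auto simp: atLeast0LessThan)
  have hm: "h k < m" if "k < m - 1" for k using h that by (auto simp: bij_betw_def N_def)
  define A0 where "A0 i x = A i x - hs (c i / c j) (A j x)" for i x
  have A0: "A0 i \<in> Bop J" if "i < m" for i
    unfolding A0_def[abs_def] using AB that j by (intro Bop_minus Bop_scale) auto
  have Bj: "B j y = (\<Sum>i\<in>N. hs (- (c i / c j)) (B i y))" for y
  proof -
    have "hs (c j) (B j y) + (\<Sum>i\<in>N. hs (c i) (B i y)) = 0" using dep[of y] N by simp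
    hence "hs (1 / c j) (hs (c j) (B j y)) + hs (1 / c j) (\<Sum>i\<in>N. hs (c i) (B i y)) = 0"
      by (metis cv.scale_right_distrib cv.scale_zero_right)
    thus ?thesis using j by (simp add: cv.scale_sum_right add_eq_0_iff2 sum_negf)
  qed
  have "(\<Sum>i<m. A i (X (B i x))) = (\<Sum>k<m-1. A0 (h k) (X (B (h k) x)))" if X: "X \<in> Bop J" for X x
  proof -
    have Aj: "A j \<in> Bop J" using AB j by blast
    have "(\<Sum>i<m. A i (X (B i x))) = A j (X (B j x)) + (\<Sum>i\<in>N. A i (X (B i x)))" using N by simp
    also have "A j (X (B j x)) = (\<Sum>i\<in>N. hs (- (c i / c j)) (A j (X (B i x))))"
      unfolding Bj by (simp only: Bop_sum[OF X] Bop_hs[OF X] Bop_sum[OF Aj] Bop_hs[OF Aj])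
    also have "\<dots> + (\<Sum>i\<in>N. A i (X (B i x))) = (\<Sum>i\<in>N. A0 i (X (B i x)))"
      by (simp add: A0_def sum_subtractf sum_negf)
    also have "\<dots> = (\<Sum>k<m-1. A0 (h k) (X (B (h k) x)))" by (rule sum.reindex_bij_betw[OF h, symmetric])
    finally show ?thesis .
  qed
  hence "elem_op E m A B = elem_op E (m-1) (\<lambda>k. A0 (h k)) (\<lambda>k. B (h k))"
    using opspace_Bop[OF E] by (auto simp: elem_op_def fun_eq_iff)
  thus ?thesis using AB A0 hm by (intro exI[of _ "\<lambda>k. A0 (h k)"] exI[of _ "\<lambda>k. B (h k)"]) auto
qed

lemma minimal_representation:
  assumes E: "opspace E" and \<Phi>: "elementary_op J E \<Phi>"
  obtains m A B where "\<And>i. i < m \<Longrightarrow> A i \<in> Bop J \<and> B i \<in> Bop J" "\<Phi> = elem_op E m A B"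
    "\<And>c. (\<And>x. (\<Sum>i<m. hs (c i) (A i x)) = 0) \<Longrightarrow> \<forall>i<m. c i = 0"
    "\<And>c. (\<And>x. (\<Sum>i<m. hs (c i) (B i x)) = 0) \<Longrightarrow> \<forall>i<m. c i = 0"
proof -
  define R where "R m \<longleftrightarrow> (\<exists>A B. (\<forall>i<m. A i \<in> Bop J \<and> B i \<in> Bop J) \<and> \<Phi> = elem_op E m A B)" for m
  have "\<exists>m. R m" using \<Phi> by (simp add: R_def elementary_op_def)
  define m where "m = (LEAST m. R m)"
  have "R m" unfolding m_def using \<open>\<exists>m. R m\<close> by (rule LeastI_ex)
  then obtain A B where AB: "\<And>i. i < m \<Longrightarrow> A i \<in> Bop J \<and> B i \<in> Bop J" "\<Phi> = elem_op E m A B"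
    by (auto simp: R_def)
  \<comment> \<open>The index \<open>j\<close> witnesses \<open>m > 0\<close>, without which
    truncated subtraction would give \<open>m - 1 = m\<close>.\<close>
  have no: "\<not> R (m - 1)" if "j < m" for j
    using that not_less_Least[of "m - 1" R] by (simp add: m_def)
  have "\<forall>i<m. c i = 0" if dep: "\<And>x. (\<Sum>i<m. hs (c i) (A i x)) = 0" for c
  proof (intro allI impI, rule ccontr)
    fix j assume j: "j < m" "c j \<noteq> 0"
    from elem_op_reduce_left[OF E AB(1) dep j] have "R (m - 1)" by (simp add: R_def AB(2))
    thus False using no[OF j(1)] by blast
  qed
  moreover have "\<forall>i<m. c i = 0" if dep: "\<And>x. (\<Sum>i<m. hs (c i) (B i x)) = 0" for c
  proof (intro allI impI, rule ccontr)
    fix j assume j: "j < m" "c j \<noteq> 0"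
    from elem_op_reduce_right[OF E AB(1) dep j] have "R (m - 1)" by (simp add: R_def AB(2))
    thus False using no[OF j(1)] by blast
  qed
  ultimately show ?thesis using that AB by blast
qed

text \<open>The coefficient vectors \<open>d\<close> whose combination of the \<open>T i\<close> has
  singular numbers in \<open>I\<close> form a linear space. It contains all vectors of matrix
  entries of the \<open>R i\<close>, which by independence exhaust the first \<open>m\<close>
  coordinates; hence it contains a vector selecting \<open>T j\<close>. Used once with
  \<open>T = A\<close>, \<open>R = B\<close> and once with the roles exchanged.\<close>

lemma coefficient_mem:
  assumes I: "calkin_space I" and T: "\<And>i. i < m \<Longrightarrow> T i \<in> Bop J" and R: "\<And>i. i < m \<Longrightarrow> R i \<in> Bop J"
    and indep: "\<And>c. (\<And>x. (\<Sum>i<m. hs (c i) (R i x)) = 0) \<Longrightarrow> \<forall>i<m. c i = 0"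
    and mem: "\<And>x y. sing_seq J (\<lambda>z. \<Sum>i<m. hs (cip (R i x) y) (T i z)) \<in> I"
    and j: "j < (m::nat)"
  shows "sing_seq J (T j) \<in> I"
proof -
  define W where "W = {d. sing_seq J (\<lambda>z. \<Sum>i<m. hs (d i) (T i z)) \<in> I}"
  have B: "(\<lambda>z. \<Sum>i<m. hs (d i) (T i z)) \<in> Bop J" for d
    using T by (intro Bop_finite_sum Bop_scale) auto
  have "\<forall>j<m. \<exists>d\<in>W. \<forall>i<m. d i = (if i = j then 1 else 0)"
  proof (rule dual_vectors[where f = "\<lambda>i p. cip (R i (fst p)) (snd p)"])
    show "(\<lambda>i. d i + e i) \<in> W" if "d \<in> W" "e \<in> W" for d e
      using sing_seq_add[OF I B[of d] B[of e]] that
      by (simp add: W_def cv.scale_left_distrib sum.distrib)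
    show "(\<lambda>i. a * d i) \<in> W" if "d \<in> W" for a d
      using sing_seq_scale[OF I B[of d], of a] that by (simp add: W_def cv.scale_sum_right)
    show "(\<lambda>i. cip (R i (fst p)) (snd p)) \<in> W" for p using mem by (simp add: W_def)
    show "(\<lambda>i. 0) \<in> W" using sing_seq_zero[OF I] by (simp add: W_def)
    fix c assume c: "\<And>p. (\<Sum>i<m. c i * cip (R i (fst p)) (snd p)) = 0"
    have "(\<Sum>i<m. hs (c i) (R i x)) = 0" for x
    proof (rule cip_ext)
      show "cip (\<Sum>i<m. hs (c i) (R i x)) y = cip 0 y" for y
        using c[of "(x, y)"] by (simp add: cip_sum_left cip_hs_left)
    qed
    thus "\<forall>i<m. c i = 0" by (rule indep)
  qed
  then obtain d where d: "d \<in> W" "\<And>i. i < m \<Longrightarrow> d i = (if i = j then 1 else 0)" using j by blast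
  have "(\<Sum>i<m. hs (d i) (T i z)) = T j z" for z
  proof -
    have "(\<Sum>i<m. hs (d i) (T i z)) = (\<Sum>i<m. if i = j then T j z else 0)"
      using d(2) by (intro sum.cong) auto
    thus ?thesis using j by simp
  qed
  thus ?thesis using d(1) by (simp add: W_def)
qed

lemma coefficients_of_s_function_mem:
  assumes s: "s_function J s" and E: "opspace E" and I: "calkin_space I" and \<Phi>: "elementary_op J E \<Phi>"
    and mem: "(\<lambda>n. complex_of_real (s E E \<Phi> n)) \<in> I"
  shows "\<exists>m A B. (\<forall>i<m. A i \<in> Bop J \<and> B i \<in> Bop J) \<and> \<Phi> = elem_op E m A B
       \<and> (\<forall>i<m. sing_seq J (A i) \<in> I \<and> sing_seq J (B i) \<in> I)"
proof -
  obtain m A B where AB: "\<And>i. i < m \<Longrightarrow> A i \<in> Bop J \<and> B i \<in> Bop J" and \<Phi>_eq: "\<Phi> = elem_op E m A B"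
    and indA: "\<And>c. (\<And>x. (\<Sum>i<m. hs (c i) (A i x)) = 0) \<Longrightarrow> \<forall>i<m. c i = 0"
    and indB: "\<And>c. (\<And>x. (\<Sum>i<m. hs (c i) (B i x)) = 0) \<Longrightarrow> \<forall>i<m. c i = 0"
    using minimal_representation[OF E \<Phi>] by blast
  have bop: "is_bop J E E \<Phi>" unfolding \<Phi>_eq by (rule elem_op_is_bop[OF E AB])
  have Eb: "is_bspace J E" by (rule opspace_is_bspace[OF E])
  have AB': "\<And>i. i < m \<Longrightarrow> A i \<in> Bop J" "\<And>i. i < m \<Longrightarrow> B i \<in> Bop J" using AB by auto
  have fromdouble: "sing_seq J S \<in> I"
    if S: "S \<in> Bop J" and le: "\<And>n. approx_num J S (2 * n) \<le> K * s E E \<Phi> n" and K: "0 \<le> K" for S K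
  proof (rule approx_num_mem_of_double[OF I S _ _ _ le])
    show "decseq (\<lambda>n. K * s E E \<Phi> n)"
      using s_function_basic(3)[OF s Eb Eb bop] K by (auto simp: decseq_def intro: mult_left_mono)
    show "0 \<le> K * s E E \<Phi> n" for n using K s_function_basic(2)[OF s Eb Eb bop] by simp
    show "(\<lambda>n. complex_of_real (K * s E E \<Phi> n)) \<in> I" using calkin_scale[OF I mem, of "complex_of_real K"] by simp
  qed
  \<comment> \<open>Read as an operator in \<open>u\<close> this is a combination of the
    \<open>A i\<close>; paired with a fixed vector and read as a function of \<open>x\<close>, it
    yields a combination of the \<open>B i\<close>.\<close>
  have \<Phi>1: "\<Phi> (rank1 u y) x = (\<Sum>i<m. hs (cip (B i x) y) (A i u))" for u x y
    unfolding \<Phi>_eq elem_op_def using opspace_rank1[OF E, of u y] AB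
    by (auto simp: rank1_def[of u y] Bop_hs intro!: sum.cong)
  have "sing_seq J (A j) \<in> I" if j: "j < m" for j
  proof (rule coefficient_mem[OF I AB'(1) AB'(2) indB _ j])
    fix x y
    show "sing_seq J (\<lambda>z. \<Sum>i<m. hs (cip (B i x) y) (A i z)) \<in> I"
    proof (rule fromdouble)
      show *: "(\<lambda>z. \<Sum>i<m. hs (cip (B i x) y) (A i z)) \<in> Bop J"
        using AB by (intro Bop_finite_sum Bop_scale) auto
      show "approx_num J (\<lambda>z. \<Sum>i<m. hs (cip (B i x) y) (A i z)) (2 * n) \<le> norm x * norm y * s E E \<Phi> n" for n
        by (rule approx_num_left_coefficient[OF s E bop *]) (rule \<Phi>1)
    qed simp
  qed
  moreover have "sing_seq J (B j) \<in> I" if j: "j < m" for j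
  proof (rule coefficient_mem[OF I AB'(2) AB'(1) indA _ j])
    fix x y
    show "sing_seq J (\<lambda>z. \<Sum>i<m. hs (cip (A i x) y) (B i z)) \<in> I"
    proof (rule fromdouble)
      show *: "(\<lambda>z. \<Sum>i<m. hs (cip (A i x) y) (B i z)) \<in> Bop J"
        using AB by (intro Bop_finite_sum Bop_scale) auto
      show "approx_num J (\<lambda>z. \<Sum>i<m. hs (cip (A i x) y) (B i z)) (2 * n) \<le> norm x * norm y * s E E \<Phi> n" for n
        by (rule approx_num_right_coefficient[OF s E bop *])
          (simp add: \<Phi>1 cip_sum_left cip_hs_left mult.commute)
    qed simp
  qed
  ultimately show ?thesis using AB \<Phi>_eq by blast
qed

end

section \<open>Approximation of elementary operators\<close>

lemma dyadic_level:
  fixes x C :: real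
  assumes "0 < x" "x \<le> C"
  obtains p where "C / 2 ^ Suc p < x" "x \<le> C / 2 ^ p"
proof -
  obtain n where n: "C / x < 2 ^ n" using real_arch_pow[of 2 "C / x"] by auto
  have C: "0 < C" using assms by simp
  define P where "P n \<longleftrightarrow> C / 2 ^ n < x" for n :: nat
  have P: "P n" using n assms by (simp add: P_def field_simps)
  have P0: "\<not> P 0" using assms by (simp add: P_def)
  define p where "p = (LEAST n. P n)"
  have "P p" unfolding p_def using P by (rule LeastI)
  hence "p \<noteq> 0" using P0 by metis
  then obtain p' where p': "p = Suc p'" by (cases p) auto
  have "\<not> P p'" using not_less_Least[of p' P] p' by (simp add: p_def)
  thus ?thesis using \<open>P p\<close> that[of p'] by (simp add: P_def p' not_less)
qed

context hilbert
begin

section \<open>Finite-rank approximation on spaces of operators\<close>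

lemma uspan_image:
  fixes b :: "'i \<Rightarrow> 'h \<Rightarrow> 'h"
  assumes "finite S"
  shows "(\<lambda>x. \<Sum>i\<in>S. hs (c i) (b i x)) \<in> uspan J (b ` S)"
proof -
  \<comment> \<open>Since \<open>uspan\<close> sums over a set while \<open>b\<close> may repeat
    values, coefficients of equal operators are collected.\<close>
  have "(\<Sum>i\<in>S. hs (c i) (b i x)) = (\<Sum>y\<in>b ` S. hs (\<Sum>i\<in>{i\<in>S. b i = y}. c i) (y x))" for x
  proof -
    have "(\<Sum>i\<in>S. hs (c i) (b i x)) = (\<Sum>y\<in>b ` S. \<Sum>i\<in>{i\<in>S. b i = y}. hs (c i) (b i x))"
      by (rule sum.image_gen[OF assms])
    also have "\<dots> = (\<Sum>y\<in>b ` S. hs (\<Sum>i\<in>{i\<in>S. b i = y}. c i) (y x))"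
      by (intro sum.cong refl) (simp add: cv.scale_sum_left)
    finally show ?thesis .
  qed
  thus ?thesis by (auto simp: uspan_def)
qed

lemma uspan_mono:
  assumes "finite C" "B \<subseteq> C" "f \<in> uspan J B"
  shows "f \<in> uspan J C"
proof -
  obtain c where c: "f = (\<lambda>x. \<Sum>b\<in>B. hs (c b) (b x))" using assms(3) by (auto simp: uspan_def)
  have "(\<Sum>b\<in>B. hs (c b) (b x)) = (\<Sum>b\<in>C. hs (if b \<in> B then c b else 0) (b x))" for x
    using assms(1,2) by (intro sum.mono_neutral_cong_left) auto
  thus ?thesis unfolding c uspan_def by (intro CollectI exI[of _ "\<lambda>b. if b \<in> B then c b else 0"]) simp
qed

lemma uspan_add:
  assumes "f \<in> uspan J B" "g \<in> uspan J B"
  shows "uadd f g \<in> uspan J B"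
proof -
  obtain c d where "f = (\<lambda>x. \<Sum>b\<in>B. hs (c b) (b x))" "g = (\<lambda>x. \<Sum>b\<in>B. hs (d b) (b x))"
    using assms by (auto simp: uspan_def)
  hence "uadd f g = (\<lambda>x. \<Sum>b\<in>B. hs (c b + d b) (b x))"
    by (simp add: uadd_def cv.scale_left_distrib sum.distrib)
  thus ?thesis unfolding uspan_def by (intro CollectI exI[of _ "\<lambda>b. c b + d b"]) simp
qed

lemma op_rank_le_add:
  assumes "op_rank_le J E G m" "op_rank_le J E H n"
  shows "op_rank_le J E (\<lambda>f. uadd (G f) (H f)) (m + n)"
proof -
  obtain B C where B: "finite B" "card B \<le> m" "G ` fst E \<subseteq> uspan J B"
    and C: "finite C" "card C \<le> n" "H ` fst E \<subseteq> uspan J C" using assms by (auto simp: op_rank_le_def)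
  have "uadd (G f) (H f) \<in> uspan J (B \<union> C)" if "f \<in> fst E" for f
    using B C that uspan_mono[of "B \<union> C" B "G f"] uspan_mono[of "B \<union> C" C "H f"]
    by (intro uspan_add) auto
  moreover have "card (B \<union> C) \<le> m + n" using card_Un_le[of B C] B C by linarith
  ultimately show ?thesis unfolding op_rank_le_def using B C by (intro exI[of _ "B \<union> C"]) auto
qed

lemma op_rank_le_mono: "op_rank_le J E G m \<Longrightarrow> m \<le> n \<Longrightarrow> op_rank_le J E G n"
  unfolding op_rank_le_def using order_trans by blast

text \<open>Says that the approximation number of \<open>\<Psi>\<close> with index \<open>n\<close>
  is at most \<open>\<epsilon>\<close>, with an actual approximant. \<open>\<Psi>\<close> is a bare
  formula, unconstrained outside \<open>E\<close>, so terms can be added without carrying the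
  default value of \<open>elem_op\<close> along.\<close>

definition approximable :: "'h bspace \<Rightarrow> (('h \<Rightarrow> 'h) \<Rightarrow> 'h \<Rightarrow> 'h) \<Rightarrow> nat \<Rightarrow> real \<Rightarrow> bool" where
  "approximable E \<Psi> n \<epsilon> \<longleftrightarrow> (\<exists>G. is_bop J E E G \<and> op_rank_le J E G n \<and>
     (\<forall>X\<in>fst E. \<forall>x. norm (\<Psi> X x - G X x) \<le> \<epsilon> * onorm X * norm x))"

lemma approximable_mono:
  assumes E: "opspace E" and "approximable E \<Psi> m a" "m \<le> n" "a \<le> b"
  shows "approximable E \<Psi> n b"
proof -
  obtain G where G: "is_bop J E E G" "op_rank_le J E G m"
    "\<And>X x. X \<in> fst E \<Longrightarrow> norm (\<Psi> X x - G X x) \<le> a * onorm X * norm x"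
    using assms(2) by (auto simp: approximable_def)
  have "norm (\<Psi> X x - G X x) \<le> b * onorm X * norm x" if X: "X \<in> fst E" for X x
    using G(3)[OF X, of x] mult_right_mono[OF mult_right_mono[OF assms(4)], of "onorm X" "norm x"]
      Bop_onorm_nonneg[OF opspace_Bop[OF E X]] by simp
  thus ?thesis unfolding approximable_def using G op_rank_le_mono[OF G(2) assms(3)] by blast
qed

lemma zero_is_bop:
  assumes E: "opspace E"
  shows "is_bop J E E (\<lambda>f. uzero)" "op_rank_le J E (\<lambda>f. uzero) n"
proof -
  show "is_bop J E E (\<lambda>f. uzero)"
  proof (rule is_bopI[where K = 0])
    show "uzero \<in> fst E" using opspace_is_bspace[OF E] by (auto simp: is_bspace_def split: prod.splits)
  qed (simp_all add: uadd_def uzero_def uscale_def opspace_norm[OF E] onorm_zero)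
  show "op_rank_le J E (\<lambda>f. uzero) n" unfolding op_rank_le_def
    by (intro exI[of _ "{}"]) (auto simp: uspan_def uzero_def)
qed

lemma approximable_zero:
  assumes E: "opspace E" and le: "\<And>X x. X \<in> fst E \<Longrightarrow> norm (\<Psi> X x) \<le> \<epsilon> * onorm X * norm x"
  shows "approximable E \<Psi> n \<epsilon>"
  unfolding approximable_def using zero_is_bop[OF E] le by (intro exI[of _ "\<lambda>f. uzero"]) (simp add: uzero_def)

lemma approximable_add:
  assumes E: "opspace E" and "approximable E \<Psi> m a" "approximable E \<Theta> n b"
  shows "approximable E (\<lambda>X x. \<Psi> X x + \<Theta> X x) (m + n) (a + b)"
proof -
  obtain G H where G: "is_bop J E E G" "op_rank_le J E G m"
    "\<And>X x. X \<in> fst E \<Longrightarrow> norm (\<Psi> X x - G X x) \<le> a * onorm X * norm x"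
    and H: "is_bop J E E H" "op_rank_le J E H n"
    "\<And>X x. X \<in> fst E \<Longrightarrow> norm (\<Theta> X x - H X x) \<le> b * onorm X * norm x"
    using assms(2,3) by (auto simp: approximable_def)
  have Eb: "is_bspace J E" by (rule opspace_is_bspace[OF E])
  have "is_bop J E E (\<lambda>f. uadd (G f) (H f))"
  proof -
    obtain KG KH where K: "\<And>f. f \<in> fst E \<Longrightarrow> snd E (G f) \<le> KG * snd E f" "\<And>f. f \<in> fst E \<Longrightarrow> snd E (H f) \<le> KH * snd E f"
    proof -
      have "\<exists>K. \<forall>f\<in>fst E. snd E (T f) \<le> K * snd E f" if "is_bop J E E T" for T
        using that by (cases E) (simp add: is_bop_def)
      from this[OF G(1)] this[OF H(1)] show ?thesis using that by metis
    qed
    have V: "G f \<in> fst E" "H f \<in> fst E" if "f \<in> fst E" for f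
      using G(1) H(1) that unfolding is_bop_def by (auto split: prod.splits)
    show ?thesis
    proof (rule is_bopI[where K = "KG + KH"])
      show "uadd (G f) (H f) \<in> fst E" if "f \<in> fst E" for f
        using V[OF that] Eb unfolding is_bspace_def by (auto split: prod.splits)
      show "uadd (G f) (H f) = uzero" if "f \<notin> fst E" for f
        using G(1) H(1) that unfolding is_bop_def by (auto split: prod.splits simp: uadd_def uzero_def)
      show "uadd (G (uadd f g)) (H (uadd f g)) = uadd (uadd (G f) (H f)) (uadd (G g) (H g))"
        if "f \<in> fst E" "g \<in> fst E" for f g
        using G(1) H(1) that unfolding is_bop_def
        by (auto split: prod.splits simp: uadd_def fun_eq_iff)
      show "uadd (G (uscale J c f)) (H (uscale J c f)) = uscale J c (uadd (G f) (H f))"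
        if "f \<in> fst E" for c f
        using G(1) H(1) that unfolding is_bop_def
        by (auto split: prod.splits simp: uadd_def uscale_def fun_eq_iff cv.scale_right_distrib)
      show "snd E (uadd (G f) (H f)) \<le> (KG + KH) * snd E f" if f: "f \<in> fst E" for f
      proof -
        have "snd E (uadd (G f) (H f)) \<le> snd E (G f) + snd E (H f)"
          using V[OF f] Eb unfolding is_bspace_def by (auto split: prod.splits)
        thus ?thesis using K[OF f] by (simp add: distrib_right)
      qed
    qed
  qed
  moreover have "norm (\<Psi> X x + \<Theta> X x - uadd (G X) (H X) x) \<le> (a + b) * onorm X * norm x" if "X \<in> fst E" for X x
  proof -
    have "norm (\<Psi> X x + \<Theta> X x - uadd (G X) (H X) x) = norm ((\<Psi> X x - G X x) + (\<Theta> X x - H X x))"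
      by (simp add: uadd_def algebra_simps)
    also have "\<dots> \<le> norm (\<Psi> X x - G X x) + norm (\<Theta> X x - H X x)" by (rule norm_triangle_ineq)
    finally show ?thesis using G(3)[OF that, of x] H(3)[OF that, of x] by (simp add: distrib_right)
  qed
  ultimately show ?thesis unfolding approximable_def using op_rank_le_add[OF G(2) H(2)] by blast
qed

section \<open>Truncation of singular value expansions along hyperbolas\<close>

lemma norm_block_le:
  assumes A: "A \<in> Bop J" and S: "finite S" and o: "orthsys v S"
    and AA: "\<And>i j. i \<in> S \<Longrightarrow> j \<in> S \<Longrightarrow> i \<noteq> j \<Longrightarrow> cip (A (v i)) (A (v j)) = 0"
    and c: "\<And>i. i \<in> S \<Longrightarrow> norm (A (v i)) \<le> c" "0 \<le> c"
  shows "norm (A (proj v S y)) \<le> c * norm (proj v S y)"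
proof -
  have "A (proj v S y) = (\<Sum>i\<in>S. hs (cip y (v i)) (A (v i)))"
    by (simp add: proj_def Bop_sum[OF A] Bop_hs[OF A])
  hence "(norm (A (proj v S y)))\<^sup>2 = (\<Sum>i\<in>S. (cmod (cip y (v i)))\<^sup>2 * (norm (A (v i)))\<^sup>2)"
    using norm_sum_orth[OF S AA] by simp
  also have "\<dots> \<le> (\<Sum>i\<in>S. (cmod (cip y (v i)))\<^sup>2 * c\<^sup>2)"
    using c by (intro sum_mono mult_left_mono power_mono) auto
  also have "\<dots> = (c * norm (proj v S y))\<^sup>2"
    by (simp add: norm_proj_sq[OF S o] power_mult_distrib sum_distrib_left mult.commute)
  finally show ?thesis by (rule power2_le_imp_le) (simp add: c(2))
qed

text \<open>All pairs of singular vectors whose levels add up to \<open>M\<close>: for different levels of the left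
  factor both the ranges and the supports of the blocks are orthogonal, so their sum has the norm
  of the largest block and no factor counting the blocks occurs.\<close>
lemma antidiagonal_blocks:
  fixes v w :: "nat \<Rightarrow> 'h" and p q :: "nat \<Rightarrow> nat"
  assumes A: "A \<in> Bop J" and B: "B \<in> Bop J" and X: "X \<in> Bop J"
    and v: "orthsys v UNIV" "\<And>i j. i \<noteq> j \<Longrightarrow> cip (A (v i)) (A (v j)) = 0"
    and w: "orthsys w UNIV" "\<And>i j. i \<noteq> j \<Longrightarrow> cip (B (w i)) (B (w j)) = 0"
    and p: "\<And>k. k < K \<Longrightarrow> p k \<le> M \<and> norm (A (v k)) \<le> C / 2 ^ p k"
    and q: "\<And>l. l < L \<Longrightarrow> norm (B (w l)) \<le> C / 2 ^ q l" and C: "0 \<le> C"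
  shows "norm (\<Sum>(k, l)\<in>{(k, l). k < K \<and> l < L \<and> p k + q l = M}.
      hs (cip z (w l) * cip (X (B (w l))) (v k)) (A (v k))) \<le> C\<^sup>2 / 2 ^ M * onorm X * norm z"
proof -
  define T where "T = {(k, l). k < K \<and> l < L \<and> p k + q l = M}"
  define g where "g = (\<lambda>(k, l). hs (cip z (w l) * cip (X (B (w l))) (v k)) (A (v k)))"
  define P where "P i = {k. k < K \<and> p k = i}" for i
  \<comment> \<open>Truncated subtraction does no harm, since only \<open>i \<le> M\<close> occurs;
    there \<open>M - i\<close> is the level complementary to \<open>i\<close>.\<close>
  define Q where "Q i = {l. l < L \<and> q l = M - i}" for i
  define Y where "Y i = A (proj v (P i) (X (B (proj w (Q i) z))))" for i
  have finP: "finite (P i)" and finQ: "finite (Q i)" for i by (auto simp: P_def Q_def)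
  have ov: "orthsys v S" and ow: "orthsys w S" for S
    using orthsys_subset[OF v(1)] orthsys_subset[OF w(1)] by auto
  have finT: "finite T" by (rule finite_subset[of _ "{..<K} \<times> {..<L}"]) (auto simp: T_def)
  have Y_eq: "Y i = (\<Sum>x\<in>P i \<times> Q i. g x)" for i
  proof -
    have "Y i = (\<Sum>k\<in>P i. hs (cip (X (B (proj w (Q i) z))) (v k)) (A (v k)))"
      by (simp add: Y_def proj_def[of v] Bop_sum[OF A] Bop_hs[OF A])
    also have "\<dots> = (\<Sum>k\<in>P i. \<Sum>l\<in>Q i. g (k, l))"
      by (intro sum.cong refl)
        (simp add: proj_def Bop_sum[OF B] Bop_hs[OF B] Bop_sum[OF X] Bop_hs[OF X] cip_sum_left cip_hs_left
          cv.scale_sum_left g_def)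
    finally show ?thesis by (simp add: sum.cartesian_product)
  qed
  have "sum g T = (\<Sum>i\<le>M. \<Sum>x\<in>{x\<in>T. p (fst x) = i}. g x)"
    using p by (intro sum.group[symmetric, OF finT]) (auto simp: T_def)
  also have "\<dots> = (\<Sum>i\<le>M. Y i)"
    by (intro sum.cong refl) (auto simp: Y_eq T_def P_def Q_def intro!: sum.cong)
  finally have sumT: "sum g T = (\<Sum>i\<le>M. Y i)" .
  \<comment> \<open>The two level bounds multiply to the same power of 2 for every \<open>i\<close>.
    The part of \<open>z\<close> seen by the block is retained rather than estimated by
    \<open>norm z\<close>, so that the blocks can be summed by Bessel.\<close>
  have Yi: "(norm (Y i))\<^sup>2 \<le> (C\<^sup>2 / 2 ^ M * onorm X)\<^sup>2 * (\<Sum>l\<in>Q i. (cmod (cip z (w l)))\<^sup>2)" if i: "i \<le> M" for i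
  proof -
    have "norm (Y i) \<le> C / 2 ^ i * norm (proj v (P i) (X (B (proj w (Q i) z))))"
      unfolding Y_def by (rule norm_block_le[OF A finP ov]) (use v p C in \<open>auto simp: P_def\<close>)
    also have "\<dots> \<le> C / 2 ^ i * norm (X (B (proj w (Q i) z)))"
      using C by (intro mult_left_mono norm_proj_le[OF finP ov]) auto
    also have "\<dots> \<le> C / 2 ^ i * (onorm X * norm (B (proj w (Q i) z)))"
      using C by (intro mult_left_mono Bop_norm_le[OF X]) auto
    also have "\<dots> \<le> C / 2 ^ i * (onorm X * (C / 2 ^ (M - i) * norm (proj w (Q i) z)))"
    proof -
      have "norm (B (proj w (Q i) z)) \<le> C / 2 ^ (M - i) * norm (proj w (Q i) z)"
      proof (rule norm_block_le[OF B finQ ow])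
        show "norm (B (w l)) \<le> C / 2 ^ (M - i)" if "l \<in> Q i" for l using that q[of l] by (auto simp: Q_def)
      qed (use w C in auto)
      thus ?thesis using C Bop_onorm_nonneg[OF X] by (intro mult_left_mono) auto
    qed
    also have "\<dots> = C\<^sup>2 / (2 ^ i * 2 ^ (M - i)) * onorm X * norm (proj w (Q i) z)"
      by (simp add: power2_eq_square)
    also have "2 ^ i * 2 ^ (M - i) = (2::real) ^ M" using i by (simp flip: power_add)
    finally have "(norm (Y i))\<^sup>2 \<le> (C\<^sup>2 / 2 ^ M * onorm X * norm (proj w (Q i) z))\<^sup>2" by (intro power_mono) auto
    thus ?thesis unfolding power_mult_distrib[of _ "norm _"] norm_proj_sq[OF finQ ow] .
  qed
  have "(norm (sum g T))\<^sup>2 = (\<Sum>i\<le>M. (norm (Y i))\<^sup>2)" unfolding sumT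
  proof (rule norm_sum_Pythagorean)
    \<comment> \<open>Different \<open>i\<close> involve disjoint sets of vectors
      \<open>v k\<close>, whose images under \<open>A\<close> are orthogonal.\<close>
    have "cip (Y i) (Y j) = 0" if "i \<noteq> j" for i j
    proof -
      have "cip (A (v k)) (A (v l)) = 0" if "k \<in> P i" "l \<in> P j" for k l
        using that \<open>i \<noteq> j\<close> by (intro v(2)) (auto simp: P_def)
      thus ?thesis
        by (auto simp: Y_def proj_def[of v] Bop_sum[OF A] Bop_hs[OF A] cip_sum_left cip_sum_right cip_hs_left
            cip_hs_right intro!: sum.neutral)
    qed
    thus "pairwise (\<lambda>i j. orthogonal (Y i) (Y j)) {..M}"
      by (auto simp: pairwise_def orthogonal_def dest: cip_eq_0D)
  qed simp
  also have "\<dots> \<le> (\<Sum>i\<le>M. (C\<^sup>2 / 2 ^ M * onorm X)\<^sup>2 * (\<Sum>l\<in>Q i. (cmod (cip z (w l)))\<^sup>2))"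
    by (intro sum_mono Yi) simp
  \<comment> \<open>The sets \<open>Q i\<close> are disjoint because \<open>M - i\<close> determines
    \<open>i\<close> when \<open>i \<le> M\<close>.\<close>
  also have "\<dots> = (C\<^sup>2 / 2 ^ M * onorm X)\<^sup>2 * (\<Sum>l\<in>(\<Union>i\<le>M. Q i). (cmod (cip z (w l)))\<^sup>2)"
    unfolding sum_distrib_left[symmetric]
    by (subst sum.UNION_disjoint) (auto simp: finQ, auto simp: Q_def)
  also have "\<dots> \<le> (C\<^sup>2 / 2 ^ M * onorm X)\<^sup>2 * (norm z)\<^sup>2"
    by (intro mult_left_mono bessel ow) (auto simp: finQ)
  finally have "(norm (sum g T))\<^sup>2 \<le> (C\<^sup>2 / 2 ^ M * onorm X * norm z)\<^sup>2"
    unfolding power_mult_distrib[of _ "norm z"] .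
  hence "norm (sum g T) \<le> C\<^sup>2 / 2 ^ M * onorm X * norm z"
    by (rule power2_le_imp_le) (simp add: Bop_onorm_nonneg[OF X])
  thus ?thesis by (simp add: g_def T_def)
qed

lemma sum_geometric_tail: "(\<Sum>M=N..<N+n. 1 / (2::real) ^ M) \<le> 2 / 2 ^ N"
proof -
  have "(\<Sum>M=N..<N+n. 1 / (2::real) ^ M) = 2 / 2 ^ N - 2 / 2 ^ (N + n)"
    by (induction n) (auto simp: power_add field_simps)
  thus ?thesis by simp
qed

text \<open>The factor 4 collects one unit for cutting off \<open>A\<close> at \<open>K\<close>, one
  for cutting off \<open>B\<close> at \<open>L\<close>, and two for the geometric series over the
  antidiagonals \<open>M \<ge> N\<close>. The kept pairs lie under a hyperbola: the product of their
  singular values is large.\<close>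

lemma hyperbolic_truncation:
  fixes v w :: "nat \<Rightarrow> 'h"
  assumes A: "A \<in> Bop J" and B: "B \<in> Bop J" and X: "X \<in> Bop J"
    and v: "orthsys v UNIV" "\<And>i j. i \<noteq> j \<Longrightarrow> cip (A (v i)) (A (v j)) = 0"
      "\<And>n x. norm (A (x - proj v {..<n} x)) \<le> norm (A (v n)) * norm x"
    and w: "orthsys w UNIV" "\<And>i j. i \<noteq> j \<Longrightarrow> cip (B (w i)) (B (w j)) = 0"
      "\<And>n x. norm (B (x - proj w {..<n} x)) \<le> norm (B (w n)) * norm x"
    and C: "0 \<le> C" "\<And>x. norm (A x) \<le> C * norm x" "\<And>x. norm (B x) \<le> C * norm x"
    and p: "\<And>k. k < K \<Longrightarrow> p k < N \<and> norm (A (v k)) \<le> C / 2 ^ p k" "norm (A (v K)) \<le> C / 2 ^ N"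
    and q: "\<And>l. l < L \<Longrightarrow> q l < N \<and> norm (B (w l)) \<le> C / 2 ^ q l" "norm (B (w L)) \<le> C / 2 ^ N"
  shows "norm (A (X (B z)) - (\<Sum>(k, l)\<in>{(k, l). k < K \<and> l < L \<and> p k + q l < N}.
      hs (cip z (w l) * cip (X (B (w l))) (v k)) (A (v k)))) \<le> 4 * C\<^sup>2 / 2 ^ N * onorm X * norm z"
proof -
  define g where "g = (\<lambda>(k, l). hs (cip z (w l) * cip (X (B (w l))) (v k)) (A (v k)))"
  define S where "S = {(k, l). k < K \<and> l < L \<and> p k + q l < N}"
  define R where "R = {(k, l). k < K \<and> l < L \<and> N \<le> p k + q l}"
  define P where "P = proj v {..<K}"
  define Q where "Q = proj w {..<L}"
  have ov: "orthsys v S" and ow: "orthsys w S" for S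
    using orthsys_subset[OF v(1)] orthsys_subset[OF w(1)] by auto
  have SR: "{..<K} \<times> {..<L} = S \<union> R" "S \<inter> R = {}" by (auto simp: S_def R_def)
  have fin: "finite S" "finite R" using SR(1) by (metis finite_Un finite_SigmaI finite_lessThan)+
  have X0: "0 \<le> onorm X" by (rule Bop_onorm_nonneg[OF X])
  have "A (P (X (B (Q z)))) = (\<Sum>k<K. \<Sum>l<L. g (k, l))"
    by (simp add: P_def Q_def proj_def Bop_sum[OF A] Bop_hs[OF A] Bop_sum[OF B] Bop_hs[OF B] Bop_sum[OF X]
        Bop_hs[OF X] cip_sum_left cip_hs_left cv.scale_sum_left g_def)
  also have "\<dots> = sum g S + sum g R" using fin SR by (simp add: sum.cartesian_product sum.union_disjoint)
  finally have main: "A (P (X (B (Q z)))) = sum g S + sum g R" .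
  have R: "norm (sum g R) \<le> 2 * C\<^sup>2 / 2 ^ N * onorm X * norm z"
  proof -
    \<comment> \<open>All levels are below \<open>N\<close>, so two of them add up to less than
      \<open>N + N\<close>.\<close>
    have "sum g R = (\<Sum>M=N..<N+N. \<Sum>x\<in>{x\<in>R. p (fst x) + q (snd x) = M}. g x)"
    proof (rule sum.group[symmetric, OF fin(2)])
      show "(\<lambda>x. p (fst x) + q (snd x)) ` R \<subseteq> {N..<N+N}"
        using p(1) q(1) by (auto simp: R_def add_strict_mono)
    qed simp
    also have "\<dots> = (\<Sum>M=N..<N+N. sum g {(k, l). k < K \<and> l < L \<and> p k + q l = M})"
      by (intro sum.cong refl) (auto simp: R_def)
    also have "norm \<dots> \<le> (\<Sum>M=N..<N+N. C\<^sup>2 / 2 ^ M * onorm X * norm z)"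
    proof (rule sum_norm_le)
      fix M assume M: "M \<in> {N..<N+N}"
      show "norm (sum g {(k, l). k < K \<and> l < L \<and> p k + q l = M}) \<le> C\<^sup>2 / 2 ^ M * onorm X * norm z"
        unfolding g_def
        by (rule antidiagonal_blocks[OF A B X v(1,2) w(1,2)]) (use p(1) q(1) C(1) M in \<open>auto dest!: p(1)\<close>)
    qed
    also have "\<dots> = (\<Sum>M=N..<N+N. 1 / 2 ^ M) * (C\<^sup>2 * onorm X * norm z)"
      by (simp add: sum_distrib_right)
    also have "\<dots> \<le> 2 / 2 ^ N * (C\<^sup>2 * onorm X * norm z)"
      using X0 by (intro mult_right_mono sum_geometric_tail) auto
    finally show ?thesis by (simp add: mult_ac)
  qed
  have 1: "norm (A (X (B z) - P (X (B z)))) \<le> C\<^sup>2 / 2 ^ N * onorm X * norm z"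
  proof -
    have "norm (A (X (B z) - P (X (B z)))) \<le> norm (A (v K)) * norm (X (B z))" unfolding P_def by (rule v(3))
    also have "\<dots> \<le> (C / 2 ^ N) * (onorm X * (C * norm z))"
      using C(1) X0 p(2) by (intro mult_mono order_trans[OF Bop_norm_le[OF X]] mult_left_mono C(3)) auto
    finally show ?thesis by (simp add: power2_eq_square mult_ac)
  qed
  have 2: "norm (A (P (X (B (z - Q z))))) \<le> C\<^sup>2 / 2 ^ N * onorm X * norm z"
  proof -
    have "norm (A (P (X (B (z - Q z))))) \<le> C * norm (P (X (B (z - Q z))))" by (rule C(2))
    also have "\<dots> \<le> C * norm (X (B (z - Q z)))"
      unfolding P_def by (intro mult_left_mono norm_proj_le ov C(1)) simp
    also have "\<dots> \<le> C * (onorm X * norm (B (z - Q z)))" by (intro mult_left_mono Bop_norm_le[OF X] C(1))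
    also have "\<dots> \<le> C * (onorm X * (norm (B (w L)) * norm z))"
      unfolding Q_def by (intro mult_left_mono w(3) X0 C(1))
    also have "\<dots> \<le> C * (onorm X * (C / 2 ^ N * norm z))"
      using q(2) by (intro mult_left_mono mult_right_mono X0 C(1)) auto
    finally show ?thesis by (simp add: power2_eq_square mult_ac)
  qed
  have PB: "P \<in> Bop J" unfolding P_def by (rule proj_Bop)
  \<comment> \<open>The first two terms are the errors of inserting \<open>P\<close> and
    \<open>Q\<close>; of the doubly projected term, the part not in \<open>sum g S\<close> is the
    tail \<open>sum g R\<close>.\<close>
  have "A (X (B z)) - sum g S = A (X (B z) - P (X (B z))) + A (P (X (B (z - Q z)))) + sum g R"
    using main by (simp add: Bop_diff[OF A] Bop_diff[OF B] Bop_diff[OF X] Bop_diff[OF PB])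
  also have "norm \<dots> \<le> norm (A (X (B z) - P (X (B z)))) + norm (A (P (X (B (z - Q z))))) + norm (sum g R)"
    by (rule order_trans[OF norm_triangle_ineq]) (simp add: norm_triangle_ineq)
  also have "\<dots> \<le> 4 * (C\<^sup>2 / 2 ^ N * onorm X * norm z)" using 1 2 R by simp
  finally show ?thesis by (simp add: g_def S_def)
qed

lemma first_below_level:
  fixes f :: "nat \<Rightarrow> real"
  assumes f: "f \<longlonglongrightarrow> 0" "\<And>k. f k \<le> C" and C: "0 < C"
  obtains K p where "f K \<le> C / 2 ^ N" "\<And>k. k < K \<Longrightarrow> p k < N \<and> C / 2 ^ Suc (p k) < f k \<and> f k \<le> C / 2 ^ p k"
proof -
  have "eventually (\<lambda>k. f k < C / 2 ^ N) sequentially" using order_tendstoD(2)[OF f(1)] C by simp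
  then obtain k where "f k \<le> C / 2 ^ N" by (meson eventually_sequentially order_refl less_imp_le)
  define K where "K = (LEAST k. f k \<le> C / 2 ^ N)"
  have K: "f K \<le> C / 2 ^ N" unfolding K_def using \<open>f k \<le> C / 2 ^ N\<close> by (rule LeastI)
  have "\<exists>p. p < N \<and> C / 2 ^ Suc p < f k \<and> f k \<le> C / 2 ^ p" if "k < K" for k
  proof -
    have gt: "C / 2 ^ N < f k" using that not_less_Least unfolding K_def by (meson not_le)
    hence pos: "0 < f k" using C by (meson divide_pos_pos less_trans zero_less_numeral zero_less_power)
    obtain p where p: "C / 2 ^ Suc p < f k" "f k \<le> C / 2 ^ p" using dyadic_level[OF pos f(2)] by blast
    have "C / 2 ^ N < C / 2 ^ p" using gt p(2) by simp
    hence "(2::real) ^ p < 2 ^ N" using C by (simp add: field_simps)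
    hence "p < N" by simp
    thus ?thesis using p by blast
  qed
  thus ?thesis using that[OF K] by metis
qed

text \<open>Origin of 16: the truncation error \<open>4 * C\<^sup>2 / 2 ^ N\<close> is 8 times the
  threshold \<open>C\<^sup>2 / 2 / 2 ^ N\<close> used for counting pairs, and rounding to a dyadic
  \<open>N\<close> costs another factor 2.\<close>

lemma approximable_mult:
  assumes E: "opspace E" and A: "A \<in> Bop J" and B: "B \<in> Bop J"
    and lim: "approx_num J A \<longlonglongrightarrow> 0" "approx_num J B \<longlonglongrightarrow> 0"
    and \<delta>: "16 * dstar (\<lambda>(k, l). sing_seq J A k * sing_seq J B l) n < \<delta>"
  shows "approximable E (\<lambda>X x. A (X (B x))) n \<delta>"
proof -
  \<comment> \<open>A common bound for both operators; the \<open>+ 1\<close> keeps it positive when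
    both vanish.\<close>
  define C where "C = onorm A + onorm B + 1"
  have nn: "0 \<le> onorm A" "0 \<le> onorm B" by (rule Bop_onorm_nonneg, fact)+
  have C: "0 < C" using nn by (simp add: C_def)
  have AC: "norm (A x) \<le> C * norm x" and BC: "norm (B x) \<le> C * norm x" for x
  proof -
    have "onorm A * norm x \<le> C * norm x" "onorm B * norm x \<le> C * norm x"
      using nn by (auto simp: C_def intro!: mult_right_mono)
    thus "norm (A x) \<le> C * norm x" "norm (B x) \<le> C * norm x"
      using Bop_norm_le[OF A, of x] Bop_norm_le[OF B, of x] by linarith+
  qed
  define d where "d = (\<lambda>(k, l). sing_seq J A k * sing_seq J B l)"
  have le0: "approx_num J T k \<le> onorm T" if "T \<in> Bop J" for T k
    using approx_num_le[OF that Bop_zero rank_le_zero] by simp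
  have d_eq: "cmod (d (k, l)) = approx_num J A k * approx_num J B l" for k l
    using approx_num_nonneg[OF A] approx_num_nonneg[OF B] by (simp add: d_def sing_seq_def norm_mult)
  have d_bdd: "cmod (d x) \<le> onorm A * onorm B" for x
    using d_eq[of "fst x" "snd x"]
      mult_mono[OF le0[OF A, of "fst x"] le0[OF B, of "snd x"] nn(1) approx_num_nonneg[OF B]] by simp
  have t0: "0 < \<delta> / 16" using dstar_nonneg[of d, OF d_bdd, of n] \<delta> by (simp add: d_def)
  have ABX: "norm (A (X (B x))) \<le> C\<^sup>2 * onorm X * norm x" if X: "X \<in> Bop J" for X x
  proof -
    have "norm (A (X (B x))) \<le> C * norm (X (B x))" by (rule AC)
    also have "\<dots> \<le> C * (onorm X * (C * norm x))"
      using C Bop_onorm_nonneg[OF X]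
      by (intro mult_left_mono order_trans[OF Bop_norm_le[OF X]] BC) auto
    finally show ?thesis by (simp add: power2_eq_square mult_ac)
  qed
  show ?thesis
  proof (cases "\<delta> / 16 \<le> C\<^sup>2 / 2")
    case False
    \<comment> \<open>For such a large \<open>\<delta>\<close> the zero operator already
      approximates well enough.\<close>
    hence "C\<^sup>2 \<le> \<delta>" using t0 by simp
    have "approximable E (\<lambda>X x. A (X (B x))) n (C\<^sup>2)"
      by (rule approximable_zero[OF E ABX[OF opspace_Bop[OF E]]])
    thus ?thesis by (rule approximable_mono[OF E]) (use \<open>C\<^sup>2 \<le> \<delta>\<close> in auto)
  next
    case True
    from dyadic_level[OF t0 True] obtain N where N: "C\<^sup>2 / 2 / 2 ^ Suc N < \<delta> / 16" "\<delta> / 16 \<le> C\<^sup>2 / 2 / 2 ^ N" by blast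
    have "dstar d n < C\<^sup>2 / 2 / 2 ^ N" using \<delta> N(2) by (simp add: d_def)
    from dstar_lessD[OF d_bdd this] obtain F where F: "finite F" "card F \<le> n"
      "\<And>x. x \<notin> F \<Longrightarrow> cmod (d x) < C\<^sup>2 / 2 / 2 ^ N" by blast
    obtain v :: "nat \<Rightarrow> 'h" where v: "orthsys v UNIV" "\<And>i j. i \<noteq> j \<Longrightarrow> cip (A (v i)) (A (v j)) = 0"
      "\<And>n x. norm (A (x - proj v {..<n} x)) \<le> norm (A (v n)) * norm x"
      using svd_exists[OF A null_approx_num_compact[OF A lim(1)]] by blast
    obtain w :: "nat \<Rightarrow> 'h" where w: "orthsys w UNIV" "\<And>i j. i \<noteq> j \<Longrightarrow> cip (B (w i)) (B (w j)) = 0"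
      "\<And>n x. norm (B (x - proj w {..<n} x)) \<le> norm (B (w n)) * norm x"
      using svd_exists[OF B null_approx_num_compact[OF B lim(2)]] by blast
    have Av: "norm (A (v k)) \<le> approx_num J A k" for k by (rule svd_le_approx_num[OF A v])
    have Bw: "norm (B (w k)) \<le> approx_num J B k" for k by (rule svd_le_approx_num[OF B w])
    have limA: "(\<lambda>k. norm (A (v k))) \<longlonglongrightarrow> 0"
      by (rule tendsto_sandwich[OF _ _ tendsto_const lim(1)]) (use Av in auto)
    have limB: "(\<lambda>k. norm (B (w k))) \<longlonglongrightarrow> 0"
      by (rule tendsto_sandwich[OF _ _ tendsto_const lim(2)]) (use Bw in auto)
    have AvC: "norm (A (v k)) \<le> C" for k using Av[of k] le0[OF A, of k] nn by (simp add: C_def)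
    have BwC: "norm (B (w k)) \<le> C" for k using Bw[of k] le0[OF B, of k] nn by (simp add: C_def)
    obtain K p where K: "norm (A (v K)) \<le> C / 2 ^ N"
      and p: "\<And>k. k < K \<Longrightarrow> p k < N \<and> C / 2 ^ Suc (p k) < norm (A (v k)) \<and> norm (A (v k)) \<le> C / 2 ^ p k"
      using first_below_level[OF limA AvC C] by blast
    obtain L q where L: "norm (B (w L)) \<le> C / 2 ^ N"
      and q: "\<And>k. k < L \<Longrightarrow> q k < N \<and> C / 2 ^ Suc (q k) < norm (B (w k)) \<and> norm (B (w k)) \<le> C / 2 ^ q k"
      using first_below_level[OF limB BwC C] by blast
    define S where "S = {(k, l). k < K \<and> l < L \<and> p k + q l < N}"
    have S: "finite S" by (rule finite_subset[of _ "{..<K} \<times> {..<L}"]) (auto simp: S_def)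
    \<comment> \<open>Each singular value exceeds half of its dyadic bound, so a pair with level sum
      below \<open>N\<close> has a product of at least the threshold and cannot lie outside the
      exceptional set. This bounds the number of kept pairs by \<open>n\<close>.\<close>
    have "S \<subseteq> F"
    proof (rule subrelI, rule ccontr)
      fix k l assume "(k, l) \<in> S" and notF: "(k, l) \<notin> F"
      hence kl: "k < K" "l < L" "p k + q l < N" by (auto simp: S_def)
      have "C\<^sup>2 / 2 / 2 ^ N \<le> C / 2 ^ Suc (p k) * (C / 2 ^ Suc (q l))"
      proof -
        have "(2::real) ^ (Suc (p k) + Suc (q l)) \<le> 2 ^ Suc N" using kl by (intro power_increasing) auto
        hence "C\<^sup>2 / 2 ^ Suc N \<le> C\<^sup>2 / 2 ^ (Suc (p k) + Suc (q l))" by (intro divide_left_mono) auto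
        thus ?thesis by (simp add: power_add power2_eq_square)
      qed
      also have "\<dots> \<le> approx_num J A k * approx_num J B l"
        using p[OF kl(1)] q[OF kl(2)] Av[of k] Bw[of l] C approx_num_nonneg[OF A] by (intro mult_mono) auto
      also have "\<dots> = cmod (d (k, l))" by (simp add: d_eq)
      also have "\<dots> < C\<^sup>2 / 2 / 2 ^ N" by (rule F(3)[OF notF])
      finally show False by simp
    qed
    hence cardS: "card S \<le> n" using card_mono[OF F(1)] F(2) order_trans by blast
    \<comment> \<open>\<open>X\<close> influences the truncated sum only through the scalars
      \<open>a X\<close>; the operators \<open>b\<close> are fixed, and their number bounds the rank
      of \<open>G\<close>.\<close>
    define b where "b = (\<lambda>(k, l). rank1 (A (v k)) (w l))"
    define a where "a X = (\<lambda>(k, l). cip (X (B (w l))) (v k))" for X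
    define G where "G X = (if X \<in> fst E then (\<lambda>z. \<Sum>x\<in>S. hs (a X x) (b x z)) else uzero)" for X
    have G_err: "norm (A (X (B z)) - G X z) \<le> 4 * C\<^sup>2 / 2 ^ N * onorm X * norm z" if X: "X \<in> fst E" for X z
    proof -
      have "G X z = (\<Sum>(k, l)\<in>S. hs (cip z (w l) * cip (X (B (w l))) (v k)) (A (v k)))"
        using X by (auto simp: G_def a_def b_def rank1_def mult.commute intro!: sum.cong)
      thus ?thesis unfolding S_def
        using hyperbolic_truncation[OF A B opspace_Bop[OF E X] v w less_imp_le[OF C] AC BC, of K p N L q z] p q K L
        by simp
    qed
    have E_add: "uadd f g \<in> fst E" and E_scale: "uscale J c f \<in> fst E" if "f \<in> fst E" "g \<in> fst E" for c f g
      using opspace_is_bspace[OF E] that by (auto simp: is_bspace_def split: prod.splits)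
    have "is_bop J E E G"
    proof (rule is_bopI)
      show "G f \<in> fst E" if "f \<in> fst E" for f
      proof -
        have "(\<lambda>z. \<Sum>x\<in>S. hs (a f x) (b x z)) \<in> fst E"
        proof (rule opspace_sum[OF E])
          show "(\<lambda>z. hs (a f x) (b x z)) \<in> fst E" for x
            by (cases x) (simp add: b_def opspace_scale[OF E] opspace_rank1[OF E])
        qed
        thus ?thesis using that by (simp add: G_def)
      qed
      show "G f = uzero" if "f \<notin> fst E" for f using that by (simp add: G_def)
      show "G (uadd f g) = uadd (G f) (G g)" if "f \<in> fst E" "g \<in> fst E" for f g
      proof -
        have "a (uadd f g) x = a f x + a g x" for x by (cases x) (simp add: a_def uadd_def cip_add_left)
        thus ?thesis using that E_add[OF that] by (simp add: G_def) (simp add: uadd_def cv.scale_left_distrib sum.distrib)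
      qed
      show "G (uscale J c f) = uscale J c (G f)" if "f \<in> fst E" for c f
      proof -
        have "a (uscale J c f) x = c * a f x" for x by (cases x) (simp add: a_def uscale_def cip_hs_left)
        thus ?thesis using that E_scale[OF that that, of c] by (simp add: G_def) (simp add: uscale_def cv.scale_sum_right)
      qed
      \<comment> \<open>Boundedness of \<open>G\<close> follows from that of
        \<open>X \<mapsto> A X B\<close> and the error estimate.\<close>
      show "snd E (G f) \<le> (C\<^sup>2 + 4 * C\<^sup>2 / 2 ^ N) * snd E f" if f: "f \<in> fst E" for f
        unfolding opspace_norm[OF E]
      proof (rule onorm_bound)
        show "0 \<le> (C\<^sup>2 + 4 * C\<^sup>2 / 2 ^ N) * onorm f" using Bop_onorm_nonneg[OF opspace_Bop[OF E f]] by simp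
        show "norm (G f x) \<le> (C\<^sup>2 + 4 * C\<^sup>2 / 2 ^ N) * onorm f * norm x" for x
          using G_err[OF f, of x] ABX[OF opspace_Bop[OF E f], of x] norm_triangle_sub[of "G f x" "A (f (B x))"]
          by (simp add: distrib_right norm_minus_commute)
      qed
    qed
    moreover have "op_rank_le J E G n"
      unfolding op_rank_le_def
    proof (intro exI[of _ "b ` S"] conjI)
      show "card (b ` S) \<le> n" using card_image_le[OF S, of b] cardS by simp
      show "G ` fst E \<subseteq> uspan J (b ` S)" using uspan_image[OF S] by (auto simp: G_def)
    qed (use S in simp)
    ultimately have "approximable E (\<lambda>X x. A (X (B x))) n (4 * C\<^sup>2 / 2 ^ N)"
      unfolding approximable_def using G_err by blast
    thus ?thesis by (rule approximable_mono[OF E]) (use N(1) in \<open>auto simp: field_simps\<close>)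
  qed
qed

text \<open>Induction over the number of terms, carrying a decreasing majorant \<open>g\<close> in
  \<open>I\<close> such that every \<open>\<delta>\<close> above \<open>g n\<close> is reachable
  with rank \<open>n\<close>. Each new term replaces the majorants by their values at
  \<open>n div 2\<close>, so that the two ranks add up to at most \<open>n\<close>.\<close>

lemma s_function_mem_of_coefficients:
  assumes s: "s_function J s" and E: "opspace E" and I: "stable_calkin I"
    and AB: "\<And>i. i < m \<Longrightarrow> A i \<in> Bop J \<and> B i \<in> Bop J"
    and mem: "\<And>i. i < m \<Longrightarrow> sing_seq J (A i) \<in> I \<and> sing_seq J (B i) \<in> I"
  shows "(\<lambda>n. complex_of_real (s E E (elem_op E m A B) n)) \<in> I"
proof -
  have I': "calkin_space I" using I by (simp add: stable_calkin_def)
  have null: "approx_num J T \<longlonglongrightarrow> 0" if "sing_seq J T \<in> I" for T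
  proof -
    have "sing_seq J T \<in> c0" using that I' by (auto simp: calkin_space_def)
    hence "(\<lambda>n. complex_of_real (approx_num J T n)) \<longlonglongrightarrow> 0" by (simp add: c0_def sing_seq_def)
    thus ?thesis using tendsto_of_real_iff[of "approx_num J T" 0, where 'a=complex] by simp
  qed
  have "\<exists>g. decseq g \<and> (\<forall>n. 0 \<le> g n) \<and> (\<lambda>n. complex_of_real (g n)) \<in> I \<and>
      (\<forall>n \<delta>. g n < \<delta> \<longrightarrow> approximable E (\<lambda>X x. \<Sum>i<k. A i (X (B i x))) n \<delta>)" if "k \<le> m" for k
    using that
  proof (induction k)
    case 0
    have "approximable E (\<lambda>X x. 0) n \<delta>" if "0 < \<delta>" for n \<delta>
      by (rule approximable_zero[OF E]) (use that in \<open>simp add: Bop_onorm_nonneg[OF opspace_Bop[OF E]]\<close>)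
    moreover have "(\<lambda>n. 0) \<in> I" using I' by (simp add: calkin_space_def)
    ultimately show ?case by (intro exI[of _ "\<lambda>n. 0"]) (simp add: decseq_def)
  next
    case (Suc k)
    then obtain g where g: "decseq g" "\<And>n. 0 \<le> g n" "(\<lambda>n. complex_of_real (g n)) \<in> I"
      "\<And>n \<delta>. g n < \<delta> \<Longrightarrow> approximable E (\<lambda>X x. \<Sum>i<k. A i (X (B i x))) n \<delta>" by auto
    have k: "A k \<in> Bop J" "B k \<in> Bop J" "sing_seq J (A k) \<in> I" "sing_seq J (B k) \<in> I"
      using AB mem Suc.prems by auto
    define t where "t = (\<lambda>(i, j). sing_seq J (A k) i * sing_seq J (B k) j)"
    define h where "h n = 16 * dstar t n" for n
    obtain MA MB where M: "0 \<le> MA" "\<And>n. cmod (sing_seq J (A k) n) \<le> MA" "\<And>n. cmod (sing_seq J (B k) n) \<le> MB"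
      using c0_bounded k(3,4) I' unfolding calkin_space_def by (metis subsetD)
    have tb: "cmod (t x) \<le> MA * MB" for x
      by (cases x) (simp add: t_def norm_mult mult_mono M)
    have h: "decseq h" "\<And>n. 0 \<le> h n"
      using dstar_antimono[of t, OF tb] dstar_nonneg[of t, OF tb] by (auto simp: h_def decseq_def)
    \<comment> \<open>Stability enters here: \<open>I\<close> contains the tensor product of the
      singular sequences of the two coefficients.\<close>
    have hI: "(\<lambda>n. complex_of_real (h n)) \<in> I"
      using calkin_scale[OF I' seq_tensor_mem[OF I k(3,4)], of 16] by (simp add: seq_tensor_def h_def t_def)
    have happ: "approximable E (\<lambda>X x. A k (X (B k x))) n \<delta>" if "h n < \<delta>" for n \<delta>
      by (rule approximable_mult[OF E k(1,2) null[OF k(3)] null[OF k(4)]]) (use that in \<open>simp add: h_def t_def\<close>)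
    define f where "f n = g (n div 2) + h (n div 2)" for n
    have "decseq f" using g(1) h(1) by (auto simp: f_def decseq_def intro!: add_mono div_le_mono)
    moreover have "0 \<le> f n" for n using g(2) h(2) by (simp add: f_def)
    moreover have "(\<lambda>n. complex_of_real (f n)) \<in> I"
      using calkin_add[OF I' calkin_double[OF I' g(1,2,3)] calkin_double[OF I' h hI]] by (simp add: f_def)
    moreover have "approximable E (\<lambda>X x. \<Sum>i<Suc k. A i (X (B i x))) n \<delta>" if "f n < \<delta>" for n \<delta>
    proof -
      \<comment> \<open>The slack is shared between the two summands, since both approximations need
        a strict inequality.\<close>
      define \<epsilon> where "\<epsilon> = (\<delta> - f n) / 2"
      have \<epsilon>: "0 < \<epsilon>" "g (n div 2) + \<epsilon> + (h (n div 2) + \<epsilon>) = \<delta>" using that by (auto simp: \<epsilon>_def f_def field_simps)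
      have "approximable E (\<lambda>X x. (\<Sum>i<k. A i (X (B i x))) + A k (X (B k x))) (n div 2 + n div 2)
         (g (n div 2) + \<epsilon> + (h (n div 2) + \<epsilon>))"
        using \<epsilon>(1) by (intro approximable_add[OF E] g(4) happ) auto
      thus ?thesis unfolding \<epsilon>(2) sum.lessThan_Suc by (rule approximable_mono[OF E]) auto
    qed
    ultimately show ?case by blast
  qed
  from this[OF order_refl] obtain g where g: "\<And>n. 0 \<le> g n" "(\<lambda>n. complex_of_real (g n)) \<in> I"
      "\<And>n \<delta>. g n < \<delta> \<Longrightarrow> approximable E (\<lambda>X x. \<Sum>i<m. A i (X (B i x))) n \<delta>" by blast
  have Eb: "is_bspace J E" by (rule opspace_is_bspace[OF E])
  have bop: "is_bop J E E (elem_op E m A B)" by (rule elem_op_is_bop[OF E AB])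
  show ?thesis
  proof (rule calkin_mono[OF I' g(2)])
    fix n
    \<comment> \<open>Approximants exist only for errors strictly above \<open>g n\<close>; density
      of the reals closes the gap.\<close>
    have "s E E (elem_op E m A B) n \<le> g n"
    proof (rule dense_ge)
      fix \<delta> assume \<delta>: "g n < \<delta>"
      have \<delta>0: "0 \<le> \<delta>" using g(1)[of n] \<delta> by simp
      obtain G where G: "is_bop J E E G" "op_rank_le J E G n"
        "\<And>X x. X \<in> fst E \<Longrightarrow> norm ((\<Sum>i<m. A i (X (B i x))) - G X x) \<le> \<delta> * onorm X * norm x"
        using g(3)[OF \<delta>] by (auto simp: approximable_def)
      show "s E E (elem_op E m A B) n \<le> \<delta>"
      proof (rule s_function_le[OF s Eb bop G(1,2) \<delta>0])
        fix X assume X: "X \<in> fst E"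
        show "snd E (usub (elem_op E m A B X) (G X)) \<le> \<delta> * snd E X" unfolding opspace_norm[OF E]
          by (rule onorm_bound) (use X G(3)[OF X] \<delta>0 Bop_onorm_nonneg[OF opspace_Bop[OF E X]] in
              \<open>auto simp: usub_def elem_op_def\<close>)
      qed
    qed
    thus "cmod (complex_of_real (s E E (elem_op E m A B) n)) \<le> cmod (complex_of_real (g n))"
      using s_function_basic(2)[OF s Eb Eb bop, of n] by simp
  qed
qed

end

theorem theorem4p6:
  fixes J :: "'h::{real_inner, complete_space} \<Rightarrow> 'h"
    and I :: "(nat \<Rightarrow> complex) set"
    and s :: "'h bspace \<Rightarrow> 'h bspace \<Rightarrow> (('h \<Rightarrow> 'h) \<Rightarrow> ('h \<Rightarrow> 'h)) \<Rightarrow> nat \<Rightarrow> real"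
    and E :: "'h bspace"
    and \<Phi> :: "('h \<Rightarrow> 'h) \<Rightarrow> ('h \<Rightarrow> 'h)"
  assumes "cplx_structure J"
    and "separable_space (euclidean :: 'h topology)"
    and "stable_calkin I"
    and "s_function J s"
    and "E = BH J \<or> E = KH J"
    and "elementary_op J E \<Phi>"
  shows "(\<lambda>n. complex_of_real (s E E \<Phi> n)) \<in> I \<longleftrightarrow>
    (\<exists>m A B. (\<forall>i<m. A i \<in> Bop J \<and> B i \<in> Bop J) \<and> \<Phi> = elem_op E m A B
       \<and> (\<forall>i<m. sing_seq J (A i) \<in> I \<and> sing_seq J (B i) \<in> I))"
proof -
  interpret hilbert J by unfold_locales fact
  have E: "opspace E" using assms(5) by (simp add: opspace_def)
  have I: "calkin_space I" using assms(3) by (simp add: stable_calkin_def)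
  show ?thesis
    using coefficients_of_s_function_mem[OF assms(4) E I assms(6)]
      s_function_mem_of_coefficients[OF assms(4) E assms(3)] by blast
qed

end
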